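(* Every $(P_7,C_4,C_5)$-free graph $G$ satisfies $\chi(G)\leq \lfloor \frac{3}{2}\omega(G)\rfloor$.
   Context: All graphs are finite, simple and nonnull. $P_n$ is the path on $n$ vertices and $C_n$ the cycle on $n$ vertices. A graph is $\mathcal{H}$-free if no induced subgraph of it is isomorphic to a member of $\mathcal{H}$. $\chi(G)$ is the chromatic number and $\omega(G)$ the clique number of $G$. *)

theory Defs
  imports Complex_Main "Graph_Theory.Graph_Theory"
begin

text \<open>
  Finite simple graphs are the loop-free symmetric finite digraphs \<open>pair_graph\<close>: an edge \<open>uv\<close> is
  represented by the two arcs \<open>(u, v)\<close> and \<open>(v, u)\<close>. This locale admits the null graph.
\<close>

definition path_graph :: "nat \<Rightarrow> nat pair_pre_digraph" where
  "path_graph n = \<lparr> pverts = {..<n},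
     parcs = {(i, j). i < n \<and> j < n \<and> (j = Suc i \<or> i = Suc j)} \<rparr>"

text \<open>Meaningful for \<open>n \<ge> 3\<close>; for \<open>n = 1\<close> the definition yields a loop.\<close>

definition cycle_graph :: "nat \<Rightarrow> nat pair_pre_digraph" where
  "cycle_graph n = \<lparr> pverts = {..<n},
     parcs = {(i, j). i < n \<and> j < n \<and> (j = Suc i mod n \<or> i = Suc j mod n)} \<rparr>"

definition family_free :: "'b pair_pre_digraph set \<Rightarrow> 'a pair_pre_digraph \<Rightarrow> bool" where
  "family_free \<H> G \<longleftrightarrow>
     \<not> (\<exists>H. induced_subgraph H (with_proj G) \<and> (\<exists>F\<in>\<H>. digraph_iso H (with_proj F)))"

definition proper_colouring :: "'a pair_pre_digraph \<Rightarrow> nat \<Rightarrow> ('a \<Rightarrow> nat) \<Rightarrow> bool" where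
  "proper_colouring G k c \<longleftrightarrow>
     (\<forall>v\<in>pverts G. c v < k) \<and> (\<forall>(u, v)\<in>parcs G. c u \<noteq> c v)"

definition chromatic_number :: "'a pair_pre_digraph \<Rightarrow> nat" where
  "chromatic_number G = (LEAST k. \<exists>c. proper_colouring G k c)"

definition clique :: "'a pair_pre_digraph \<Rightarrow> 'a set \<Rightarrow> bool" where
  "clique G S \<longleftrightarrow> S \<subseteq> pverts G \<and> (\<forall>u\<in>S. \<forall>v\<in>S. u \<noteq> v \<longrightarrow> (u, v) \<in> parcs G)"

definition clique_number :: "'a pair_pre_digraph \<Rightarrow> nat" where
  "clique_number G = Max (card ` {S. clique G S})"

lemma pair_graph_path_graph: "pair_graph (path_graph n)"
  by unfold_locales
    (auto simp: path_graph_def symmetric_def sym_def intro: finite_subset[of _ "{..<n} \<times> {..<n}"])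

lemma pair_graph_cycle_graph:
  assumes "n \<ge> 3"
  shows "pair_graph (cycle_graph n)"
proof -
  have ne: "Suc i mod n \<noteq> i" if "i < n" for i
    using that assms by (cases "Suc i = n") auto
  show ?thesis
    by unfold_locales
      (use ne in \<open>auto simp: cycle_graph_def symmetric_def sym_def
         intro: finite_subset[of _ "{..<n} \<times> {..<n}"] dest: sym\<close>)
qed

lemma chromatic_number_attained:
  assumes "pair_graph G"
  shows "\<exists>c. proper_colouring G (chromatic_number G) c"
proof -
  interpret pair_graph G by fact
  obtain f :: "_ \<Rightarrow> nat" where f: "bij_betw f (pverts G) {0..<card (pverts G)}"
    using ex_bij_betw_finite_nat[OF pair_finite_verts] by blast
  have "proper_colouring G (card (pverts G)) f"
    unfolding proper_colouring_def
  proof (intro conjI ballI, goal_cases)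
    case (1 v) then show ?case using f by (auto simp: bij_betw_def)
  next
    case (2 e) 
    then have "fst e \<in> pverts G" "snd e \<in> pverts G" "fst e \<noteq> snd e"
      using arc_fst_in_verts arc_snd_in_verts pair_no_loops by auto
    then show ?case using f by (auto simp: bij_betw_def inj_on_def split: prod.split)
  qed
  then show ?thesis
    unfolding chromatic_number_def by (intro LeastI[of "\<lambda>k. \<exists>c. proper_colouring G k c"]) blast
qed

lemma clique_number_attained:
  assumes "pair_graph G"
  shows "\<exists>S. clique G S \<and> card S = clique_number G"
    and "clique G S \<Longrightarrow> card S \<le> clique_number G"
proof -
  interpret pair_graph G by fact
  have fin: "finite {S. clique G S}"
    by (rule finite_subset[of _ "Pow (pverts G)"]) (auto simp: clique_def pair_finite_verts)
  have "clique G {}" by (simp add: clique_def)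
  then have "clique_number G \<in> card ` {S. clique G S}"
    unfolding clique_number_def using fin by (intro Max_in) auto
  then show "\<exists>S. clique G S \<and> card S = clique_number G" by auto
  show "clique G S \<Longrightarrow> card S \<le> clique_number G"
    unfolding clique_number_def using fin by auto
qed

lemma family_free_iff:
  assumes "pair_graph G" and "\<And>F. F \<in> \<H> \<Longrightarrow> pair_graph F"
  shows "family_free \<H> G \<longleftrightarrow>
    \<not> (\<exists>F\<in>\<H>. \<exists>f. inj_on f (pverts F) \<and> f ` pverts F \<subseteq> pverts G \<and>
          (\<forall>u\<in>pverts F. \<forall>v\<in>pverts F. (u, v) \<in> parcs F \<longleftrightarrow> (f u, f v) \<in> parcs G))"
proof -
  interpret G: pair_graph G by fact
  have "(\<exists>H. induced_subgraph H (with_proj G) \<and> digraph_iso H (with_proj F)) \<longleftrightarrow>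
    (\<exists>f. inj_on f (pverts F) \<and> f ` pverts F \<subseteq> pverts G \<and>
          (\<forall>u\<in>pverts F. \<forall>v\<in>pverts F. (u, v) \<in> parcs F \<longleftrightarrow> (f u, f v) \<in> parcs G))"
    (is "?L \<longleftrightarrow> (\<exists>f. ?R f)") if "F \<in> \<H>" for F
  proof
    interpret F: pair_graph F using assms(2) that by blast
    assume ?L
    then obtain H where H: "induced_subgraph H (with_proj G)" "digraph_iso H (with_proj F)"
      by blast
    then obtain h where h: "pre_digraph.digraph_isomorphism H h" "with_proj F = app_iso h H"
      unfolding digraph_iso_def by blast
    have ends: "tail H = fst" "head H = snd" and sub: "verts H \<subseteq> pverts G"
      and arcsH: "arcs H = {e \<in> parcs G. fst e \<in> verts H \<and> snd e \<in> verts H}"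
      using H(1) by (auto simp: induced_subgraph_def subgraph_def compatible_def)
    let ?g = "iso_verts h"
    have vF: "pverts F = ?g ` verts H" and aF: "parcs F = iso_arcs h ` arcs H"
      and t: "iso_tail h = fst" "iso_head h = snd"
      using h(2) by (auto simp: app_iso_def with_proj_def)
    have inj: "inj_on ?g (verts H)"
      and ia: "\<And>a. a \<in> arcs H \<Longrightarrow> iso_arcs h a = (?g (fst a), ?g (snd a))"
      using h(1) by (auto simp: pre_digraph.digraph_isomorphism_def ends t prod_eq_iff)
    have arc: "(?g x, ?g y) \<in> parcs F \<longleftrightarrow> (x, y) \<in> parcs G"
      if xy: "x \<in> verts H" "y \<in> verts H" for x y
    proof
      assume "(?g x, ?g y) \<in> parcs F"
      then obtain a where a: "a \<in> arcs H" "(?g x, ?g y) = iso_arcs h a" using aF by auto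
      then have "?g x = ?g (fst a)" "?g y = ?g (snd a)" "fst a \<in> verts H" "snd a \<in> verts H"
        using ia arcsH by auto
      then have "a = (x, y)" using inj xy by (auto simp: inj_on_def prod_eq_iff)
      then show "(x, y) \<in> parcs G" using a(1) arcsH by auto
    next
      assume "(x, y) \<in> parcs G"
      then have "(x, y) \<in> arcs H" using arcsH xy by auto
      then show "(?g x, ?g y) \<in> parcs F" using aF ia[of "(x, y)"] by (auto intro!: image_eqI[of _ _ "(x, y)"])
    qed
    let ?f = "the_inv_into (verts H) ?g"
    have f: "\<And>u. u \<in> pverts F \<Longrightarrow> ?f u \<in> verts H \<and> ?g (?f u) = u"
      using inj vF by (auto simp: the_inv_into_f_f)
    have "?R ?f"
    proof (intro conjI ballI)
      show "inj_on ?f (pverts F)" by (rule inj_on_inverseI[where g = ?g]) (use f in blast)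
      show "?f ` pverts F \<subseteq> pverts G" using f sub by blast
      show "(u, v) \<in> parcs F \<longleftrightarrow> (?f u, ?f v) \<in> parcs G" if "u \<in> pverts F" "v \<in> pverts F" for u v
        using arc[of "?f u" "?f v"] f[OF that(1)] f[OF that(2)] by simp
    qed
    then show "\<exists>f. ?R f" by blast
  next
    interpret F: pair_graph F using assms(2) that by blast
    assume "\<exists>f. ?R f"
    then obtain f where f: "inj_on f (pverts F)" "f ` pverts F \<subseteq> pverts G"
      and fF: "\<And>u v. u \<in> pverts F \<Longrightarrow> v \<in> pverts F \<Longrightarrow> (u, v) \<in> parcs F \<longleftrightarrow> (f u, f v) \<in> parcs G"
      by metis
    let ?S = "f ` pverts F"
    let ?H = "with_proj G \<restriction> ?S"
    have ind: "induced_subgraph ?H (with_proj G)"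
      using f by (intro G.induced_induce) auto
    let ?g = "the_inv_into (pverts F) f"
    have g: "\<And>u. u \<in> pverts F \<Longrightarrow> ?g (f u) = u" using f by (simp add: the_inv_into_f_f)
    let ?h = "\<lparr> iso_verts = ?g, iso_arcs = (\<lambda>e. (?g (fst e), ?g (snd e))),
      iso_head = snd, iso_tail = fst \<rparr>"
    have arcsH: "arcs ?H = {(f u, f v) | u v. u \<in> pverts F \<and> v \<in> pverts F \<and> (u, v) \<in> parcs F}"
    proof (intro set_eqI iffI)
      fix e assume "e \<in> arcs ?H"
      then obtain u v where uv: "u \<in> pverts F" "v \<in> pverts F" "e = (f u, f v)" "(f u, f v) \<in> parcs G"
        by (cases e) auto
      moreover have "(u, v) \<in> parcs F" using fF uv by blast
      ultimately show "e \<in> {(f u, f v) | u v. u \<in> pverts F \<and> v \<in> pverts F \<and> (u, v) \<in> parcs F}"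
        by blast
    next
      fix e assume "e \<in> {(f u, f v) | u v. u \<in> pverts F \<and> v \<in> pverts F \<and> (u, v) \<in> parcs F}"
      then obtain u v where uv: "u \<in> pverts F" "v \<in> pverts F" "e = (f u, f v)" "(u, v) \<in> parcs F"
        by blast
      moreover have "(f u, f v) \<in> parcs G" using fF uv by blast
      ultimately show "e \<in> arcs ?H" by simp
    qed
    have iso: "pre_digraph.digraph_isomorphism ?H ?h"
      unfolding pre_digraph.digraph_isomorphism_def arcsH
    proof (intro conjI ballI)
      show "wf_digraph ?H" using wf_digraphI_induced[OF ind] .
      show "inj_on (iso_verts ?h) (verts ?H)" using g by (auto simp: inj_on_def)
      show "inj_on (iso_arcs ?h) {(f u, f v) | u v. u \<in> pverts F \<and> v \<in> pverts F \<and> (u, v) \<in> parcs F}"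
        using g by (auto intro!: inj_onI)
    qed simp_all
    have "parcs F = (\<lambda>e. (?g (fst e), ?g (snd e))) ` arcs ?H" (is "_ = ?A")
    proof (intro set_eqI iffI)
      fix e assume e: "e \<in> parcs F"
      obtain u v where uv: "e = (u, v)" by force
      then have "u \<in> pverts F" "v \<in> pverts F" using e F.in_arcsD1 F.in_arcsD2 by auto
      then show "e \<in> ?A" unfolding arcsH using e uv g
        by (intro image_eqI[of _ _ "(f u, f v)"]) auto
    next
      fix e assume "e \<in> ?A"
      then show "e \<in> parcs F" unfolding arcsH using g by auto
    qed
    moreover have "pverts F = ?g ` ?S" using g by (force simp: image_image)
    ultimately have "with_proj F = app_iso ?h ?H"
      by (simp add: app_iso_def with_proj_def)
    then show ?L using iso ind unfolding digraph_iso_def by blast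
  qed
  then have "(\<exists>F\<in>\<H>. \<exists>H. induced_subgraph H (with_proj G) \<and> digraph_iso H (with_proj F)) \<longleftrightarrow>
    (\<exists>F\<in>\<H>. \<exists>f. inj_on f (pverts F) \<and> f ` pverts F \<subseteq> pverts G \<and>
          (\<forall>u\<in>pverts F. \<forall>v\<in>pverts F. (u, v) \<in> parcs F \<longleftrightarrow> (f u, f v) \<in> parcs G))"
    by (intro bex_cong refl)
  moreover have "family_free \<H> G \<longleftrightarrow>
    \<not> (\<exists>F\<in>\<H>. \<exists>H. induced_subgraph H (with_proj G) \<and> digraph_iso H (with_proj F))"
    unfolding family_free_def by blast
  ultimately show ?thesis by (simp only:)
qed

end

theory Submission
  imports Defs
begin

text \<open>
  Induct on the number of vertices; \<open>k\<close> colours with \<open>k = \<lfloor>3\<omega>/2\<rfloor>\<close> are available. Clique cutsets and universal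
  vertices are harmless, so assume there are none.

  If there is a 7-cycle, every other vertex sees three or four consecutive vertices of it: a vertex seeing
  none of it lies behind a clique cutset, and one seeing all of it is universal. Choose the 7-cycle with the
  largest degree sum. Unless the square of an 11-cycle is induced, every clique disjoint from the 7-cycle
  extends by two of its vertices, so deleting the cycle costs 3 colours and lowers \<open>\<omega>\<close> by 2. If the square
  of an 11-cycle is induced, all other vertices are twins of its vertices, and deleting it costs 4 colours
  and lowers \<open>\<omega>\<close> by 3.

  If there is no 7-cycle, let \<open>R\<close> be a largest connected set that does not dominate the graph, \<open>S\<close> its
  neighbourhood and \<open>C\<close> the rest. Then \<open>C\<close> is a clique complete to \<open>S\<close>, and every centre of an induced
  path on three vertices of \<open>S\<close> is adjacent to all of \<open>S\<close>. Among the \<open>k\<close>-colourings of \<open>R \<union> S\<close> take one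
  maximising the sum of the squared sizes of the colour classes on \<open>S\<close>. By Kempe changes this colouring
  uses no more than \<open>\<omega>(S)\<close> colours on \<open>S\<close>, which leaves enough colours for \<open>C\<close>.
\<close>

subsection \<open>Cliques and colourings\<close>

text \<open>The factor 3/2 is dictated by the 7-cycle, which costs 3 colours for a drop of 2 in
  \<omega>. The 11-cycle case trades 4 colours for a drop of 3.

  The drop in \<omega> is a Helly argument. The vertices of a clique off the 7-cycle see short arcs
  of it, so a common edge of all the arcs exists as soon as any two of them share an edge. Excluding
  4-cycles and 5-cycles almost guarantees this for adjacent vertices. The one pattern that survives
  consists of two arcs of three vertices with a single vertex in common. Maximality of the degree
  sum is there to exclude it, and the obstruction to that argument is exactly the square of an
  11-cycle. Attachments are encoded as tuples of truth values, which turns the case analyses on the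
  cycles into propositional problems.

  Without 7-cycles, an induced path through \<open>R\<close> between two nonadjacent vertices of
  \<open>S\<close> closes up through \<open>C\<close> to an induced cycle. Lengths 4, 5 and 7 are
  excluded and longer cycles contain a forbidden path, so only 6-cycles remain. This rigidity yields
  the structure of \<open>S\<close> and limits the Kempe chains. For this reason 7-cycles have to be
  removed first.\<close>

locale p7_c4_c5_free =
  fixes adj :: "'a \<Rightarrow> 'a \<Rightarrow> bool" (infix "\<sim>" 50)
  assumes adj_sym: "x \<sim> y \<Longrightarrow> y \<sim> x"
    and adj_irrefl: "\<not> x \<sim> x"
    and no_C4: "\<lbrakk>a \<sim> b; b \<sim> c; c \<sim> d; d \<sim> a; a \<noteq> c; b \<noteq> d\<rbrakk> \<Longrightarrow> a \<sim> c \<or> b \<sim> d"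
    and no_C5: "\<lbrakk>a \<sim> b; b \<sim> c; c \<sim> d; d \<sim> e; e \<sim> a\<rbrakk> \<Longrightarrow>
      a \<sim> c \<or> b \<sim> d \<or> c \<sim> e \<or> d \<sim> a \<or> e \<sim> b"
    and no_P7: "\<lbrakk>a \<sim> b; b \<sim> c; c \<sim> d; d \<sim> e; e \<sim> f; f \<sim> g\<rbrakk> \<Longrightarrow>
      a \<sim> c \<or> a \<sim> d \<or> a \<sim> e \<or> a \<sim> f \<or> a \<sim> g \<or> b \<sim> d \<or> b \<sim> e \<or> b \<sim> f \<or> b \<sim> g \<or>
      c \<sim> e \<or> c \<sim> f \<or> c \<sim> g \<or> d \<sim> f \<or> d \<sim> g \<or> e \<sim> g"
begin

lemma adj_commute: "x \<sim> y \<longleftrightarrow> y \<sim> x"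
  using adj_sym by blast

definition clq :: "'a set \<Rightarrow> bool" where
  "clq K \<longleftrightarrow> (\<forall>u\<in>K. \<forall>v\<in>K. u \<noteq> v \<longrightarrow> u \<sim> v)"

definition clqs_le :: "'a set \<Rightarrow> nat \<Rightarrow> bool" where
  "clqs_le V w \<longleftrightarrow> (\<forall>K\<subseteq>V. clq K \<longrightarrow> card K \<le> w)"

definition proper :: "'a set \<Rightarrow> nat \<Rightarrow> ('a \<Rightarrow> nat) \<Rightarrow> bool" where
  "proper V k c \<longleftrightarrow> (\<forall>v\<in>V. c v < k) \<and> (\<forall>u\<in>V. \<forall>v\<in>V. u \<sim> v \<longrightarrow> c u \<noteq> c v)"

definition colourable :: "'a set \<Rightarrow> nat \<Rightarrow> bool" where
  "colourable V k \<longleftrightarrow> (\<exists>c. proper V k c)"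

lemma clq_insert: "clq (insert x K) \<longleftrightarrow> clq K \<and> (\<forall>y\<in>K. y \<noteq> x \<longrightarrow> x \<sim> y)"
  by (auto simp: clq_def adj_commute)

lemma clqs_le_mono: "clqs_le V w \<Longrightarrow> U \<subseteq> V \<Longrightarrow> clqs_le U w"
  by (auto simp: clqs_le_def)

lemma colourable_mono: "colourable V k \<Longrightarrow> U \<subseteq> V \<Longrightarrow> k \<le> l \<Longrightarrow> colourable U l"
proof -
  assume *: "U \<subseteq> V" "k \<le> l"
  assume "colourable V k"
  then obtain c where c: "proper V k c" by (auto simp: colourable_def)
  have "proper U l c"
    unfolding proper_def
  proof (intro conjI ballI impI)
    show "c v < l" if "v \<in> U" for v using c * that by (force simp: proper_def)
    show "c u \<noteq> c v" if "u \<in> U" "v \<in> U" "u \<sim> v" for u v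
      using c * that by (auto simp: proper_def)
  qed
  then show ?thesis by (auto simp: colourable_def)
qed

lemma colourable_Un:
  assumes "colourable A k" "colourable B l"
  shows "colourable (A \<union> B) (k + l)"
proof -
  obtain c d where "proper A k c" "proper B l d"
    using assms by (auto simp: colourable_def)
  then have "proper (A \<union> B) (k + l) (\<lambda>v. if v \<in> A then c v else k + d v)"
    by (force simp: proper_def)
  then show ?thesis by (auto simp: colourable_def)
qed

lemma colourable_card:
  assumes "finite V"
  shows "colourable V (card V)"
proof -
  obtain f :: "'a \<Rightarrow> nat" where f: "bij_betw f V {0..<card V}"
    using ex_bij_betw_finite_nat[OF assms] by blast
  then have "proper V (card V) f"
    unfolding proper_def using adj_irrefl by (auto simp: bij_betw_def inj_on_def)
  then show ?thesis by (auto simp: colourable_def)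
qed

text \<open>Turns a partial renaming of colours into a permutation of the whole palette.\<close>

lemma extend_bij:
  assumes "finite S" "A \<subseteq> S" "B \<subseteq> S" "bij_betw f A B"
  shows "\<exists>g. bij_betw g S S \<and> (\<forall>x\<in>A. g x = f x)"
proof -
  have "card (S - A) = card (S - B)"
    using assms by (simp add: bij_betw_same_card card_Diff_subset finite_subset)
  then obtain h where h: "bij_betw h (S - A) (S - B)"
    using assms(1) finite_same_card_bij by blast
  let ?g = "\<lambda>x. if x \<in> A then f x else h x"
  have "bij_betw ?g A B" using assms(4) by (rule bij_betw_cong[THEN iffD1, rotated]) simp
  moreover have "bij_betw ?g (S - A) (S - B)" using h by (rule bij_betw_cong[THEN iffD1, rotated]) simp
  ultimately have "bij_betw ?g (A \<union> (S - A)) (B \<union> (S - B))"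
    by (rule bij_betw_combine) auto
  then have "bij_betw ?g S S" using assms by (simp add: Un_absorb1)
  then show ?thesis by auto
qed

text \<open>Both colourings are injective on the clique \<open>A \<inter> B\<close>, so a
  permutation of the colours used on \<open>B\<close> makes them agree there, and no edge joins the
  two remaining parts.\<close>

lemma colourable_clique_cutset:
  assumes A: "colourable A k" and B: "colourable B k" and clq: "clq (A \<inter> B)"
    and anti: "\<And>a b. a \<in> A - B \<Longrightarrow> b \<in> B - A \<Longrightarrow> \<not> a \<sim> b"
  shows "colourable (A \<union> B) k"
proof -
  obtain c d where c: "proper A k c" and d: "proper B k d"
    using A B by (auto simp: colourable_def)
  have injc: "inj_on c (A \<inter> B)" and injd: "inj_on d (A \<inter> B)"
    using c d clq unfolding proper_def clq_def inj_on_def by (metis IntD1, metis IntD2)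
  \<comment> \<open>Sends the \<open>d\<close>-colour of a vertex of the clique to its
    \<open>c\<close>-colour.\<close>
  let ?f = "c \<circ> the_inv_into (A \<inter> B) d"
  have f: "?f (d x) = c x" if "x \<in> A \<inter> B" for x
    using that injd by (simp add: the_inv_into_f_f)
  have "bij_betw ?f (d ` (A \<inter> B)) (c ` (A \<inter> B))"
    using injc injd by (intro bij_betw_trans[OF bij_betw_the_inv_into]) (auto simp: bij_betw_def)
  moreover have "d ` (A \<inter> B) \<subseteq> {..<k}" "c ` (A \<inter> B) \<subseteq> {..<k}"
    using c d by (auto simp: proper_def)
  ultimately obtain g where g: "bij_betw g {..<k} {..<k}" "\<forall>x\<in>d ` (A \<inter> B). g x = ?f x"
    using extend_bij[of "{..<k}"] by blast
  have gc: "g (d x) = c x" if "x \<in> A" "x \<in> B" for x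
    using g(2) f that by auto
  have gk: "g (d x) < k" if "x \<in> B" for x
    using g(1) d that by (auto simp: bij_betw_def proper_def)
  have gne: "g (d x) \<noteq> g (d y)" if "x \<in> B" "y \<in> B" "x \<sim> y" for x y
  proof -
    have "d x \<noteq> d y" "d x < k" "d y < k" using d that by (auto simp: proper_def)
    then show ?thesis using g(1) by (auto simp: bij_betw_def dest: inj_onD)
  qed
  have "proper (A \<union> B) k (\<lambda>v. if v \<in> A then c v else g (d v))"
    unfolding proper_def
  proof (intro conjI ballI impI)
    fix u v assume uv: "u \<in> A \<union> B" "v \<in> A \<union> B" "u \<sim> v"
    consider "u \<in> A" "v \<in> A" | "u \<in> B" "v \<in> B"
      using uv anti adj_commute by blast
    then show "(if u \<in> A then c u else g (d u)) \<noteq> (if v \<in> A then c v else g (d v))"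
    proof cases
      case 1 then show ?thesis using c uv by (auto simp: proper_def)
    next
      case 2 then show ?thesis using gne[of u v] uv gc by auto
    qed
  qed (use c gk in \<open>auto simp: proper_def\<close>)
  then show ?thesis by (auto simp: colourable_def)
qed

text \<open>A clique that avoids \<open>u\<close> can be enlarged by \<open>u\<close>. Positivity of
  \<open>w\<close> ensures that the truncated difference \<open>w - 1\<close> really drops when one
  colour is spent on \<open>u\<close>.\<close>

lemma colourable_universal:
  assumes "finite V" "u \<in> V" and univ: "\<And>x. x \<in> V \<Longrightarrow> x \<noteq> u \<Longrightarrow> u \<sim> x" and w: "clqs_le V w"
  shows "clqs_le (V - {u}) (w - 1)" "0 < w"
proof -
  have "clq {u}" by (auto simp: clq_def)
  then have "card {u} \<le> w" using w assms(2) unfolding clqs_le_def by blast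
  then show "0 < w" by simp
  show "clqs_le (V - {u}) (w - 1)" unfolding clqs_le_def
  proof (intro allI impI)
    fix K assume K: "K \<subseteq> V - {u}" "clq K"
    have "clq (insert u K)" unfolding clq_insert using K univ by blast
    moreover have "insert u K \<subseteq> V" using K assms(2) by auto
    ultimately have "card (insert u K) \<le> w" using w unfolding clqs_le_def by blast
    moreover have "finite K" "u \<notin> K" using K assms(1) finite_subset by auto
    ultimately show "card K \<le> w - 1" by simp
  qed
qed

subsection \<open>Induced paths\<close>

definition ind_path :: "'a list \<Rightarrow> bool" where
  "ind_path p \<longleftrightarrow> distinct p \<and>
     (\<forall>i<length p. \<forall>j<length p. p ! i \<sim> p ! j \<longleftrightarrow> j = Suc i \<or> i = Suc j)"

definition edges_in :: "'a set \<Rightarrow> ('a \<times> 'a) set" where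
  "edges_in W = {(x, y). x \<in> W \<and> y \<in> W \<and> x \<sim> y}"

lemma sym_edges_in: "sym (edges_in W)"
  by (auto simp: sym_def edges_in_def adj_commute)

lemma edges_in_rtrancl_mem: "(x, y) \<in> (edges_in W)\<^sup>* \<Longrightarrow> x \<in> W \<Longrightarrow> y \<in> W"
  by (induction rule: rtrancl_induct) (auto simp: edges_in_def)

lemma ind_path_take: "ind_path p \<Longrightarrow> ind_path (take n p)"
  by (auto simp: ind_path_def)

lemma ind_path_length:
  assumes "ind_path p"
  shows "length p \<le> 6"
proof (rule ccontr)
  assume "\<not> length p \<le> 6"
  then have l: "6 < length p" by simp
  have e: "p ! i \<sim> p ! j \<longleftrightarrow> j = Suc i \<or> i = Suc j" if "i \<le> 6" "j \<le> 6" for i j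
    using assms l that by (auto simp: ind_path_def)
  show False
    using no_P7[of "p!0" "p!1" "p!2" "p!3" "p!4" "p!5" "p!6"] by (simp add: e)
qed

text \<open>The path grows along a walk from \<open>x\<close>. A vertex already on the path
  truncates it; a new vertex is attached to its first neighbour on the path, and the rest is cut
  off, so no chord arises.\<close>

lemma obtain_ind_path:
  assumes "(x, y) \<in> (edges_in W)\<^sup>*" "x \<in> W"
  shows "\<exists>p. p \<noteq> [] \<and> hd p = x \<and> last p = y \<and> set p \<subseteq> W \<and> ind_path p"
  using assms
proof (induction rule: rtrancl_induct)
  case base
  then show ?case by (intro exI[of _ "[x]"]) (auto simp: ind_path_def adj_irrefl)
next
  case (step y z)
  then obtain p where p: "p \<noteq> []" "hd p = x" "last p = y" "set p \<subseteq> W" "ind_path p"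
    by blast
  have yz: "y \<sim> z" "z \<in> W" using step by (auto simp: edges_in_def)
  show ?case
  proof (cases "z \<in> set p")
    case True
    then obtain i where i: "i < length p" "p ! i = z" by (auto simp: in_set_conv_nth)
    have "last (take (Suc i) p) = z" using i by (simp add: take_Suc_conv_app_nth)
    moreover have "set (take (Suc i) p) \<subseteq> W" using p(4) by (auto dest: in_set_takeD)
    ultimately show ?thesis using p ind_path_take[OF p(5)]
      by (intro exI[of _ "take (Suc i) p"]) auto
  next
    case False
    define P where "P i \<longleftrightarrow> i < length p \<and> p ! i \<sim> z" for i
    have "P (length p - 1)" using p yz by (auto simp: P_def last_conv_nth)
    define i where "i = (LEAST i. P i)"
    have i: "P i" and min: "\<And>j. j < i \<Longrightarrow> \<not> P j"
      using \<open>P (length p - 1)\<close> by (auto simp: i_def intro: LeastI dest: not_less_Least)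
    let ?q = "take (Suc i) p @ [z]"
    have len: "length ?q = Suc (Suc i)" using i by (simp add: P_def)
    have nth: "?q ! j = (if j \<le> i then p ! j else z)" if "j < Suc (Suc i)" for j
      using that i by (auto simp: nth_append P_def)
    have pp: "p ! j \<sim> p ! k \<longleftrightarrow> k = Suc j \<or> j = Suc k" if "j \<le> i" "k \<le> i" for j k
      using p(5) i that by (auto simp: ind_path_def P_def)
    have pz: "p ! j \<sim> z \<longleftrightarrow> j = i" if "j \<le> i" for j
      using that i min[of j] by (cases "j = i") (auto simp: P_def)
    have "ind_path ?q" unfolding ind_path_def len
    proof (intro conjI allI impI)
      show "distinct ?q" using p(5) False by (auto simp: ind_path_def dest: in_set_takeD)
      fix j k assume jk: "j < Suc (Suc i)" "k < Suc (Suc i)"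
      show "?q ! j \<sim> ?q ! k \<longleftrightarrow> k = Suc j \<or> j = Suc k"
      proof (cases "j \<le> i"; cases "k \<le> i")
        assume "j \<le> i" "k \<le> i"
        then show ?thesis using pp nth jk by simp
      next
        assume "j \<le> i" "\<not> k \<le> i"
        then show ?thesis using pz[of j] nth[OF jk(1)] nth[OF jk(2)] jk by auto
      next
        assume "\<not> j \<le> i" "k \<le> i"
        then show ?thesis using pz[of k] nth[OF jk(1)] nth[OF jk(2)] jk adj_commute[of z] by auto
      next
        assume "\<not> j \<le> i" "\<not> k \<le> i"
        then show ?thesis using nth[OF jk(1)] nth[OF jk(2)] jk adj_irrefl[of z] by auto
      qed
    qed
    moreover have "set ?q \<subseteq> W" using p(4) yz(2) by (auto dest: in_set_takeD)
    moreover have "?q \<noteq> []" "hd ?q = x" "last ?q = z" using p(1,2) by (simp_all add: hd_append)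
    ultimately show ?thesis by (intro exI[of _ ?q] conjI)
  qed
qed

lemma length_le_6_cases:
  assumes "length p \<le> 6" "p \<noteq> []"
  obtains a where "p = [a]" | a b where "p = [a,b]" | a b c where "p = [a,b,c]"
  | a b c d where "p = [a,b,c,d]" | a b c d e where "p = [a,b,c,d,e]"
  | a b c d e f where "p = [a,b,c,d,e,f]"
  using assms
  apply (cases p; simp)
  apply (rename_tac a p1, case_tac p1; simp)
  apply (rename_tac b p2, case_tac p2; simp)
  apply (rename_tac c p3, case_tac p3; simp)
  apply (rename_tac d p4, case_tac p4; simp)
  apply (rename_tac e p5, case_tac p5; simp)
  done

end

subsection \<open>Attachments to a 7-cycle\<close>

text \<open>The arguments record to which of the seven vertices, in cyclic order, a given vertex is adjacent.\<close>

definition arc7 :: "bool \<Rightarrow> bool \<Rightarrow> bool \<Rightarrow> bool \<Rightarrow> bool \<Rightarrow> bool \<Rightarrow> bool \<Rightarrow> bool" where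
  "arc7 a b c d e f g \<longleftrightarrow>
     (a \<and> b \<and> c \<and> \<not> d \<and> \<not> e \<and> \<not> f \<and> \<not> g) \<or> (a \<and> b \<and> c \<and> d \<and> \<not> e \<and> \<not> f \<and> \<not> g) \<or>
     (b \<and> c \<and> d \<and> \<not> e \<and> \<not> f \<and> \<not> g \<and> \<not> a) \<or> (b \<and> c \<and> d \<and> e \<and> \<not> f \<and> \<not> g \<and> \<not> a) \<or>
     (c \<and> d \<and> e \<and> \<not> f \<and> \<not> g \<and> \<not> a \<and> \<not> b) \<or> (c \<and> d \<and> e \<and> f \<and> \<not> g \<and> \<not> a \<and> \<not> b) \<or>
     (d \<and> e \<and> f \<and> \<not> g \<and> \<not> a \<and> \<not> b \<and> \<not> c) \<or> (d \<and> e \<and> f \<and> g \<and> \<not> a \<and> \<not> b \<and> \<not> c) \<or>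
     (e \<and> f \<and> g \<and> \<not> a \<and> \<not> b \<and> \<not> c \<and> \<not> d) \<or> (e \<and> f \<and> g \<and> a \<and> \<not> b \<and> \<not> c \<and> \<not> d) \<or>
     (f \<and> g \<and> a \<and> \<not> b \<and> \<not> c \<and> \<not> d \<and> \<not> e) \<or> (f \<and> g \<and> a \<and> b \<and> \<not> c \<and> \<not> d \<and> \<not> e) \<or>
     (g \<and> a \<and> b \<and> \<not> c \<and> \<not> d \<and> \<not> e \<and> \<not> f) \<or> (g \<and> a \<and> b \<and> c \<and> \<not> d \<and> \<not> e \<and> \<not> f)"

text \<open>The assumptions exclude, in this order, an induced 4-cycle, an induced 5-cycle, and an
  induced path on seven vertices that enters the cycle at one vertex and runs round it the long
  way.\<close>

lemma arc7_attach:
  assumes "a \<and> c \<longrightarrow> b" "b \<and> d \<longrightarrow> c" "c \<and> e \<longrightarrow> d" "d \<and> f \<longrightarrow> e" "e \<and> g \<longrightarrow> f" "f \<and> a \<longrightarrow> g" "g \<and> b \<longrightarrow> a"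
   "a \<and> d \<longrightarrow> b \<or> c" "b \<and> e \<longrightarrow> c \<or> d" "c \<and> f \<longrightarrow> d \<or> e" "d \<and> g \<longrightarrow> e \<or> f" "e \<and> a \<longrightarrow> f \<or> g" "f \<and> b \<longrightarrow> g \<or> a" "g \<and> c \<longrightarrow> a \<or> b"
   "a \<longrightarrow> c \<or> d \<or> e \<or> f \<or> g" "b \<longrightarrow> d \<or> e \<or> f \<or> g \<or> a" "c \<longrightarrow> e \<or> f \<or> g \<or> a \<or> b" "d \<longrightarrow> f \<or> g \<or> a \<or> b \<or> c"
   "e \<longrightarrow> g \<or> a \<or> b \<or> c \<or> d" "f \<longrightarrow> a \<or> b \<or> c \<or> d \<or> e" "g \<longrightarrow> b \<or> c \<or> d \<or> e \<or> f"
  shows "arc7 a b c d e f g \<or> (\<not> a \<and> \<not> b \<and> \<not> c \<and> \<not> d \<and> \<not> e \<and> \<not> f \<and> \<not> g) \<or> (a \<and> b \<and> c \<and> d \<and> e \<and> f \<and> g)"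
  using assms unfolding arc7_def by satx
text \<open>Two consecutive positions are an edge of the cycle, hence two vertices by which a clique
  can grow.\<close>

definition meet7 :: "bool \<Rightarrow> bool \<Rightarrow> bool \<Rightarrow> bool \<Rightarrow> bool \<Rightarrow> bool \<Rightarrow> bool \<Rightarrow> bool" where
  "meet7 a b c d e f g \<longleftrightarrow>
     (a \<and> b) \<or> (b \<and> c) \<or> (c \<and> d) \<or> (d \<and> e) \<or> (e \<and> f) \<or> (f \<and> g) \<or> (g \<and> a)"

text \<open>Arcs of at most four vertices are too short to cover the cycle, so pairwise meeting in edges
  forces a common edge.\<close>

lemma arc7_triple:
  assumes "arc7 a1 b1 c1 d1 e1 f1 g1" "arc7 a2 b2 c2 d2 e2 f2 g2" "arc7 a3 b3 c3 d3 e3 f3 g3"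
    and "meet7 (a1 \<and> a2) (b1 \<and> b2) (c1 \<and> c2) (d1 \<and> d2) (e1 \<and> e2) (f1 \<and> f2) (g1 \<and> g2)"
    and "meet7 (a1 \<and> a3) (b1 \<and> b3) (c1 \<and> c3) (d1 \<and> d3) (e1 \<and> e3) (f1 \<and> f3) (g1 \<and> g3)"
    and "meet7 (a2 \<and> a3) (b2 \<and> b3) (c2 \<and> c3) (d2 \<and> d3) (e2 \<and> e3) (f2 \<and> f3) (g2 \<and> g3)"
  shows "meet7 (a1 \<and> a2 \<and> a3) (b1 \<and> b2 \<and> b3) (c1 \<and> c2 \<and> c3) (d1 \<and> d2 \<and> d3) (e1 \<and> e2 \<and> e3) (f1 \<and> f2 \<and> f3) (g1 \<and> g2 \<and>
      g3)"
  using assms unfolding arc7_def meet7_def by satx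

definition arc3 :: "bool \<Rightarrow> bool \<Rightarrow> bool \<Rightarrow> bool \<Rightarrow> bool \<Rightarrow> bool \<Rightarrow> bool \<Rightarrow> bool" where
  "arc3 a b c d e f g \<longleftrightarrow> a \<and> b \<and> c \<and> \<not> d \<and> \<not> e \<and> \<not> f \<and> \<not> g"

text \<open>The assumptions exclude, in this order, induced 4-cycles, induced 5-cycles, and adjacent vertices
  attached to three consecutive vertices each with only one in common.\<close>

lemma arc7_pair:
  assumes "arc7 a1 b1 c1 d1 e1 f1 g1" "arc7 a2 b2 c2 d2 e2 f2 g2"
    and "\<not> (a1 \<and> \<not> a2 \<and> b2 \<and> \<not> b1)"
    "\<not> (b1 \<and> \<not> b2 \<and> c2 \<and> \<not> c1)"
    "\<not> (c1 \<and> \<not> c2 \<and> d2 \<and> \<not> d1)"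
    "\<not> (d1 \<and> \<not> d2 \<and> e2 \<and> \<not> e1)"
    "\<not> (e1 \<and> \<not> e2 \<and> f2 \<and> \<not> f1)"
    "\<not> (f1 \<and> \<not> f2 \<and> g2 \<and> \<not> g1)"
    "\<not> (g1 \<and> \<not> g2 \<and> a2 \<and> \<not> a1)"
    "\<not> (a2 \<and> \<not> a1 \<and> b1 \<and> \<not> b2)"
    "\<not> (b2 \<and> \<not> b1 \<and> c1 \<and> \<not> c2)"
    "\<not> (c2 \<and> \<not> c1 \<and> d1 \<and> \<not> d2)"
    "\<not> (d2 \<and> \<not> d1 \<and> e1 \<and> \<not> e2)"
    "\<not> (e2 \<and> \<not> e1 \<and> f1 \<and> \<not> f2)"
    "\<not> (f2 \<and> \<not> f1 \<and> g1 \<and> \<not> g2)"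
    "\<not> (g2 \<and> \<not> g1 \<and> a1 \<and> \<not> a2)"
    "\<not> (a1 \<and> \<not> a2 \<and> \<not> b1 \<and> \<not> b2 \<and> c2 \<and> \<not> c1)"
    "\<not> (b1 \<and> \<not> b2 \<and> \<not> c1 \<and> \<not> c2 \<and> d2 \<and> \<not> d1)"
    "\<not> (c1 \<and> \<not> c2 \<and> \<not> d1 \<and> \<not> d2 \<and> e2 \<and> \<not> e1)"
    "\<not> (d1 \<and> \<not> d2 \<and> \<not> e1 \<and> \<not> e2 \<and> f2 \<and> \<not> f1)"
    "\<not> (e1 \<and> \<not> e2 \<and> \<not> f1 \<and> \<not> f2 \<and> g2 \<and> \<not> g1)"
    "\<not> (f1 \<and> \<not> f2 \<and> \<not> g1 \<and> \<not> g2 \<and> a2 \<and> \<not> a1)"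
    "\<not> (g1 \<and> \<not> g2 \<and> \<not> a1 \<and> \<not> a2 \<and> b2 \<and> \<not> b1)"
    "\<not> (a2 \<and> \<not> a1 \<and> \<not> b2 \<and> \<not> b1 \<and> c1 \<and> \<not> c2)"
    "\<not> (b2 \<and> \<not> b1 \<and> \<not> c2 \<and> \<not> c1 \<and> d1 \<and> \<not> d2)"
    "\<not> (c2 \<and> \<not> c1 \<and> \<not> d2 \<and> \<not> d1 \<and> e1 \<and> \<not> e2)"
    "\<not> (d2 \<and> \<not> d1 \<and> \<not> e2 \<and> \<not> e1 \<and> f1 \<and> \<not> f2)"
    "\<not> (e2 \<and> \<not> e1 \<and> \<not> f2 \<and> \<not> f1 \<and> g1 \<and> \<not> g2)"
    "\<not> (f2 \<and> \<not> f1 \<and> \<not> g2 \<and> \<not> g1 \<and> a1 \<and> \<not> a2)"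
    "\<not> (g2 \<and> \<not> g1 \<and> \<not> a2 \<and> \<not> a1 \<and> b1 \<and> \<not> b2)"
    "\<not> (arc3 a1 b1 c1 d1 e1 f1 g1 \<and> arc3 c2 d2 e2 f2 g2 a2 b2)"
    "\<not> (arc3 a1 b1 c1 d1 e1 f1 g1 \<and> arc3 f2 g2 a2 b2 c2 d2 e2)"
    "\<not> (arc3 b1 c1 d1 e1 f1 g1 a1 \<and> arc3 d2 e2 f2 g2 a2 b2 c2)"
    "\<not> (arc3 b1 c1 d1 e1 f1 g1 a1 \<and> arc3 g2 a2 b2 c2 d2 e2 f2)"
    "\<not> (arc3 c1 d1 e1 f1 g1 a1 b1 \<and> arc3 e2 f2 g2 a2 b2 c2 d2)"
    "\<not> (arc3 c1 d1 e1 f1 g1 a1 b1 \<and> arc3 a2 b2 c2 d2 e2 f2 g2)"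
    "\<not> (arc3 d1 e1 f1 g1 a1 b1 c1 \<and> arc3 f2 g2 a2 b2 c2 d2 e2)"
    "\<not> (arc3 d1 e1 f1 g1 a1 b1 c1 \<and> arc3 b2 c2 d2 e2 f2 g2 a2)"
    "\<not> (arc3 e1 f1 g1 a1 b1 c1 d1 \<and> arc3 g2 a2 b2 c2 d2 e2 f2)"
    "\<not> (arc3 e1 f1 g1 a1 b1 c1 d1 \<and> arc3 c2 d2 e2 f2 g2 a2 b2)"
    "\<not> (arc3 f1 g1 a1 b1 c1 d1 e1 \<and> arc3 a2 b2 c2 d2 e2 f2 g2)"
    "\<not> (arc3 f1 g1 a1 b1 c1 d1 e1 \<and> arc3 d2 e2 f2 g2 a2 b2 c2)"
    "\<not> (arc3 g1 a1 b1 c1 d1 e1 f1 \<and> arc3 b2 c2 d2 e2 f2 g2 a2)"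
    "\<not> (arc3 g1 a1 b1 c1 d1 e1 f1 \<and> arc3 e2 f2 g2 a2 b2 c2 d2)"
  shows "meet7 (a1 \<and> a2) (b1 \<and> b2) (c1 \<and> c2) (d1 \<and> d2) (e1 \<and> e2) (f1 \<and> f2) (g1 \<and> g2)"
  using assms unfolding arc7_def arc3_def meet7_def by satx

context p7_c4_c5_free
begin

lemma common_nbrs_adj: "\<lbrakk>x \<sim> p; x \<sim> q; y \<sim> p; y \<sim> q; \<not> p \<sim> q; p \<noteq> q; x \<noteq> y\<rbrakk> \<Longrightarrow> x \<sim> y"
  using no_C4[of x p y q] adj_sym by blast

lemma C4_D: "\<lbrakk>a \<sim> b; x \<sim> y; x \<sim> a; y \<sim> b; x \<noteq> b; y \<noteq> a\<rbrakk> \<Longrightarrow> x \<sim> b \<or> y \<sim> a"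
  using no_C4[of x a b y] adj_sym by blast

lemma C5_D: "\<lbrakk>a \<sim> b; b \<sim> c; \<not> a \<sim> c; x \<sim> y; x \<sim> a; y \<sim> c\<rbrakk> \<Longrightarrow> x \<sim> b \<or> x \<sim> c \<or> y \<sim> a \<or> y \<sim> b"
  using no_C5[of x a b c y] adj_sym by blast

definition C7 :: "'a \<Rightarrow> 'a \<Rightarrow> 'a \<Rightarrow> 'a \<Rightarrow> 'a \<Rightarrow> 'a \<Rightarrow> 'a \<Rightarrow> bool" where
  "C7 a b c d e f g \<longleftrightarrow>
     a \<sim> b \<and> b \<sim> c \<and> c \<sim> d \<and> d \<sim> e \<and> e \<sim> f \<and> f \<sim> g \<and> g \<sim> a \<and>
     \<not> a \<sim> c \<and> \<not> b \<sim> d \<and> \<not> c \<sim> e \<and> \<not> d \<sim> f \<and> \<not> e \<sim> g \<and> \<not> f \<sim> a \<and> \<not> g \<sim> b \<and>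
     \<not> a \<sim> d \<and> \<not> b \<sim> e \<and> \<not> c \<sim> f \<and> \<not> d \<sim> g \<and> \<not> e \<sim> a \<and> \<not> f \<sim> b \<and> \<not> g \<sim> c"

lemma C7_rotate: "C7 a b c d e f g \<Longrightarrow> C7 b c d e f g a"
  by (simp add: C7_def adj_commute)

lemma C7_reflect: "C7 a b c d e f g \<Longrightarrow> C7 g f e d c b a"
  unfolding C7_def using adj_commute by blast

lemma C7_rotations:
  assumes "C7 a b c d e f g"
  shows "C7 a b c d e f g" "C7 b c d e f g a" "C7 c d e f g a b" "C7 d e f g a b c"
    "C7 e f g a b c d" "C7 f g a b c d e" "C7 g a b c d e f"
  using assms assms[THEN C7_rotate] assms[THEN C7_rotate, THEN C7_rotate]
    C7_rotate[OF C7_rotate[OF C7_rotate[OF assms]]]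
    C7_rotate[OF C7_rotate[OF C7_rotate[OF C7_rotate[OF assms]]]]
    C7_rotate[OF C7_rotate[OF C7_rotate[OF C7_rotate[OF C7_rotate[OF assms]]]]]
    C7_rotate[OF C7_rotate[OF C7_rotate[OF C7_rotate[OF C7_rotate[OF C7_rotate[OF assms]]]]]]
  by this+

lemma C7_distinct: "C7 a b c d e f g \<Longrightarrow> distinct [a, b, c, d, e, f, g]"
  by (auto simp: C7_def adj_irrefl adj_commute)

lemma C7_nbr2:
  assumes "C7 a b c d e f g" "x \<noteq> b"
  shows "x \<sim> a \<and> x \<sim> c \<longrightarrow> x \<sim> b"
  using assms no_C4[of x a b c] C7_distinct[OF assms(1)] adj_sym by (auto simp: C7_def)

lemma C7_nbr3:
  assumes "C7 a b c d e f g"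
  shows "x \<sim> a \<and> x \<sim> d \<longrightarrow> x \<sim> b \<or> x \<sim> c"
  using assms no_C5[of x a b c d] adj_commute by (auto simp: C7_def)

text \<open>If \<open>x\<close> saw \<open>a\<close> and at most \<open>b\<close> besides, then
  \<open>x, a, g, f, e, d, c\<close> would be an induced path.\<close>

lemma C7_nbr_pendant:
  assumes "C7 a b c d e f g"
  shows "x \<sim> a \<longrightarrow> x \<sim> c \<or> x \<sim> d \<or> x \<sim> e \<or> x \<sim> f \<or> x \<sim> g"
  using assms no_P7[of x a g f e d c] adj_commute by (auto simp: C7_def)

lemma C7_attach:
  assumes H: "C7 a b c d e f g" and x: "x \<notin> {a, b, c, d, e, f, g}"
  shows "arc7 (x \<sim> a) (x \<sim> b) (x \<sim> c) (x \<sim> d) (x \<sim> e) (x \<sim> f) (x \<sim> g) \<or>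
    (\<not> x \<sim> a \<and> \<not> x \<sim> b \<and> \<not> x \<sim> c \<and> \<not> x \<sim> d \<and> \<not> x \<sim> e \<and> \<not> x \<sim> f \<and> \<not> x \<sim> g) \<or>
    (x \<sim> a \<and> x \<sim> b \<and> x \<sim> c \<and> x \<sim> d \<and> x \<sim> e \<and> x \<sim> f \<and> x \<sim> g)"
proof -
  note R = C7_rotations[OF H]
  show ?thesis
    by (rule arc7_attach; (rule R[THEN C7_nbr3] R[THEN C7_nbr_pendant] |
        (rule R[THEN C7_nbr2], use x in simp)))
qed

text \<open>Otherwise the path \<open>k, y, c\<close> continues through the four vertices missed by
  \<open>y\<close>, which makes seven vertices in all.\<close>

lemma C7_pendant_not_arc3:
  assumes "C7 a b c d e f g" "k \<sim> y" "\<forall>h\<in>{a, b, c, d, e, f, g}. \<not> k \<sim> h"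
  shows "\<not> arc3 (y \<sim> a) (y \<sim> b) (y \<sim> c) (y \<sim> d) (y \<sim> e) (y \<sim> f) (y \<sim> g)"
  using assms no_P7[of k y c d e f g] adj_commute by (auto simp: C7_def arc3_def)

lemma C7_pendant_path:
  assumes "C7 a b c d e f g" "k \<sim> y" "k' \<sim> k" "\<forall>h\<in>{a, b, c, d, e, f, g}. \<not> k \<sim> h \<and> \<not> k' \<sim> h"
  shows "y \<sim> d \<and> \<not> y \<sim> e \<and> \<not> y \<sim> f \<and> \<not> y \<sim> g \<longrightarrow> k' \<sim> y"
  using assms no_P7[of k' k y d e f g] adj_commute by (auto simp: C7_def)

text \<open>The arc of \<open>y\<close> has four vertices by \<open>C7_pendant_not_arc3\<close>.
  From one of its ends the three missed vertices prolong the path \<open>k', k, y\<close> to seven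
  vertices, so \<open>k' \<sim> y\<close> must be a chord. Adjacency to \<open>y\<close> thus
  spreads along edges between vertices that see nothing of the cycle.\<close>

lemma C7_pendant_step:
  assumes H: "C7 a b c d e f g" and "k \<sim> y" "k' \<sim> k"
    and k: "\<forall>h\<in>{a, b, c, d, e, f, g}. \<not> k \<sim> h \<and> \<not> k' \<sim> h"
    and y: "arc7 (y \<sim> a) (y \<sim> b) (y \<sim> c) (y \<sim> d) (y \<sim> e) (y \<sim> f) (y \<sim> g)"
  shows "k' \<sim> y"
proof -
  note R = C7_rotations[OF H]
  have P: "\<And>p q r s t u v. \<lbrakk>C7 p q r s t u v; {p, q, r, s, t, u, v} = {a, b, c, d, e, f, g}\<rbrakk> \<Longrightarrow>
      y \<sim> s \<and> \<not> y \<sim> t \<and> \<not> y \<sim> u \<and> \<not> y \<sim> v \<longrightarrow> k' \<sim> y"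
    using C7_pendant_path[OF _ assms(2,3)] k by metis
  note P = P[OF R(1)] P[OF R(2)] P[OF R(3)] P[OF R(4)] P[OF R(5)] P[OF R(6)] P[OF R(7)]
  have N: "\<And>p q r s t u v. \<lbrakk>C7 p q r s t u v; {p, q, r, s, t, u, v} = {a, b, c, d, e, f, g}\<rbrakk> \<Longrightarrow>
      \<not> arc3 (y \<sim> p) (y \<sim> q) (y \<sim> r) (y \<sim> s) (y \<sim> t) (y \<sim> u) (y \<sim> v)"
    using C7_pendant_not_arc3[OF _ assms(2)] k by metis
  note N = N[OF R(1)] N[OF R(2)] N[OF R(3)] N[OF R(4)] N[OF R(5)] N[OF R(6)] N[OF R(7)]
  have "y \<sim> d \<and> \<not> y \<sim> e \<and> \<not> y \<sim> f \<and> \<not> y \<sim> g \<longrightarrow> k' \<sim> y"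
    "y \<sim> e \<and> \<not> y \<sim> f \<and> \<not> y \<sim> g \<and> \<not> y \<sim> a \<longrightarrow> k' \<sim> y"
    "y \<sim> f \<and> \<not> y \<sim> g \<and> \<not> y \<sim> a \<and> \<not> y \<sim> b \<longrightarrow> k' \<sim> y"
    "y \<sim> g \<and> \<not> y \<sim> a \<and> \<not> y \<sim> b \<and> \<not> y \<sim> c \<longrightarrow> k' \<sim> y"
    "y \<sim> a \<and> \<not> y \<sim> b \<and> \<not> y \<sim> c \<and> \<not> y \<sim> d \<longrightarrow> k' \<sim> y"
    "y \<sim> b \<and> \<not> y \<sim> c \<and> \<not> y \<sim> d \<and> \<not> y \<sim> e \<longrightarrow> k' \<sim> y"
    "y \<sim> c \<and> \<not> y \<sim> d \<and> \<not> y \<sim> e \<and> \<not> y \<sim> f \<longrightarrow> k' \<sim> y"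
    by (rule P; auto)+
  then show ?thesis using y unfolding arc7_def by satx
qed

text \<open>Arcs of three vertices are excluded by \<open>C7_pendant_not_arc3\<close>, and two arcs
  of four vertices overlap on seven positions.\<close>

lemma C7_pendant_meet:
  assumes H: "C7 a b c d e f g" and "k \<sim> y" "k \<sim> y'"
    and k: "\<forall>h\<in>{a, b, c, d, e, f, g}. \<not> k \<sim> h"
    and y: "arc7 (y \<sim> a) (y \<sim> b) (y \<sim> c) (y \<sim> d) (y \<sim> e) (y \<sim> f) (y \<sim> g)"
    and y': "arc7 (y' \<sim> a) (y' \<sim> b) (y' \<sim> c) (y' \<sim> d) (y' \<sim> e) (y' \<sim> f) (y' \<sim> g)"
  shows "\<exists>h\<in>{a, b, c, d, e, f, g}. y \<sim> h \<and> y' \<sim> h"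
proof -
  note R = C7_rotations[OF H]
  have N: "\<not> arc3 (z \<sim> a) (z \<sim> b) (z \<sim> c) (z \<sim> d) (z \<sim> e) (z \<sim> f) (z \<sim> g)"
    "\<not> arc3 (z \<sim> b) (z \<sim> c) (z \<sim> d) (z \<sim> e) (z \<sim> f) (z \<sim> g) (z \<sim> a)"
    "\<not> arc3 (z \<sim> c) (z \<sim> d) (z \<sim> e) (z \<sim> f) (z \<sim> g) (z \<sim> a) (z \<sim> b)"
    "\<not> arc3 (z \<sim> d) (z \<sim> e) (z \<sim> f) (z \<sim> g) (z \<sim> a) (z \<sim> b) (z \<sim> c)"
    "\<not> arc3 (z \<sim> e) (z \<sim> f) (z \<sim> g) (z \<sim> a) (z \<sim> b) (z \<sim> c) (z \<sim> d)"
    "\<not> arc3 (z \<sim> f) (z \<sim> g) (z \<sim> a) (z \<sim> b) (z \<sim> c) (z \<sim> d) (z \<sim> e)"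
    "\<not> arc3 (z \<sim> g) (z \<sim> a) (z \<sim> b) (z \<sim> c) (z \<sim> d) (z \<sim> e) (z \<sim> f)"
    if "k \<sim> z" for z
    by (rule R[THEN C7_pendant_not_arc3[OF _ that]]; use k in simp)+
  have "y \<sim> a \<and> y' \<sim> a \<or> y \<sim> b \<and> y' \<sim> b \<or> y \<sim> c \<and> y' \<sim> c \<or> y \<sim> d \<and> y' \<sim> d \<or>
    y \<sim> e \<and> y' \<sim> e \<or> y \<sim> f \<and> y' \<sim> f \<or> y \<sim> g \<and> y' \<sim> g"
    using y y' N[OF assms(2)] N[OF assms(3)] unfolding arc7_def arc3_def by satx
  then show ?thesis by blast
qed

lemma C7_complete_adj:
  assumes H: "C7 a b c d e f g" and y: "\<forall>h\<in>{a, b, c, d, e, f, g}. y \<sim> h" and "x \<noteq> y"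
    and x: "arc7 (x \<sim> a) (x \<sim> b) (x \<sim> c) (x \<sim> d) (x \<sim> e) (x \<sim> f) (x \<sim> g) \<or>
       (\<forall>h\<in>{a, b, c, d, e, f, g}. x \<sim> h)"
  shows "x \<sim> y"
proof -
  \<comment> \<open>two vertices at distance two on the cycle have no chord, so they force \<open>x \<sim> y\<close> by C4-freeness\<close>
  have "(x \<sim> a \<and> x \<sim> c) \<or> (x \<sim> b \<and> x \<sim> d) \<or> (x \<sim> c \<and> x \<sim> e) \<or> (x \<sim> d \<and> x \<sim> f) \<or>
    (x \<sim> e \<and> x \<sim> g) \<or> (x \<sim> f \<and> x \<sim> a) \<or> (x \<sim> g \<and> x \<sim> b)"
    using x by (auto simp: arc7_def)
  then obtain p q where pq: "x \<sim> p" "x \<sim> q" "\<not> p \<sim> q" "p \<noteq> q" "y \<sim> p" "y \<sim> q"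
    using H y C7_distinct[OF H] unfolding C7_def by (elim disjE) auto
  then show ?thesis using common_nbrs_adj[of x p q y] assms(3) by blast
qed

end

text \<open>The clique \<open>A \<inter> B\<close> may be empty, so \<open>no_clique_cutset\<close>
  includes connectedness of \<open>V\<close>.\<close>

locale reduced_graph = p7_c4_c5_free adj for adj :: "'a \<Rightarrow> 'a \<Rightarrow> bool" (infix "\<sim>" 50) +
  fixes V :: "'a set"
  assumes finite_V: "finite V"
    and no_clique_cutset: "\<lbrakk>A \<union> B = V; A \<noteq> V; B \<noteq> V; clq (A \<inter> B)\<rbrakk> \<Longrightarrow> \<exists>a\<in>A - B. \<exists>b\<in>B - A. a \<sim> b"
    and no_universal: "u \<in> V \<Longrightarrow> \<exists>x\<in>V. x \<noteq> u \<and> \<not> u \<sim> x"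
begin

text \<open>The component \<open>K\<close> of \<open>z\<close> among the vertices that see nothing
  of the cycle is separated from the cycle by its neighbourhood \<open>N\<close>, and
  \<open>N\<close> is a clique. A vertex of \<open>N\<close> complete to the cycle is adjacent to
  the others by \<open>C7_complete_adj\<close>. Two vertices with arcs have two nonadjacent common
  neighbours: \<open>z\<close> and a vertex of the cycle.\<close>

lemma C7_dominating:
  assumes H: "C7 a b c d e f g" and HV: "{a, b, c, d, e, f, g} \<subseteq> V" and z: "z \<in> V"
  shows "\<exists>h\<in>{a, b, c, d, e, f, g}. z \<sim> h"
proof (rule ccontr)
  let ?H = "{a, b, c, d, e, f, g}"
  assume "\<not> ?thesis"
  then have z0: "\<forall>h\<in>?H. \<not> z \<sim> h" by blast
  define Z where "Z = {x \<in> V. \<forall>h\<in>?H. \<not> x \<sim> h}"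
  have ZH: "x \<notin> ?H" if "x \<in> Z" for x
    using that H by (auto simp: Z_def C7_def adj_commute)
  define K where "K = {y. (z, y) \<in> (edges_in Z)\<^sup>*}"
  define N where "N = {y \<in> V - K. \<exists>k\<in>K. k \<sim> y}"
  have "z \<in> Z" using z z0 by (simp add: Z_def)
  then have KZ: "K \<subseteq> Z" and zK: "z \<in> K"
    using edges_in_rtrancl_mem[of z _ Z] by (auto simp: K_def)
  have Kstep: "y \<in> K" if "k \<in> K" "k \<sim> y" "y \<in> Z" for k y
  proof -
    have "(k, y) \<in> edges_in Z" using that KZ by (auto simp: edges_in_def)
    then show ?thesis using that(1) by (auto simp: K_def)
  qed
  have NZ: "y \<notin> Z" if "y \<in> N" for y using that Kstep by (auto simp: N_def)
  have NH: "y \<notin> ?H" if "y \<in> N" for y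
    using that KZ by (auto simp: N_def Z_def)
  have Ntype: "arc7 (y \<sim> a) (y \<sim> b) (y \<sim> c) (y \<sim> d) (y \<sim> e) (y \<sim> f) (y \<sim> g) \<or> (\<forall>h\<in>?H. y \<sim> h)"
    if "y \<in> N" for y
    using C7_attach[OF H NH[OF that]] NZ[OF that] that by (auto simp: N_def Z_def)
  have complete: "z \<sim> y"
    if y: "y \<in> N" and arc: "arc7 (y \<sim> a) (y \<sim> b) (y \<sim> c) (y \<sim> d) (y \<sim> e) (y \<sim> f) (y \<sim> g)" for y
  proof -
    obtain k where k: "k \<in> K" "k \<sim> y" using y by (auto simp: N_def)
    have "(k, z) \<in> (edges_in Z)\<^sup>*"
      using k(1) sym_rtrancl[OF sym_edges_in] by (auto simp: K_def dest: symD)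
    then show ?thesis
    proof (induction rule: rtrancl_induct)
      case base show ?case by (fact k(2))
    next
      case (step p q)
      then show ?case
        using C7_pendant_step[OF H, of p y q] arc adj_sym[of p q] by (auto simp: edges_in_def Z_def)
    qed
  qed
  have "clq N" unfolding clq_def
  proof (intro ballI impI)
    fix y y' assume y: "y \<in> N" "y' \<in> N" "y \<noteq> y'"
    show "y \<sim> y'"
    proof (cases "(\<forall>h\<in>?H. y \<sim> h) \<or> (\<forall>h\<in>?H. y' \<sim> h)")
      case True
      then show ?thesis
        using C7_complete_adj[OF H, of y y'] C7_complete_adj[OF H, of y' y] Ntype y adj_sym by blast
    next
      case False
      then have arcs: "arc7 (y \<sim> a) (y \<sim> b) (y \<sim> c) (y \<sim> d) (y \<sim> e) (y \<sim> f) (y \<sim> g)"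
        "arc7 (y' \<sim> a) (y' \<sim> b) (y' \<sim> c) (y' \<sim> d) (y' \<sim> e) (y' \<sim> f) (y' \<sim> g)"
        using Ntype y by blast+
      have zy: "z \<sim> y" "z \<sim> y'" using complete y arcs by blast+
      then obtain h where h: "h \<in> ?H" "y \<sim> h" "y' \<sim> h"
        using C7_pendant_meet[OF H zy z0 arcs] by blast
      have "\<not> z \<sim> h" "z \<noteq> h" using h(1) z0 ZH[OF \<open>z \<in> Z\<close>] by auto
      then show ?thesis
        using common_nbrs_adj[of y z h y'] zy h y(3) adj_sym by blast
    qed
  qed
  moreover have "(K \<union> N) \<inter> (V - K) = N" "(K \<union> N) \<union> (V - K) = V"
    using KZ by (auto simp: N_def Z_def)
  moreover have "a \<notin> K \<union> N" using ZH NH KZ by blast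
  ultimately have "\<exists>x\<in>K \<union> N - (V - K). \<exists>y\<in>V - K - (K \<union> N). x \<sim> y"
    using no_clique_cutset[of "K \<union> N" "V - K"] HV zK z by auto
  then show False by (auto simp: N_def)
qed

text \<open>Of the three attachments, the empty one is excluded by \<open>C7_dominating\<close>. A
  vertex with the full one would be adjacent to every other vertex, against
  \<open>no_universal\<close>.\<close>

lemma C7_arc:
  assumes H: "C7 a b c d e f g" and HV: "{a, b, c, d, e, f, g} \<subseteq> V"
    and x: "x \<in> V" "x \<notin> {a, b, c, d, e, f, g}"
  shows "arc7 (x \<sim> a) (x \<sim> b) (x \<sim> c) (x \<sim> d) (x \<sim> e) (x \<sim> f) (x \<sim> g)"
proof -
  let ?H = "{a, b, c, d, e, f, g}"
  let ?arc = "\<lambda>x. arc7 (x \<sim> a) (x \<sim> b) (x \<sim> c) (x \<sim> d) (x \<sim> e) (x \<sim> f) (x \<sim> g)"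
  have type: "?arc y \<or> (\<forall>h\<in>?H. y \<sim> h)" if "y \<in> V" "y \<notin> ?H" for y
    using C7_attach[OF H that(2)] C7_dominating[OF H HV that(1)] by auto
  have "\<not> (\<forall>h\<in>?H. x \<sim> h)"
  proof
    assume *: "\<forall>h\<in>?H. x \<sim> h"
    have "x \<sim> y" if "y \<in> V" "y \<noteq> x" for y
    proof (cases "y \<in> ?H")
      case True then show ?thesis using * by blast
    next
      case False
      then show ?thesis using C7_complete_adj[OF H *] type that adj_sym by blast
    qed
    then show False using no_universal[OF x(1)] by blast
  qed
  then show ?thesis using type x by blast
qed

definition deg :: "'a \<Rightarrow> nat" where
  "deg x = card {y \<in> V. x \<sim> y}"

text \<open>Otherwise the closed neighbourhood of \<open>h\<close> lies in that of \<open>x\<close>,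
  properly because of \<open>y\<close>, and the degrees compare the wrong way round.\<close>

lemma deg_exchange:
  assumes "x \<in> V" "h \<in> V" "x \<sim> h" "y \<in> V" "x \<sim> y" "\<not> h \<sim> y" "y \<noteq> h" "deg x \<le> deg h"
  shows "\<exists>u\<in>V. u \<sim> h \<and> \<not> u \<sim> x \<and> u \<noteq> x"
proof (rule ccontr)
  assume "\<not> ?thesis"
  then have "insert h {u \<in> V. h \<sim> u} \<subseteq> insert x {u \<in> V. x \<sim> u}"
    using assms(2,3) adj_commute by blast
  moreover have "y \<in> insert x {u \<in> V. x \<sim> u} - insert h {u \<in> V. h \<sim> u}"
    using assms by auto
  ultimately have "insert h {u \<in> V. h \<sim> u} \<subset> insert x {u \<in> V. x \<sim> u}" by blast
  then have "card (insert h {u \<in> V. h \<sim> u}) < card (insert x {u \<in> V. x \<sim> u})"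
    using finite_V by (intro psubset_card_mono) auto
  then show False using assms(8) finite_V adj_irrefl by (simp add: deg_def)
qed

text \<open>Since \<open>x\<close> can replace \<open>a\<close> on the cycle, the neighbour
  \<open>u\<close> of \<open>a\<close> given by \<open>deg_exchange\<close> has an arc on both
  cycles, and the two arcs differ only at this position. Hence its arc on the old cycle has four
  vertices and \<open>a\<close> is one of its ends. The arc \<open>a, b, c, d\<close> is impossible,
  because \<open>b\<close> and \<open>d\<close> would make \<open>u\<close> adjacent to
  \<open>y\<close>.\<close>

lemma C7_far_pair:
  assumes H: "C7 a b c d e f g" and HV: "{a, b, c, d, e, f, g} \<subseteq> V"
    and x: "x \<in> V" "arc3 (x \<sim> g) (x \<sim> a) (x \<sim> b) (x \<sim> c) (x \<sim> d) (x \<sim> e) (x \<sim> f)" "x \<notin> {a, b, c, d, e, f, g}"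
    and y: "y \<in> V" "arc3 (y \<sim> b) (y \<sim> c) (y \<sim> d) (y \<sim> e) (y \<sim> f) (y \<sim> g) (y \<sim> a)" "y \<notin> {a, b, c, d, e, f, g}"
    and xy: "x \<sim> y" and deg: "deg x \<le> deg a"
  shows "\<exists>u\<in>V. u \<sim> e \<and> u \<sim> f \<and> u \<sim> g \<and> u \<sim> a \<and> \<not> u \<sim> b \<and> \<not> u \<sim> c \<and> \<not> u \<sim> d \<and> \<not> u \<sim> x \<and> \<not> u \<sim> y"
proof -
  have xa: "x \<sim> g" "x \<sim> a" "x \<sim> b" "\<not> x \<sim> c" "\<not> x \<sim> d" "\<not> x \<sim> e" "\<not> x \<sim> f" using x by (auto simp: arc3_def)
  have ya: "y \<sim> b" "y \<sim> c" "y \<sim> d" "\<not> y \<sim> e" "\<not> y \<sim> f" "\<not> y \<sim> g" "\<not> y \<sim> a" using y by (auto simp: arc3_def)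
  have H': "C7 x b c d e f g" using H xa adj_commute unfolding C7_def by blast
  have "\<not> a \<sim> y" using ya adj_sym by blast
  then obtain u where u: "u \<in> V" "u \<sim> a" "\<not> u \<sim> x" "u \<noteq> x"
    using deg_exchange[OF x(1) _ xa(2) y(1) xy _ _ deg] y(3) HV by blast
  have "u \<notin> {a, b, c, d, e, f, g}"
    using u xa H adj_commute adj_irrefl unfolding C7_def by blast
  then have arcs: "arc7 (u \<sim> a) (u \<sim> b) (u \<sim> c) (u \<sim> d) (u \<sim> e) (u \<sim> f) (u \<sim> g)"
    "arc7 (u \<sim> x) (u \<sim> b) (u \<sim> c) (u \<sim> d) (u \<sim> e) (u \<sim> f) (u \<sim> g)"
    using C7_arc[OF H HV u(1)] C7_arc[OF H' _ u(1)] u(4) x(1) HV by auto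
  have uy: "\<not> u \<sim> y"
    using C4_D[of x a y u] u xa ya xy y(3) adj_commute by blast
  have "\<not> (u \<sim> b \<and> u \<sim> d)"
  proof
    assume "u \<sim> b \<and> u \<sim> d"
    moreover have "u \<noteq> y" "\<not> b \<sim> d" "b \<noteq> d" using ya u(2) H C7_distinct[OF H] by (auto simp: C7_def)
    ultimately show False using common_nbrs_adj[of u b d y] ya uy by blast
  qed
  then have "u \<sim> e \<and> u \<sim> f \<and> u \<sim> g \<and> \<not> u \<sim> b \<and> \<not> u \<sim> c \<and> \<not> u \<sim> d"
    using arcs u(2,3) unfolding arc7_def by satx
  then show ?thesis using u uy by blast
qed

end

subsection \<open>Attachments to the square of an 11-cycle\<close>

text \<open>Five cyclically consecutive positions, the closed neighbourhood of the middle one in the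
  square of the 11-cycle.\<close>

definition arc11 :: "bool \<Rightarrow> bool \<Rightarrow> bool \<Rightarrow> bool \<Rightarrow> bool \<Rightarrow> bool \<Rightarrow> bool \<Rightarrow> bool \<Rightarrow> bool \<Rightarrow> bool \<Rightarrow> bool \<Rightarrow> bool" where
  "arc11 c0 c1 c2 c3 c4 c5 c6 c7 c8 c9 c10 \<longleftrightarrow>
    (c0 \<and> c1 \<and> c2 \<and> \<not> c3 \<and> \<not> c4 \<and> \<not> c5 \<and> \<not> c6 \<and> \<not> c7 \<and> \<not> c8 \<and> c9 \<and> c10) \<or>
    (c0 \<and> c1 \<and> c2 \<and> c3 \<and> \<not> c4 \<and> \<not> c5 \<and> \<not> c6 \<and> \<not> c7 \<and> \<not> c8 \<and> \<not> c9 \<and> c10) \<or>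
    (c0 \<and> c1 \<and> c2 \<and> c3 \<and> c4 \<and> \<not> c5 \<and> \<not> c6 \<and> \<not> c7 \<and> \<not> c8 \<and> \<not> c9 \<and> \<not> c10) \<or>
    (\<not> c0 \<and> c1 \<and> c2 \<and> c3 \<and> c4 \<and> c5 \<and> \<not> c6 \<and> \<not> c7 \<and> \<not> c8 \<and> \<not> c9 \<and> \<not> c10) \<or>
    (\<not> c0 \<and> \<not> c1 \<and> c2 \<and> c3 \<and> c4 \<and> c5 \<and> c6 \<and> \<not> c7 \<and> \<not> c8 \<and> \<not> c9 \<and> \<not> c10) \<or>
    (\<not> c0 \<and> \<not> c1 \<and> \<not> c2 \<and> c3 \<and> c4 \<and> c5 \<and> c6 \<and> c7 \<and> \<not> c8 \<and> \<not> c9 \<and> \<not> c10) \<or>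
    (\<not> c0 \<and> \<not> c1 \<and> \<not> c2 \<and> \<not> c3 \<and> c4 \<and> c5 \<and> c6 \<and> c7 \<and> c8 \<and> \<not> c9 \<and> \<not> c10) \<or>
    (\<not> c0 \<and> \<not> c1 \<and> \<not> c2 \<and> \<not> c3 \<and> \<not> c4 \<and> c5 \<and> c6 \<and> c7 \<and> c8 \<and> c9 \<and> \<not> c10) \<or>
    (\<not> c0 \<and> \<not> c1 \<and> \<not> c2 \<and> \<not> c3 \<and> \<not> c4 \<and> \<not> c5 \<and> c6 \<and> c7 \<and> c8 \<and> c9 \<and> c10) \<or>
    (c0 \<and> \<not> c1 \<and> \<not> c2 \<and> \<not> c3 \<and> \<not> c4 \<and> \<not> c5 \<and> \<not> c6 \<and> c7 \<and> c8 \<and> c9 \<and> c10) \<or>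
    (c0 \<and> c1 \<and> \<not> c2 \<and> \<not> c3 \<and> \<not> c4 \<and> \<not> c5 \<and> \<not> c6 \<and> \<not> c7 \<and> c8 \<and> c9 \<and> c10)"

text \<open>Taking positions \<open>0, 2, 4, 5, 7, 8, 10\<close> and their rotations gives eleven induced 7-cycles.\<close>

lemma arc11_from_arc7:
  assumes "arc7 c0 c2 c4 c5 c7 c8 c10"
    "arc7 c1 c3 c5 c6 c8 c9 c0"
    "arc7 c2 c4 c6 c7 c9 c10 c1"
    "arc7 c3 c5 c7 c8 c10 c0 c2"
    "arc7 c4 c6 c8 c9 c0 c1 c3"
    "arc7 c5 c7 c9 c10 c1 c2 c4"
    "arc7 c6 c8 c10 c0 c2 c3 c5"
    "arc7 c7 c9 c0 c1 c3 c4 c6"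
    "arc7 c8 c10 c1 c2 c4 c5 c7"
    "arc7 c9 c0 c2 c3 c5 c6 c8"
    "arc7 c10 c1 c3 c4 c6 c7 c9"
    and "c0 \<and> c6 \<longrightarrow> c2 \<or> c4"
    "c1 \<and> c7 \<longrightarrow> c3 \<or> c5"
    "c2 \<and> c8 \<longrightarrow> c4 \<or> c6"
    "c3 \<and> c9 \<longrightarrow> c5 \<or> c7"
    "c4 \<and> c10 \<longrightarrow> c6 \<or> c8"
    "c5 \<and> c0 \<longrightarrow> c7 \<or> c9"
    "c6 \<and> c1 \<longrightarrow> c8 \<or> c10"
    "c7 \<and> c2 \<longrightarrow> c9 \<or> c0"
    "c8 \<and> c3 \<longrightarrow> c10 \<or> c1"
    "c9 \<and> c4 \<longrightarrow> c0 \<or> c2"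
    "c10 \<and> c5 \<longrightarrow> c1 \<or> c3"
  shows "arc11 c0 c1 c2 c3 c4 c5 c6 c7 c8 c9 c10"
  using assms unfolding arc7_def arc11_def by satx

text \<open>Three consecutive positions are a triangle of the square.\<close>

definition meet11 :: "bool \<Rightarrow> bool \<Rightarrow> bool \<Rightarrow> bool \<Rightarrow> bool \<Rightarrow> bool \<Rightarrow> bool \<Rightarrow> bool \<Rightarrow> bool \<Rightarrow> bool \<Rightarrow> bool \<Rightarrow> bool" where
  "meet11 c0 c1 c2 c3 c4 c5 c6 c7 c8 c9 c10 \<longleftrightarrow>
    (c0 \<and> c1 \<and> c2) \<or>
    (c1 \<and> c2 \<and> c3) \<or>
    (c2 \<and> c3 \<and> c4) \<or>
    (c3 \<and> c4 \<and> c5) \<or>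
    (c4 \<and> c5 \<and> c6) \<or>
    (c5 \<and> c6 \<and> c7) \<or>
    (c6 \<and> c7 \<and> c8) \<or>
    (c7 \<and> c8 \<and> c9) \<or>
    (c8 \<and> c9 \<and> c10) \<or>
    (c9 \<and> c10 \<and> c0) \<or>
    (c10 \<and> c0 \<and> c1)"

text \<open>Two arcs share three consecutive positions exactly when their centres are at distance at
  most 2. Three centres pairwise that close on an 11-cycle lie among three consecutive positions, so
  the arcs have three positions in common.\<close>

lemma arc11_triple:
  assumes "arc11 c0x c1x c2x c3x c4x c5x c6x c7x c8x c9x c10x" "arc11 c0y c1y c2y c3y c4y c5y c6y c7y c8y c9y c10y"
      "arc11 c0z c1z c2z c3z c4z c5z c6z c7z c8z c9z c10z"
    "meet11 (c0x \<and> c0y) (c1x \<and> c1y) (c2x \<and> c2y) (c3x \<and> c3y) (c4x \<and> c4y) (c5x \<and> c5y) (c6x \<and> c6y) (c7x \<and> c7y) (c8x \<and>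
        c8y) (c9x \<and> c9y) (c10x \<and> c10y)"
    "meet11 (c0x \<and> c0z) (c1x \<and> c1z) (c2x \<and> c2z) (c3x \<and> c3z) (c4x \<and> c4z) (c5x \<and> c5z) (c6x \<and> c6z) (c7x \<and> c7z) (c8x \<and>
        c8z) (c9x \<and> c9z) (c10x \<and> c10z)"
    "meet11 (c0y \<and> c0z) (c1y \<and> c1z) (c2y \<and> c2z) (c3y \<and> c3z) (c4y \<and> c4z) (c5y \<and> c5z) (c6y \<and> c6z) (c7y \<and> c7z) (c8y \<and>
        c8z) (c9y \<and> c9z) (c10y \<and> c10z)"
  shows "meet11 (c0x \<and> c0y \<and> c0z) (c1x \<and> c1y \<and> c1z) (c2x \<and> c2y \<and> c2z) (c3x \<and> c3y \<and> c3z) (c4x \<and> c4y \<and> c4z) (c5x \<and> c5y \<and>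
      c5z) (c6x \<and> c6y \<and> c6z) (c7x \<and> c7y \<and> c7z) (c8x \<and> c8y \<and> c8z) (c9x \<and> c9y \<and> c9z) (c10x \<and> c10y \<and> c10z)"
  using assms unfolding arc11_def meet11_def by satx

text \<open>The assumptions exclude induced 4-cycles over the edges of the square and induced
  5-cycles over the paths \<open>i, i + 2, i + 4\<close>. Arcs with centres at distance at least 3
  would produce one of these.\<close>

lemma arc11_pair:
  assumes "arc11 c0x c1x c2x c3x c4x c5x c6x c7x c8x c9x c10x" "arc11 c0y c1y c2y c3y c4y c5y c6y c7y c8y c9y c10y"
    "\<not> (c0x \<and> \<not> c0y \<and> c1y \<and> \<not> c1x)"
    "\<not> (c0x \<and> \<not> c0y \<and> c2y \<and> \<not> c2x)"
    "\<not> (c1x \<and> \<not> c1y \<and> c2y \<and> \<not> c2x)"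
    "\<not> (c1x \<and> \<not> c1y \<and> c3y \<and> \<not> c3x)"
    "\<not> (c2x \<and> \<not> c2y \<and> c3y \<and> \<not> c3x)"
    "\<not> (c2x \<and> \<not> c2y \<and> c4y \<and> \<not> c4x)"
    "\<not> (c3x \<and> \<not> c3y \<and> c4y \<and> \<not> c4x)"
    "\<not> (c3x \<and> \<not> c3y \<and> c5y \<and> \<not> c5x)"
    "\<not> (c4x \<and> \<not> c4y \<and> c5y \<and> \<not> c5x)"
    "\<not> (c4x \<and> \<not> c4y \<and> c6y \<and> \<not> c6x)"
    "\<not> (c5x \<and> \<not> c5y \<and> c6y \<and> \<not> c6x)"
    "\<not> (c5x \<and> \<not> c5y \<and> c7y \<and> \<not> c7x)"
    "\<not> (c6x \<and> \<not> c6y \<and> c7y \<and> \<not> c7x)"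
    "\<not> (c6x \<and> \<not> c6y \<and> c8y \<and> \<not> c8x)"
    "\<not> (c7x \<and> \<not> c7y \<and> c8y \<and> \<not> c8x)"
    "\<not> (c7x \<and> \<not> c7y \<and> c9y \<and> \<not> c9x)"
    "\<not> (c8x \<and> \<not> c8y \<and> c9y \<and> \<not> c9x)"
    "\<not> (c8x \<and> \<not> c8y \<and> c10y \<and> \<not> c10x)"
    "\<not> (c9x \<and> \<not> c9y \<and> c10y \<and> \<not> c10x)"
    "\<not> (c9x \<and> \<not> c9y \<and> c0y \<and> \<not> c0x)"
    "\<not> (c10x \<and> \<not> c10y \<and> c0y \<and> \<not> c0x)"
    "\<not> (c10x \<and> \<not> c10y \<and> c1y \<and> \<not> c1x)"
    "\<not> (c0y \<and> \<not> c0x \<and> c1x \<and> \<not> c1y)"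
    "\<not> (c0y \<and> \<not> c0x \<and> c2x \<and> \<not> c2y)"
    "\<not> (c1y \<and> \<not> c1x \<and> c2x \<and> \<not> c2y)"
    "\<not> (c1y \<and> \<not> c1x \<and> c3x \<and> \<not> c3y)"
    "\<not> (c2y \<and> \<not> c2x \<and> c3x \<and> \<not> c3y)"
    "\<not> (c2y \<and> \<not> c2x \<and> c4x \<and> \<not> c4y)"
    "\<not> (c3y \<and> \<not> c3x \<and> c4x \<and> \<not> c4y)"
    "\<not> (c3y \<and> \<not> c3x \<and> c5x \<and> \<not> c5y)"
    "\<not> (c4y \<and> \<not> c4x \<and> c5x \<and> \<not> c5y)"
    "\<not> (c4y \<and> \<not> c4x \<and> c6x \<and> \<not> c6y)"
    "\<not> (c5y \<and> \<not> c5x \<and> c6x \<and> \<not> c6y)"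
    "\<not> (c5y \<and> \<not> c5x \<and> c7x \<and> \<not> c7y)"
    "\<not> (c6y \<and> \<not> c6x \<and> c7x \<and> \<not> c7y)"
    "\<not> (c6y \<and> \<not> c6x \<and> c8x \<and> \<not> c8y)"
    "\<not> (c7y \<and> \<not> c7x \<and> c8x \<and> \<not> c8y)"
    "\<not> (c7y \<and> \<not> c7x \<and> c9x \<and> \<not> c9y)"
    "\<not> (c8y \<and> \<not> c8x \<and> c9x \<and> \<not> c9y)"
    "\<not> (c8y \<and> \<not> c8x \<and> c10x \<and> \<not> c10y)"
    "\<not> (c9y \<and> \<not> c9x \<and> c10x \<and> \<not> c10y)"
    "\<not> (c9y \<and> \<not> c9x \<and> c0x \<and> \<not> c0y)"
    "\<not> (c10y \<and> \<not> c10x \<and> c0x \<and> \<not> c0y)"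
    "\<not> (c10y \<and> \<not> c10x \<and> c1x \<and> \<not> c1y)"
    "\<not> (c0x \<and> \<not> c0y \<and> \<not> c2x \<and> \<not> c2y \<and> c4y \<and> \<not> c4x)"
    "\<not> (c1x \<and> \<not> c1y \<and> \<not> c3x \<and> \<not> c3y \<and> c5y \<and> \<not> c5x)"
    "\<not> (c2x \<and> \<not> c2y \<and> \<not> c4x \<and> \<not> c4y \<and> c6y \<and> \<not> c6x)"
    "\<not> (c3x \<and> \<not> c3y \<and> \<not> c5x \<and> \<not> c5y \<and> c7y \<and> \<not> c7x)"
    "\<not> (c4x \<and> \<not> c4y \<and> \<not> c6x \<and> \<not> c6y \<and> c8y \<and> \<not> c8x)"
    "\<not> (c5x \<and> \<not> c5y \<and> \<not> c7x \<and> \<not> c7y \<and> c9y \<and> \<not> c9x)"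
    "\<not> (c6x \<and> \<not> c6y \<and> \<not> c8x \<and> \<not> c8y \<and> c10y \<and> \<not> c10x)"
    "\<not> (c7x \<and> \<not> c7y \<and> \<not> c9x \<and> \<not> c9y \<and> c0y \<and> \<not> c0x)"
    "\<not> (c8x \<and> \<not> c8y \<and> \<not> c10x \<and> \<not> c10y \<and> c1y \<and> \<not> c1x)"
    "\<not> (c9x \<and> \<not> c9y \<and> \<not> c0x \<and> \<not> c0y \<and> c2y \<and> \<not> c2x)"
    "\<not> (c10x \<and> \<not> c10y \<and> \<not> c1x \<and> \<not> c1y \<and> c3y \<and> \<not> c3x)"
    "\<not> (c0y \<and> \<not> c0x \<and> \<not> c2y \<and> \<not> c2x \<and> c4x \<and> \<not> c4y)"
    "\<not> (c1y \<and> \<not> c1x \<and> \<not> c3y \<and> \<not> c3x \<and> c5x \<and> \<not> c5y)"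
    "\<not> (c2y \<and> \<not> c2x \<and> \<not> c4y \<and> \<not> c4x \<and> c6x \<and> \<not> c6y)"
    "\<not> (c3y \<and> \<not> c3x \<and> \<not> c5y \<and> \<not> c5x \<and> c7x \<and> \<not> c7y)"
    "\<not> (c4y \<and> \<not> c4x \<and> \<not> c6y \<and> \<not> c6x \<and> c8x \<and> \<not> c8y)"
    "\<not> (c5y \<and> \<not> c5x \<and> \<not> c7y \<and> \<not> c7x \<and> c9x \<and> \<not> c9y)"
    "\<not> (c6y \<and> \<not> c6x \<and> \<not> c8y \<and> \<not> c8x \<and> c10x \<and> \<not> c10y)"
    "\<not> (c7y \<and> \<not> c7x \<and> \<not> c9y \<and> \<not> c9x \<and> c0x \<and> \<not> c0y)"
    "\<not> (c8y \<and> \<not> c8x \<and> \<not> c10y \<and> \<not> c10x \<and> c1x \<and> \<not> c1y)"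
    "\<not> (c9y \<and> \<not> c9x \<and> \<not> c0y \<and> \<not> c0x \<and> c2x \<and> \<not> c2y)"
    "\<not> (c10y \<and> \<not> c10x \<and> \<not> c1y \<and> \<not> c1x \<and> c3x \<and> \<not> c3y)"
  shows "meet11 (c0x \<and> c0y) (c1x \<and> c1y) (c2x \<and> c2y) (c3x \<and> c3y) (c4x \<and> c4y) (c5x \<and> c5y) (c6x \<and> c6y) (c7x \<and> c7y) (c8x \<and>
      c8y) (c9x \<and> c9y) (c10x \<and> c10y)"
  using assms unfolding arc11_def meet11_def by satx

lemma arc7_rotate: "arc7 a b c d e f g \<Longrightarrow> arc7 b c d e f g a"
  unfolding arc7_def by satx

lemma meet7_rotate: "meet7 a b c d e f g \<Longrightarrow> meet7 b c d e f g a"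
  unfolding meet7_def by satx

section \<open>Colourings and Helly properties of the two configurations\<close>

context p7_c4_c5_free
begin

lemma colourable_stable: "(\<And>x y. x \<in> S \<Longrightarrow> y \<in> S \<Longrightarrow> \<not> x \<sim> y) \<Longrightarrow> colourable S (Suc 0)"
  by (auto simp: colourable_def proper_def intro!: exI[of _ "\<lambda>_. 0"])

lemma C7_colourable:
  assumes "C7 a b c d e f g"
  shows "colourable {a, b, c, d, e, f, g} 3"
proof -
  have "colourable {a, c, e} 1" "colourable {b, d, f} 1" "colourable {g} 1"
    using assms by (auto intro!: colourable_stable simp: C7_def adj_commute adj_irrefl)
  then have "colourable ({a, c, e} \<union> {b, d, f} \<union> {g}) (1 + 1 + 1)"
    by (intro colourable_Un)
  then show ?thesis by (rule colourable_mono) auto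
qed

text \<open>Only the three edges inside \<open>a, b, c, d\<close> are candidates, because
  \<open>x\<close> sees nothing else. If \<open>p\<close>, \<open>q\<close>, \<open>r\<close> each
  spoil one of them, the common edge of \<open>x\<close>, \<open>p\<close>, \<open>q\<close> must be
  \<open>c d\<close> and that of \<open>x\<close>, \<open>q\<close>, \<open>r\<close> must be
  \<open>a b\<close>. Then \<open>q\<close> sees \<open>b\<close> and \<open>c\<close>, the edge it
  was chosen to spoil.\<close>

lemma C7_helly_aux:
  assumes edges: "a \<sim> b" "b \<sim> c" "c \<sim> d" "{a, b, c, d} \<subseteq> S"
    and arcs: "\<And>k. k \<in> K \<Longrightarrow> arc7 (k \<sim> a) (k \<sim> b) (k \<sim> c) (k \<sim> d) (k \<sim> e) (k \<sim> f) (k \<sim> g)"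
    and meet: "\<And>k l. k \<in> K \<Longrightarrow> l \<in> K \<Longrightarrow> meet7 (k \<sim> a \<and> l \<sim> a) (k \<sim> b \<and> l \<sim> b) (k \<sim> c \<and> l \<sim> c)
      (k \<sim> d \<and> l \<sim> d) (k \<sim> e \<and> l \<sim> e) (k \<sim> f \<and> l \<sim> f) (k \<sim> g \<and> l \<sim> g)"
    and x: "x \<in> K" "\<not> x \<sim> e" "\<not> x \<sim> f" "\<not> x \<sim> g"
  shows "\<exists>p\<in>S. \<exists>q\<in>S. p \<sim> q \<and> (\<forall>k\<in>K. k \<sim> p \<and> k \<sim> q)"
proof (rule ccontr)
  assume "\<not> ?thesis"
  then have miss: "\<not> (\<forall>k\<in>K. k \<sim> p \<and> k \<sim> q)" if "p \<in> S" "q \<in> S" "p \<sim> q" for p q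
    using that by blast
  obtain p q r where K: "p \<in> K" "q \<in> K" "r \<in> K"
    and miss: "\<not> (p \<sim> a \<and> p \<sim> b)" "\<not> (q \<sim> b \<and> q \<sim> c)" "\<not> (r \<sim> c \<and> r \<sim> d)"
    using miss[OF _ _ edges(1)] miss[OF _ _ edges(2)] miss[OF _ _ edges(3)] edges(4) by auto
  have "q \<sim> c \<and> q \<sim> d"
    using arc7_triple[OF arcs[OF x(1)] arcs[OF K(1)] arcs[OF K(2)]
        meet[OF x(1) K(1)] meet[OF x(1) K(2)] meet[OF K(1,2)]] x miss
    unfolding meet7_def by satx
  moreover have "q \<sim> a \<and> q \<sim> b"
    using arc7_triple[OF arcs[OF x(1)] arcs[OF K(2)] arcs[OF K(3)]
        meet[OF x(1) K(2)] meet[OF x(1) K(3)] meet[OF K(2,3)]] x miss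
    unfolding meet7_def by satx
  ultimately show False using miss(2) by blast
qed

lemma C7_helly:
  assumes H: "C7 a b c d e f g"
    and arcs: "\<And>k. k \<in> K \<Longrightarrow> arc7 (k \<sim> a) (k \<sim> b) (k \<sim> c) (k \<sim> d) (k \<sim> e) (k \<sim> f) (k \<sim> g)"
    and meet: "\<And>k l. k \<in> K \<Longrightarrow> l \<in> K \<Longrightarrow> meet7 (k \<sim> a \<and> l \<sim> a) (k \<sim> b \<and> l \<sim> b) (k \<sim> c \<and> l \<sim> c) (k \<sim> d \<and> l \<sim> d) (k \<sim> e \<and>
        l \<sim> e) (k \<sim> f \<and> l \<sim> f) (k \<sim> g \<and> l \<sim> g)"
  shows "\<exists>p\<in>{a, b, c, d, e, f, g}. \<exists>q\<in>{a, b, c, d, e, f, g}. p \<sim> q \<and> (\<forall>k\<in>K. k \<sim> p \<and> k \<sim> q)"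
proof (cases "K = {}")
  case True
  then show ?thesis using H by (auto simp: C7_def)
next
  case False
  then obtain x where x: "x \<in> K" by blast
  let ?S = "{a, b, c, d, e, f, g}"

  \<comment> \<open>Rotated copies of the hypotheses, one for each place where the three positions
    missed by \<open>x\<close> can start.\<close>
  note A = arcs
    arcs[THEN arc7_rotate]
    arcs[THEN arc7_rotate, THEN arc7_rotate]
    arcs[THEN arc7_rotate, THEN arc7_rotate, THEN arc7_rotate]
    arcs[THEN arc7_rotate, THEN arc7_rotate, THEN arc7_rotate, THEN arc7_rotate]
    arcs[THEN arc7_rotate, THEN arc7_rotate, THEN arc7_rotate, THEN arc7_rotate, THEN arc7_rotate]
    arcs[THEN arc7_rotate, THEN arc7_rotate, THEN arc7_rotate, THEN arc7_rotate, THEN arc7_rotate, THEN arc7_rotate]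
  note M = meet
    meet[THEN meet7_rotate]
    meet[THEN meet7_rotate, THEN meet7_rotate]
    meet[THEN meet7_rotate, THEN meet7_rotate, THEN meet7_rotate]
    meet[THEN meet7_rotate, THEN meet7_rotate, THEN meet7_rotate, THEN meet7_rotate]
    meet[THEN meet7_rotate, THEN meet7_rotate, THEN meet7_rotate, THEN meet7_rotate, THEN meet7_rotate]
    meet[THEN meet7_rotate, THEN meet7_rotate, THEN meet7_rotate, THEN meet7_rotate, THEN meet7_rotate, THEN
        meet7_rotate]
  have E: "a \<sim> b" "b \<sim> c" "c \<sim> d" "d \<sim> e" "e \<sim> f" "f \<sim> g" "g \<sim> a"
    using H by (auto simp: C7_def)
  have L1: ?thesis if "\<not> x \<sim> e" "\<not> x \<sim> f" "\<not> x \<sim> g"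
    by (rule C7_helly_aux[OF E(1) E(2) E(3) _ A(1) M(1) x that]) auto
  have L2: ?thesis if "\<not> x \<sim> f" "\<not> x \<sim> g" "\<not> x \<sim> a"
    by (rule C7_helly_aux[OF E(2) E(3) E(4) _ A(2) M(2) x that]) auto
  have L3: ?thesis if "\<not> x \<sim> g" "\<not> x \<sim> a" "\<not> x \<sim> b"
    by (rule C7_helly_aux[OF E(3) E(4) E(5) _ A(3) M(3) x that]) auto
  have L4: ?thesis if "\<not> x \<sim> a" "\<not> x \<sim> b" "\<not> x \<sim> c"
    by (rule C7_helly_aux[OF E(4) E(5) E(6) _ A(4) M(4) x that]) auto
  have L5: ?thesis if "\<not> x \<sim> b" "\<not> x \<sim> c" "\<not> x \<sim> d"
    by (rule C7_helly_aux[OF E(5) E(6) E(7) _ A(5) M(5) x that]) auto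
  have L6: ?thesis if "\<not> x \<sim> c" "\<not> x \<sim> d" "\<not> x \<sim> e"
    by (rule C7_helly_aux[OF E(6) E(7) E(1) _ A(6) M(6) x that]) auto
  have L7: ?thesis if "\<not> x \<sim> d" "\<not> x \<sim> e" "\<not> x \<sim> f"
    by (rule C7_helly_aux[OF E(7) E(1) E(2) _ A(7) M(7) x that]) auto
  have "(\<not> x \<sim> e \<and> \<not> x \<sim> f \<and> \<not> x \<sim> g) \<or>
    (\<not> x \<sim> f \<and> \<not> x \<sim> g \<and> \<not> x \<sim> a) \<or>
    (\<not> x \<sim> g \<and> \<not> x \<sim> a \<and> \<not> x \<sim> b) \<or>
    (\<not> x \<sim> a \<and> \<not> x \<sim> b \<and> \<not> x \<sim> c) \<or>
    (\<not> x \<sim> b \<and> \<not> x \<sim> c \<and> \<not> x \<sim> d) \<or>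
    (\<not> x \<sim> c \<and> \<not> x \<sim> d \<and> \<not> x \<sim> e) \<or>
    (\<not> x \<sim> d \<and> \<not> x \<sim> e \<and> \<not> x \<sim> f)"
    using arcs[OF x] unfolding arc7_def by satx
  then show ?thesis using L1 L2 L3 L4 L5 L6 L7 by argo
qed

end

lemma arc11_rotate: "arc11 c0 c1 c2 c3 c4 c5 c6 c7 c8 c9 c10 \<Longrightarrow> arc11 c1 c2 c3 c4 c5 c6 c7 c8 c9 c10 c0"
  unfolding arc11_def by satx

lemma meet11_rotate: "meet11 c0 c1 c2 c3 c4 c5 c6 c7 c8 c9 c10 \<Longrightarrow> meet11 c1 c2 c3 c4 c5 c6 c7 c8 c9 c10 c0"
  unfolding meet11_def by satx

lemma arc7_meet7: "arc7 a b c d e f g \<Longrightarrow> meet7 a b c d e f g"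
  unfolding arc7_def meet7_def by satx

lemma arc11_meet11: "arc11 c0 c1 c2 c3 c4 c5 c6 c7 c8 c9 c10 \<Longrightarrow> meet11 c0 c1 c2 c3 c4 c5 c6 c7 c8 c9 c10"
  unfolding arc11_def meet11_def by satx

context p7_c4_c5_free
begin

text \<open>The square of the 11-cycle. The conjuncts are grouped by cyclic distance 1 to 5, of
  which 1 and 2 are edges.\<close>

definition C11 :: "'a \<Rightarrow> 'a \<Rightarrow> 'a \<Rightarrow> 'a \<Rightarrow> 'a \<Rightarrow> 'a \<Rightarrow> 'a \<Rightarrow> 'a \<Rightarrow> 'a \<Rightarrow> 'a \<Rightarrow> 'a \<Rightarrow> bool" where
  "C11 c0 c1 c2 c3 c4 c5 c6 c7 c8 c9 c10 \<longleftrightarrow>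
     c0 \<sim> c1 \<and> c1 \<sim> c2 \<and> c2 \<sim> c3 \<and> c3 \<sim> c4 \<and> c4 \<sim> c5 \<and> c5 \<sim> c6 \<and> c6 \<sim> c7 \<and> c7 \<sim> c8 \<and> c8 \<sim> c9 \<and> c9 \<sim> c10 \<and> c10 \<sim> c0 \<and>
     c0 \<sim> c2 \<and> c1 \<sim> c3 \<and> c2 \<sim> c4 \<and> c3 \<sim> c5 \<and> c4 \<sim> c6 \<and> c5 \<sim> c7 \<and> c6 \<sim> c8 \<and> c7 \<sim> c9 \<and> c8 \<sim> c10 \<and> c9 \<sim> c0 \<and> c10 \<sim> c1 \<and>
     \<not> c0 \<sim> c3 \<and> \<not> c1 \<sim> c4 \<and> \<not> c2 \<sim> c5 \<and> \<not> c3 \<sim> c6 \<and> \<not> c4 \<sim> c7 \<and> \<not> c5 \<sim> c8 \<and> \<not> c6 \<sim> c9 \<and> \<not> c7 \<sim> c10 \<and> \<not> c8 \<sim> c0 \<and>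
         \<not> c9 \<sim> c1 \<and> \<not> c10 \<sim> c2 \<and>
     \<not> c0 \<sim> c4 \<and> \<not> c1 \<sim> c5 \<and> \<not> c2 \<sim> c6 \<and> \<not> c3 \<sim> c7 \<and> \<not> c4 \<sim> c8 \<and> \<not> c5 \<sim> c9 \<and> \<not> c6 \<sim> c10 \<and> \<not> c7 \<sim> c0 \<and> \<not> c8 \<sim> c1 \<and>
         \<not> c9 \<sim> c2 \<and> \<not> c10 \<sim> c3 \<and>
     \<not> c0 \<sim> c5 \<and> \<not> c1 \<sim> c6 \<and> \<not> c2 \<sim> c7 \<and> \<not> c3 \<sim> c8 \<and> \<not> c4 \<sim> c9 \<and> \<not> c5 \<sim> c10 \<and> \<not> c6 \<sim> c0 \<and> \<not> c7 \<sim> c1 \<and> \<not> c8 \<sim> c2 \<and>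
         \<not> c9 \<sim> c3 \<and> \<not> c10 \<sim> c4"

lemma C11_rotate: "C11 c0 c1 c2 c3 c4 c5 c6 c7 c8 c9 c10 \<Longrightarrow> C11 c1 c2 c3 c4 c5 c6 c7 c8 c9 c10 c0"
  by (simp add: C11_def adj_commute)

text \<open>The gaps 2, 2, 1, 2, 1, 2, 1 add up to 11, and any two successive ones add up to at
  least 3, so only neighbours in this cyclic order are adjacent.\<close>

lemma C11_C7: "C11 c0 c1 c2 c3 c4 c5 c6 c7 c8 c9 c10 \<Longrightarrow> C7 c0 c2 c4 c5 c7 c8 c10"
  by (simp add: C11_def C7_def adj_commute)

lemma C11_nbr: "C11 c0 c1 c2 c3 c4 c5 c6 c7 c8 c9 c10 \<Longrightarrow> x \<sim> c0 \<and> x \<sim> c6 \<longrightarrow> x \<sim> c2 \<or> x \<sim> c4"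
  using no_C5[of x c0 c2 c4 c6] by (auto simp: C11_def adj_commute)

text \<open>Members of a stable set are at cyclic distance at least 3, so it has at most three
  vertices and eleven vertices require four classes.\<close>

lemma C11_colourable:
  assumes "C11 c0 c1 c2 c3 c4 c5 c6 c7 c8 c9 c10"
  shows "colourable {c0, c1, c2, c3, c4, c5, c6, c7, c8, c9, c10} 4"
proof -
  have "colourable {c0, c3, c7} (Suc 0)" "colourable {c1, c4, c8} (Suc 0)"
    "colourable {c2, c5, c9} (Suc 0)" "colourable {c6, c10} (Suc 0)"
    using assms by (auto intro!: colourable_stable simp: C11_def adj_commute adj_irrefl)
  then have "colourable ({c0, c3, c7} \<union> {c1, c4, c8} \<union> {c2, c5, c9} \<union> {c6, c10}) (Suc 0 + Suc 0 + Suc 0 + Suc 0)"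
    by (intro colourable_Un)
  then show ?thesis by (rule colourable_mono) auto
qed

text \<open>The argument of \<open>C7_helly_aux\<close>, with the three triangles of consecutive
  vertices among \<open>c0\<close> to \<open>c4\<close> in place of the three edges.\<close>

lemma C11_helly_aux:
  assumes edges: "c0 \<sim> c1" "c1 \<sim> c2" "c2 \<sim> c3" "c3 \<sim> c4" "c0 \<sim> c2" "c1 \<sim> c3" "c2 \<sim> c4" "{c0, c1, c2, c3, c4} \<subseteq> S"
    and arcs: "\<And>k. k \<in> K \<Longrightarrow> arc11 (k \<sim> c0) (k \<sim> c1) (k \<sim> c2) (k \<sim> c3) (k \<sim> c4) (k \<sim> c5) (k \<sim> c6) (k \<sim> c7) (k \<sim> c8)
        (k \<sim> c9) (k \<sim> c10)"
    and meet: "\<And>k l. k \<in> K \<Longrightarrow> l \<in> K \<Longrightarrow> meet11 (k \<sim> c0 \<and> l \<sim> c0) (k \<sim> c1 \<and> l \<sim> c1) (k \<sim> c2 \<and> l \<sim> c2) (k \<sim> c3 \<and> l \<sim> c3)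
        (k \<sim> c4 \<and> l \<sim> c4) (k \<sim> c5 \<and> l \<sim> c5) (k \<sim> c6 \<and> l \<sim> c6) (k \<sim> c7 \<and> l \<sim> c7) (k \<sim> c8 \<and> l \<sim> c8) (k \<sim> c9 \<and> l \<sim> c9)
        (k \<sim> c10 \<and> l \<sim> c10)"
    and x: "x \<in> K" "\<not> x \<sim> c5" "\<not> x \<sim> c6" "\<not> x \<sim> c7" "\<not> x \<sim> c8" "\<not> x \<sim> c9" "\<not> x \<sim> c10"
  shows "\<exists>p\<in>S. \<exists>q\<in>S. \<exists>r\<in>S. p \<sim> q \<and> q \<sim> r \<and> p \<sim> r \<and> (\<forall>k\<in>K. k \<sim> p \<and> k \<sim> q \<and> k \<sim> r)"
proof (rule ccontr)
  assume "\<not> ?thesis"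
  then have miss: "\<not> (\<forall>k\<in>K. k \<sim> p \<and> k \<sim> q \<and> k \<sim> r)"
    if "p \<in> S" "q \<in> S" "r \<in> S" "p \<sim> q" "q \<sim> r" "p \<sim> r" for p q r
    using that by blast
  obtain p q r where K: "p \<in> K" "q \<in> K" "r \<in> K"
    and miss: "\<not> (p \<sim> c0 \<and> p \<sim> c1 \<and> p \<sim> c2)" "\<not> (q \<sim> c1 \<and> q \<sim> c2 \<and> q \<sim> c3)"
      "\<not> (r \<sim> c2 \<and> r \<sim> c3 \<and> r \<sim> c4)"
    using miss[OF _ _ _ edges(1,2,5)] miss[OF _ _ _ edges(2,3,6)] miss[OF _ _ _ edges(3,4,7)] edges(8) by auto
  have "q \<sim> c2 \<and> q \<sim> c3 \<and> q \<sim> c4"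
    using arc11_triple[OF arcs[OF x(1)] arcs[OF K(1)] arcs[OF K(2)]
        meet[OF x(1) K(1)] meet[OF x(1) K(2)] meet[OF K(1,2)]] x miss
    unfolding meet11_def by satx
  moreover have "q \<sim> c0 \<and> q \<sim> c1 \<and> q \<sim> c2"
    using arc11_triple[OF arcs[OF x(1)] arcs[OF K(2)] arcs[OF K(3)]
        meet[OF x(1) K(2)] meet[OF x(1) K(3)] meet[OF K(2,3)]] x miss
    unfolding meet11_def by satx
  ultimately show False using miss(2) by blast
qed

lemma C11_helly:
  assumes H: "C11 c0 c1 c2 c3 c4 c5 c6 c7 c8 c9 c10"
    and arcs: "\<And>k. k \<in> K \<Longrightarrow> arc11 (k \<sim> c0) (k \<sim> c1) (k \<sim> c2) (k \<sim> c3) (k \<sim> c4) (k \<sim> c5) (k \<sim> c6) (k \<sim> c7) (k \<sim> c8)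
        (k \<sim> c9) (k \<sim> c10)"
    and meet: "\<And>k l. k \<in> K \<Longrightarrow> l \<in> K \<Longrightarrow> meet11 (k \<sim> c0 \<and> l \<sim> c0) (k \<sim> c1 \<and> l \<sim> c1) (k \<sim> c2 \<and> l \<sim> c2) (k \<sim> c3 \<and> l \<sim> c3)
        (k \<sim> c4 \<and> l \<sim> c4) (k \<sim> c5 \<and> l \<sim> c5) (k \<sim> c6 \<and> l \<sim> c6) (k \<sim> c7 \<and> l \<sim> c7) (k \<sim> c8 \<and> l \<sim> c8) (k \<sim> c9 \<and> l \<sim> c9)
        (k \<sim> c10 \<and> l \<sim> c10)"
  shows "\<exists>p\<in>{c0, c1, c2, c3, c4, c5, c6, c7, c8, c9, c10}. \<exists>q\<in>{c0, c1, c2, c3, c4, c5, c6, c7, c8, c9, c10}. \<exists>r\<in>{c0,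
      c1, c2, c3, c4, c5, c6, c7, c8, c9, c10}.
    p \<sim> q \<and> q \<sim> r \<and> p \<sim> r \<and> (\<forall>k\<in>K. k \<sim> p \<and> k \<sim> q \<and> k \<sim> r)"
proof (cases "K = {}")
  case True
  then show ?thesis using H by (auto simp: C11_def)
next
  case False
  then obtain x where x: "x \<in> K" by blast
  note A = arcs
    arcs[THEN arc11_rotate]
    arcs[THEN arc11_rotate, THEN arc11_rotate]
    arcs[THEN arc11_rotate, THEN arc11_rotate, THEN arc11_rotate]
    arcs[THEN arc11_rotate, THEN arc11_rotate, THEN arc11_rotate, THEN arc11_rotate]
    arcs[THEN arc11_rotate, THEN arc11_rotate, THEN arc11_rotate, THEN arc11_rotate, THEN arc11_rotate]
    arcs[THEN arc11_rotate, THEN arc11_rotate, THEN arc11_rotate, THEN arc11_rotate, THEN arc11_rotate, THEN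
        arc11_rotate]
    arcs[THEN arc11_rotate, THEN arc11_rotate, THEN arc11_rotate, THEN arc11_rotate, THEN arc11_rotate, THEN
        arc11_rotate, THEN arc11_rotate]
    arcs[THEN arc11_rotate, THEN arc11_rotate, THEN arc11_rotate, THEN arc11_rotate, THEN arc11_rotate, THEN
        arc11_rotate, THEN arc11_rotate, THEN arc11_rotate]
    arcs[THEN arc11_rotate, THEN arc11_rotate, THEN arc11_rotate, THEN arc11_rotate, THEN arc11_rotate, THEN
        arc11_rotate, THEN arc11_rotate, THEN arc11_rotate, THEN arc11_rotate]
    arcs[THEN arc11_rotate, THEN arc11_rotate, THEN arc11_rotate, THEN arc11_rotate, THEN arc11_rotate, THEN
        arc11_rotate, THEN arc11_rotate, THEN arc11_rotate, THEN arc11_rotate, THEN arc11_rotate]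
  note M = meet
    meet[THEN meet11_rotate]
    meet[THEN meet11_rotate, THEN meet11_rotate]
    meet[THEN meet11_rotate, THEN meet11_rotate, THEN meet11_rotate]
    meet[THEN meet11_rotate, THEN meet11_rotate, THEN meet11_rotate, THEN meet11_rotate]
    meet[THEN meet11_rotate, THEN meet11_rotate, THEN meet11_rotate, THEN meet11_rotate, THEN meet11_rotate]
    meet[THEN meet11_rotate, THEN meet11_rotate, THEN meet11_rotate, THEN meet11_rotate, THEN meet11_rotate, THEN
        meet11_rotate]
    meet[THEN meet11_rotate, THEN meet11_rotate, THEN meet11_rotate, THEN meet11_rotate, THEN meet11_rotate, THEN
        meet11_rotate, THEN meet11_rotate]
    meet[THEN meet11_rotate, THEN meet11_rotate, THEN meet11_rotate, THEN meet11_rotate, THEN meet11_rotate, THEN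
        meet11_rotate, THEN meet11_rotate, THEN meet11_rotate]
    meet[THEN meet11_rotate, THEN meet11_rotate, THEN meet11_rotate, THEN meet11_rotate, THEN meet11_rotate, THEN
        meet11_rotate, THEN meet11_rotate, THEN meet11_rotate, THEN meet11_rotate]
    meet[THEN meet11_rotate, THEN meet11_rotate, THEN meet11_rotate, THEN meet11_rotate, THEN meet11_rotate, THEN
        meet11_rotate, THEN meet11_rotate, THEN meet11_rotate, THEN meet11_rotate, THEN meet11_rotate]
  have E: "c0 \<sim> c1" "c1 \<sim> c2" "c2 \<sim> c3" "c3 \<sim> c4" "c4 \<sim> c5" "c5 \<sim> c6" "c6 \<sim> c7" "c7 \<sim> c8" "c8 \<sim> c9" "c9 \<sim> c10"
      "c10 \<sim> c0"
    and F: "c0 \<sim> c2" "c1 \<sim> c3" "c2 \<sim> c4" "c3 \<sim> c5" "c4 \<sim> c6" "c5 \<sim> c7" "c6 \<sim> c8" "c7 \<sim> c9" "c8 \<sim> c10" "c9 \<sim> c0"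
        "c10 \<sim> c1"
    using H by (auto simp: C11_def adj_commute)
  have L0: ?thesis if "\<not> x \<sim> c5" "\<not> x \<sim> c6" "\<not> x \<sim> c7" "\<not> x \<sim> c8" "\<not> x \<sim> c9" "\<not> x \<sim> c10"
    by (rule C11_helly_aux[OF E(1) E(2) E(3) E(4) F(1) F(2) F(3) _ A(1) M(1) x that]) auto
  have L1: ?thesis if "\<not> x \<sim> c6" "\<not> x \<sim> c7" "\<not> x \<sim> c8" "\<not> x \<sim> c9" "\<not> x \<sim> c10" "\<not> x \<sim> c0"
    by (rule C11_helly_aux[OF E(2) E(3) E(4) E(5) F(2) F(3) F(4) _ A(2) M(2) x that]) auto
  have L2: ?thesis if "\<not> x \<sim> c7" "\<not> x \<sim> c8" "\<not> x \<sim> c9" "\<not> x \<sim> c10" "\<not> x \<sim> c0" "\<not> x \<sim> c1"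
    by (rule C11_helly_aux[OF E(3) E(4) E(5) E(6) F(3) F(4) F(5) _ A(3) M(3) x that]) auto
  have L3: ?thesis if "\<not> x \<sim> c8" "\<not> x \<sim> c9" "\<not> x \<sim> c10" "\<not> x \<sim> c0" "\<not> x \<sim> c1" "\<not> x \<sim> c2"
    by (rule C11_helly_aux[OF E(4) E(5) E(6) E(7) F(4) F(5) F(6) _ A(4) M(4) x that]) auto
  have L4: ?thesis if "\<not> x \<sim> c9" "\<not> x \<sim> c10" "\<not> x \<sim> c0" "\<not> x \<sim> c1" "\<not> x \<sim> c2" "\<not> x \<sim> c3"
    by (rule C11_helly_aux[OF E(5) E(6) E(7) E(8) F(5) F(6) F(7) _ A(5) M(5) x that]) auto
  have L5: ?thesis if "\<not> x \<sim> c10" "\<not> x \<sim> c0" "\<not> x \<sim> c1" "\<not> x \<sim> c2" "\<not> x \<sim> c3" "\<not> x \<sim> c4"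
    by (rule C11_helly_aux[OF E(6) E(7) E(8) E(9) F(6) F(7) F(8) _ A(6) M(6) x that]) auto
  have L6: ?thesis if "\<not> x \<sim> c0" "\<not> x \<sim> c1" "\<not> x \<sim> c2" "\<not> x \<sim> c3" "\<not> x \<sim> c4" "\<not> x \<sim> c5"
    by (rule C11_helly_aux[OF E(7) E(8) E(9) E(10) F(7) F(8) F(9) _ A(7) M(7) x that]) auto
  have L7: ?thesis if "\<not> x \<sim> c1" "\<not> x \<sim> c2" "\<not> x \<sim> c3" "\<not> x \<sim> c4" "\<not> x \<sim> c5" "\<not> x \<sim> c6"
    by (rule C11_helly_aux[OF E(8) E(9) E(10) E(11) F(8) F(9) F(10) _ A(8) M(8) x that]) auto
  have L8: ?thesis if "\<not> x \<sim> c2" "\<not> x \<sim> c3" "\<not> x \<sim> c4" "\<not> x \<sim> c5" "\<not> x \<sim> c6" "\<not> x \<sim> c7"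
    by (rule C11_helly_aux[OF E(9) E(10) E(11) E(1) F(9) F(10) F(11) _ A(9) M(9) x that]) auto
  have L9: ?thesis if "\<not> x \<sim> c3" "\<not> x \<sim> c4" "\<not> x \<sim> c5" "\<not> x \<sim> c6" "\<not> x \<sim> c7" "\<not> x \<sim> c8"
    by (rule C11_helly_aux[OF E(10) E(11) E(1) E(2) F(10) F(11) F(1) _ A(10) M(10) x that]) auto
  have L10: ?thesis if "\<not> x \<sim> c4" "\<not> x \<sim> c5" "\<not> x \<sim> c6" "\<not> x \<sim> c7" "\<not> x \<sim> c8" "\<not> x \<sim> c9"
    by (rule C11_helly_aux[OF E(11) E(1) E(2) E(3) F(11) F(1) F(2) _ A(11) M(11) x that]) auto
  show ?thesis using arcs[OF x] L0 L1 L2 L3 L4 L5 L6 L7 L8 L9 L10 unfolding arc11_def by argo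
qed

end

context reduced_graph
begin

lemma C11_arc:
  assumes H: "C11 c0 c1 c2 c3 c4 c5 c6 c7 c8 c9 c10" and HV: "{c0, c1, c2, c3, c4, c5, c6, c7, c8, c9, c10} \<subseteq> V"
    and x: "x \<in> V" "x \<notin> {c0, c1, c2, c3, c4, c5, c6, c7, c8, c9, c10}"
  shows "arc11 (x \<sim> c0) (x \<sim> c1) (x \<sim> c2) (x \<sim> c3) (x \<sim> c4) (x \<sim> c5) (x \<sim> c6) (x \<sim> c7) (x \<sim> c8) (x \<sim> c9) (x \<sim> c10)"
proof -
  note R = H
    H[THEN C11_rotate]
    H[THEN C11_rotate, THEN C11_rotate]
    H[THEN C11_rotate, THEN C11_rotate, THEN C11_rotate]
    H[THEN C11_rotate, THEN C11_rotate, THEN C11_rotate, THEN C11_rotate]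
    H[THEN C11_rotate, THEN C11_rotate, THEN C11_rotate, THEN C11_rotate, THEN C11_rotate]
    H[THEN C11_rotate, THEN C11_rotate, THEN C11_rotate, THEN C11_rotate, THEN C11_rotate, THEN C11_rotate]
    H[THEN C11_rotate, THEN C11_rotate, THEN C11_rotate, THEN C11_rotate, THEN C11_rotate, THEN C11_rotate, THEN
        C11_rotate]
    H[THEN C11_rotate, THEN C11_rotate, THEN C11_rotate, THEN C11_rotate, THEN C11_rotate, THEN C11_rotate, THEN
        C11_rotate, THEN C11_rotate]
    H[THEN C11_rotate, THEN C11_rotate, THEN C11_rotate, THEN C11_rotate, THEN C11_rotate, THEN C11_rotate, THEN
        C11_rotate, THEN C11_rotate, THEN C11_rotate]
    H[THEN C11_rotate, THEN C11_rotate, THEN C11_rotate, THEN C11_rotate, THEN C11_rotate, THEN C11_rotate, THEN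
        C11_rotate, THEN C11_rotate, THEN C11_rotate, THEN C11_rotate]
  have A0: "arc7 (x \<sim> c0) (x \<sim> c2) (x \<sim> c4) (x \<sim> c5) (x \<sim> c7) (x \<sim> c8) (x \<sim> c10)"
    by (rule C7_arc[OF C11_C7[OF R(1)] _ x(1)]) (use HV x(2) in auto)
  have A1: "arc7 (x \<sim> c1) (x \<sim> c3) (x \<sim> c5) (x \<sim> c6) (x \<sim> c8) (x \<sim> c9) (x \<sim> c0)"
    by (rule C7_arc[OF C11_C7[OF R(2)] _ x(1)]) (use HV x(2) in auto)
  have A2: "arc7 (x \<sim> c2) (x \<sim> c4) (x \<sim> c6) (x \<sim> c7) (x \<sim> c9) (x \<sim> c10) (x \<sim> c1)"
    by (rule C7_arc[OF C11_C7[OF R(3)] _ x(1)]) (use HV x(2) in auto)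
  have A3: "arc7 (x \<sim> c3) (x \<sim> c5) (x \<sim> c7) (x \<sim> c8) (x \<sim> c10) (x \<sim> c0) (x \<sim> c2)"
    by (rule C7_arc[OF C11_C7[OF R(4)] _ x(1)]) (use HV x(2) in auto)
  have A4: "arc7 (x \<sim> c4) (x \<sim> c6) (x \<sim> c8) (x \<sim> c9) (x \<sim> c0) (x \<sim> c1) (x \<sim> c3)"
    by (rule C7_arc[OF C11_C7[OF R(5)] _ x(1)]) (use HV x(2) in auto)
  have A5: "arc7 (x \<sim> c5) (x \<sim> c7) (x \<sim> c9) (x \<sim> c10) (x \<sim> c1) (x \<sim> c2) (x \<sim> c4)"
    by (rule C7_arc[OF C11_C7[OF R(6)] _ x(1)]) (use HV x(2) in auto)
  have A6: "arc7 (x \<sim> c6) (x \<sim> c8) (x \<sim> c10) (x \<sim> c0) (x \<sim> c2) (x \<sim> c3) (x \<sim> c5)"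
    by (rule C7_arc[OF C11_C7[OF R(7)] _ x(1)]) (use HV x(2) in auto)
  have A7: "arc7 (x \<sim> c7) (x \<sim> c9) (x \<sim> c0) (x \<sim> c1) (x \<sim> c3) (x \<sim> c4) (x \<sim> c6)"
    by (rule C7_arc[OF C11_C7[OF R(8)] _ x(1)]) (use HV x(2) in auto)
  have A8: "arc7 (x \<sim> c8) (x \<sim> c10) (x \<sim> c1) (x \<sim> c2) (x \<sim> c4) (x \<sim> c5) (x \<sim> c7)"
    by (rule C7_arc[OF C11_C7[OF R(9)] _ x(1)]) (use HV x(2) in auto)
  have A9: "arc7 (x \<sim> c9) (x \<sim> c0) (x \<sim> c2) (x \<sim> c3) (x \<sim> c5) (x \<sim> c6) (x \<sim> c8)"
    by (rule C7_arc[OF C11_C7[OF R(10)] _ x(1)]) (use HV x(2) in auto)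
  have A10: "arc7 (x \<sim> c10) (x \<sim> c1) (x \<sim> c3) (x \<sim> c4) (x \<sim> c6) (x \<sim> c7) (x \<sim> c9)"
    by (rule C7_arc[OF C11_C7[OF R(11)] _ x(1)]) (use HV x(2) in auto)
  show ?thesis
    by (rule arc11_from_arc7[OF A0 A1 A2 A3 A4 A5 A6 A7 A8 A9 A10
      C11_nbr[OF R(1)]
      C11_nbr[OF R(2)]
      C11_nbr[OF R(3)]
      C11_nbr[OF R(4)]
      C11_nbr[OF R(5)]
      C11_nbr[OF R(6)]
      C11_nbr[OF R(7)]
      C11_nbr[OF R(8)]
      C11_nbr[OF R(9)]
      C11_nbr[OF R(10)]
      C11_nbr[OF R(11)]])
qed

lemma C11_pair:
  assumes H: "C11 c0 c1 c2 c3 c4 c5 c6 c7 c8 c9 c10" and HV: "{c0, c1, c2, c3, c4, c5, c6, c7, c8, c9, c10} \<subseteq> V"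
    and x: "x \<in> V" "x \<notin> {c0, c1, c2, c3, c4, c5, c6, c7, c8, c9, c10}" and y: "y \<in> V" "y \<notin> {c0, c1, c2, c3, c4, c5,
        c6, c7, c8, c9, c10}" and xy: "x \<sim> y"
  shows "meet11 (x \<sim> c0 \<and> y \<sim> c0) (x \<sim> c1 \<and> y \<sim> c1) (x \<sim> c2 \<and> y \<sim> c2) (x \<sim> c3 \<and> y \<sim> c3) (x \<sim> c4 \<and> y \<sim> c4) (x \<sim> c5 \<and>
      y \<sim> c5) (x \<sim> c6 \<and> y \<sim> c6) (x \<sim> c7 \<and> y \<sim> c7) (x \<sim> c8 \<and> y \<sim> c8) (x \<sim> c9 \<and> y \<sim> c9) (x \<sim> c10 \<and> y \<sim> c10)"
proof -
  have 4: "\<not> (u \<sim> p \<and> \<not> v \<sim> p \<and> v \<sim> q \<and> \<not> u \<sim> q)"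
    if "p \<sim> q" "u \<sim> v" "u \<notin> {c0, c1, c2, c3, c4, c5, c6, c7, c8, c9, c10}" "v \<notin> {c0, c1, c2, c3, c4, c5, c6, c7, c8,
        c9, c10}" "p \<in> {c0, c1, c2, c3, c4, c5, c6, c7, c8, c9, c10}" "q \<in> {c0, c1, c2, c3, c4, c5, c6, c7, c8, c9,
        c10}" for p q u v
    using C4_D[of p q u v] that by blast
  have 5: "\<not> (u \<sim> p \<and> \<not> v \<sim> p \<and> \<not> u \<sim> q \<and> \<not> v \<sim> q \<and> v \<sim> r \<and> \<not> u \<sim> r)"
    if "p \<sim> q" "q \<sim> r" "\<not> p \<sim> r" "u \<sim> v" for p q r u v
    using C5_D[of p q r u v] that by blast
  note yx = adj_sym[OF xy]
  have E: "c0 \<sim> c1" "c1 \<sim> c2" "c2 \<sim> c3" "c3 \<sim> c4" "c4 \<sim> c5" "c5 \<sim> c6" "c6 \<sim> c7" "c7 \<sim> c8" "c8 \<sim> c9" "c9 \<sim> c10"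
      "c10 \<sim> c0"
    and F: "c0 \<sim> c2" "c1 \<sim> c3" "c2 \<sim> c4" "c3 \<sim> c5" "c4 \<sim> c6" "c5 \<sim> c7" "c6 \<sim> c8" "c7 \<sim> c9" "c8 \<sim> c10" "c9 \<sim> c0"
        "c10 \<sim> c1"
    and G: "\<not> c0 \<sim> c4" "\<not> c1 \<sim> c5" "\<not> c2 \<sim> c6" "\<not> c3 \<sim> c7" "\<not> c4 \<sim> c8" "\<not> c5 \<sim> c9" "\<not> c6 \<sim> c10" "\<not> c7 \<sim> c0"
        "\<not> c8 \<sim> c1" "\<not> c9 \<sim> c2" "\<not> c10 \<sim> c3"
    using H by (auto simp: C11_def adj_commute)
  show ?thesis
    by (rule arc11_pair[OF C11_arc[OF H HV x] C11_arc[OF H HV y]];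
        (rule 5[OF F(1) F(3) G(1) xy] 5[OF F(1) F(3) G(1) yx] 5[OF F(2) F(4) G(2) xy] 5[OF F(2) F(4) G(2) yx] 5[OF
            F(3) F(5) G(3) xy] 5[OF F(3) F(5) G(3) yx] 5[OF F(4) F(6) G(4) xy] 5[OF F(4) F(6) G(4) yx] 5[OF F(5) F(7)
            G(5) xy] 5[OF F(5) F(7) G(5) yx] 5[OF F(6) F(8) G(6) xy] 5[OF F(6) F(8) G(6) yx] 5[OF F(7) F(9) G(7) xy]
            5[OF F(7) F(9) G(7) yx] 5[OF F(8) F(10) G(8) xy] 5[OF F(8) F(10) G(8) yx] 5[OF F(9) F(11) G(9) xy] 5[OF
            F(9) F(11) G(9) yx] 5[OF F(10) F(1) G(10) xy] 5[OF F(10) F(1) G(10) yx] 5[OF F(11) F(2) G(11) xy] 5[OF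
            F(11) F(2) G(11) yx] |
        (rule E[THEN 4, OF xy] F[THEN 4, OF xy] E[THEN 4, OF yx] F[THEN 4, OF yx], (use x(2) y(2) in simp)+)))
qed

subsection \<open>Removing a 7-cycle\<close>

definition max_C7 :: "'a \<Rightarrow> 'a \<Rightarrow> 'a \<Rightarrow> 'a \<Rightarrow> 'a \<Rightarrow> 'a \<Rightarrow> 'a \<Rightarrow> bool" where
  "max_C7 a b c d e f g \<longleftrightarrow> C7 a b c d e f g \<and> {a, b, c, d, e, f, g} \<subseteq> V \<and>
     (\<forall>a' b' c' d' e' f' g'. C7 a' b' c' d' e' f' g' \<and> {a', b', c', d', e', f', g'} \<subseteq> V \<longrightarrow>
       deg a' + deg b' + deg c' + deg d' + deg e' + deg f' + deg g' \<le>
       deg a + deg b + deg c + deg d + deg e + deg f + deg g)"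

lemma max_C7_rotate: "max_C7 a b c d e f g \<Longrightarrow> max_C7 b c d e f g a"
  unfolding max_C7_def using C7_rotate[of a b c d e f g] by (simp add: add_ac insert_commute)

lemma obtain_max_C7:
  assumes "C7 a b c d e f g" "{a, b, c, d, e, f, g} \<subseteq> V"
  shows "\<exists>a b c d e f g. max_C7 a b c d e f g"
proof -
  let ?P = "\<lambda>(a, b, c, d, e, f, g). C7 a b c d e f g \<and> {a, b, c, d, e, f, g} \<subseteq> V"
  let ?f = "\<lambda>(a, b, c, d, e, f, g). deg a + deg b + deg c + deg d + deg e + deg f + deg g"
  have bound: "deg x \<le> card V" for x
    unfolding deg_def using finite_V by (intro card_mono) auto
  have "?P (a, b, c, d, e, f, g)" using assms by simp
  moreover have "?f t < 7 * card V + 1" for t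
  proof -
    obtain p q r s u v w where "t = (p, q, r, s, u, v, w)" by (rule prod_cases7)
    then show ?thesis using bound[of p] bound[of q] bound[of r] bound[of s] bound[of u] bound[of v] bound[of w] by
        simp
  qed
  ultimately have "\<exists>t. ?P t \<and> (\<forall>s. ?P s \<longrightarrow> ?f s \<le> ?f t)"
    by (intro ex_has_greatest_nat[of ?P "(a, b, c, d, e, f, g)" ?f "7 * card V + 1"]) simp_all
  then obtain t where "?P t" "\<forall>s. ?P s \<longrightarrow> ?f s \<le> ?f t" by (elim exE conjE)
  obtain p q r s u v w where "t = (p, q, r, s, u, v, w)" by (rule prod_cases7)
  then have "max_C7 p q r s u v w"
    using \<open>?P t\<close> \<open>\<forall>s. ?P s \<longrightarrow> ?f s \<le> ?f t\<close> unfolding max_C7_def by simp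
  then show ?thesis by blast
qed

text \<open>An existential over eleven vertices, cast as an inductive predicate so that one rule
  introduces it and one rule takes it apart.\<close>

inductive has_C11 :: bool where
  has_C11I: "\<lbrakk>C11 c0 c1 c2 c3 c4 c5 c6 c7 c8 c9 c10; {c0, c1, c2, c3, c4, c5, c6, c7, c8, c9, c10} \<subseteq> V\<rbrakk> \<Longrightarrow> has_C11"

text \<open>Replacing \<open>a\<close> by \<open>x\<close>, or \<open>c\<close> by \<open>y\<close>, yields another 7-cycle. By maximality of the degree sum, \<open>a\<close> and \<open>c\<close>
  have private neighbours \<open>u\<close> and \<open>v\<close>, which complete the square of an 11-cycle.\<close>

lemma max_C7_no_far_pair:
  assumes M: "max_C7 a b c d e f g"
    and no_C11: "\<not> has_C11"
    and x: "x \<in> V" "x \<notin> {a, b, c, d, e, f, g}" and y: "y \<in> V" "y \<notin> {a, b, c, d, e, f, g}" and xy: "x \<sim> y"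
  shows "\<not> (arc3 (x \<sim> g) (x \<sim> a) (x \<sim> b) (x \<sim> c) (x \<sim> d) (x \<sim> e) (x \<sim> f) \<and>
     arc3 (y \<sim> b) (y \<sim> c) (y \<sim> d) (y \<sim> e) (y \<sim> f) (y \<sim> g) (y \<sim> a))"
proof
  assume far: "arc3 (x \<sim> g) (x \<sim> a) (x \<sim> b) (x \<sim> c) (x \<sim> d) (x \<sim> e) (x \<sim> f) \<and>
     arc3 (y \<sim> b) (y \<sim> c) (y \<sim> d) (y \<sim> e) (y \<sim> f) (y \<sim> g) (y \<sim> a)"
  have H: "C7 a b c d e f g" and HV: "{a, b, c, d, e, f, g} \<subseteq> V"
    using M by (simp_all add: max_C7_def)
  note max = M[unfolded max_C7_def, THEN conjunct2, THEN conjunct2, rule_format, OF conjI]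
  have xa: "x \<sim> g" "x \<sim> a" "x \<sim> b" "\<not> x \<sim> c" "\<not> x \<sim> d" "\<not> x \<sim> e" "\<not> x \<sim> f" using far by (auto simp: arc3_def)
  have ya: "y \<sim> b" "y \<sim> c" "y \<sim> d" "\<not> y \<sim> e" "\<not> y \<sim> f" "\<not> y \<sim> g" "\<not> y \<sim> a" using far by (auto simp: arc3_def)
  have "C7 x b c d e f g" using H xa adj_commute unfolding C7_def by blast
  then have degx: "deg x \<le> deg a" using max[of x b c d e f g] HV x(1) by simp
  have "C7 a b y d e f g" using H ya adj_commute unfolding C7_def by blast
  then have degy: "deg y \<le> deg c" using max[of a b y d e f g] HV y(1) by simp
  obtain u where u: "u \<in> V" "u \<sim> e" "u \<sim> f" "u \<sim> g" "u \<sim> a" "\<not> u \<sim> b" "\<not> u \<sim> c" "\<not> u \<sim> d" "\<not> u \<sim> x" "\<not> u \<sim> y"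
    using C7_far_pair[OF H HV x(1) _ x(2) y(1) _ y(2) xy degx] far by blast
  \<comment> \<open>The reflection that fixes \<open>b\<close> exchanges the roles of
    \<open>x\<close> and \<open>y\<close>, so the same lemma also supplies \<open>v\<close>.\<close>
  have H': "C7 c b a g f e d"
    using C7_rotations(5)[OF C7_reflect[OF H]] .
  have "\<exists>u\<in>V. u \<sim> f \<and> u \<sim> e \<and> u \<sim> d \<and> u \<sim> c \<and> \<not> u \<sim> b \<and> \<not> u \<sim> a \<and> \<not> u \<sim> g \<and> \<not> u \<sim> y \<and> \<not> u \<sim> x"
    by (rule C7_far_pair[OF H' _ y(1) _ _ x(1) _ _ adj_sym[OF xy] degy])
      (use HV x(2) y(2) xa ya in \<open>auto simp: arc3_def\<close>)
  then obtain v where v: "v \<in> V" "v \<sim> f" "v \<sim> e" "v \<sim> d" "v \<sim> c" "\<not> v \<sim> b" "\<not> v \<sim> a" "\<not> v \<sim> g" "\<not> v \<sim> y" "\<not> v \<sim> x"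
    by blast
  have uv: "\<not> u \<sim> v"
    using C5_D[of a b c u v] u v H by (auto simp: C7_def)
  \<comment> \<open>Each of \<open>x\<close>, \<open>y\<close>, \<open>u\<close>, \<open>v\<close>
    is inserted in the middle of the four vertices it sees: \<open>x\<close> between
    \<open>a\<close> and \<open>b\<close>, \<open>y\<close> between \<open>b\<close> and
    \<open>c\<close>, \<open>v\<close> between \<open>d\<close> and \<open>e\<close>,
    \<open>u\<close> between \<open>f\<close> and \<open>g\<close>.\<close>
  have "C11 a x b y c d v e f u g"
    using H xa ya u(2-) v(2-) uv xy by (simp add: C11_def C7_def adj_commute)
  moreover have "{a, x, b, y, c, d, v, e, f, u, g} \<subseteq> V" using HV x(1) y(1) u(1) v(1) by simp
  ultimately have has_C11 by (rule has_C11I)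
  then show False using no_C11 by contradiction
qed

text \<open>The far pattern occurs in seven rotations with \<open>x\<close> and \<open>y\<close> in
  either role, which accounts for the last fourteen assumptions of \<open>arc7_pair\<close>. The
  others are 4-cycles and 5-cycles through the edge between \<open>x\<close> and
  \<open>y\<close>.\<close>

lemma max_C7_pair:
  assumes M: "max_C7 a b c d e f g"
    and no_C11: "\<not> has_C11"
    and x: "x \<in> V" "x \<notin> {a, b, c, d, e, f, g}" and y: "y \<in> V" "y \<notin> {a, b, c, d, e, f, g}" and xy: "x \<sim> y"
  shows "meet7 (x \<sim> a \<and> y \<sim> a) (x \<sim> b \<and> y \<sim> b) (x \<sim> c \<and> y \<sim> c) (x \<sim> d \<and> y \<sim> d) (x \<sim> e \<and> y \<sim> e) (x \<sim> f \<and> y \<sim> f) (x \<sim> g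
      \<and> y \<sim> g)"
proof -
  have H: "C7 a b c d e f g" and HV: "{a, b, c, d, e, f, g} \<subseteq> V"
    using M by (simp_all add: max_C7_def)
  have 4: "\<not> (u \<sim> p \<and> \<not> v \<sim> p \<and> v \<sim> q \<and> \<not> u \<sim> q)"
    if "p \<sim> q" "u \<sim> v" "u \<noteq> q" "v \<noteq> p" for p q u v
    using C4_D[of p q u v] that by blast
  have 5: "\<not> (u \<sim> p \<and> \<not> v \<sim> p \<and> \<not> u \<sim> q \<and> \<not> v \<sim> q \<and> v \<sim> r \<and> \<not> u \<sim> r)"
    if "p \<sim> q" "q \<sim> r" "\<not> p \<sim> r" "u \<sim> v" for p q r u v
    using C5_D[of p q r u v] that by blast
  note yx = adj_sym[OF xy]
  have E: "a \<sim> b" "b \<sim> c" "c \<sim> d" "d \<sim> e" "e \<sim> f" "f \<sim> g" "g \<sim> a"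
    and F: "\<not> a \<sim> c" "\<not> b \<sim> d" "\<not> c \<sim> e" "\<not> d \<sim> f" "\<not> e \<sim> g" "\<not> f \<sim> a" "\<not> g \<sim> b"
    using H by (auto simp: C7_def)
  note R = M
    M[THEN max_C7_rotate]
    M[THEN max_C7_rotate, THEN max_C7_rotate]
    M[THEN max_C7_rotate, THEN max_C7_rotate, THEN max_C7_rotate]
    M[THEN max_C7_rotate, THEN max_C7_rotate, THEN max_C7_rotate, THEN max_C7_rotate]
    M[THEN max_C7_rotate, THEN max_C7_rotate, THEN max_C7_rotate, THEN max_C7_rotate, THEN max_C7_rotate]
    M[THEN max_C7_rotate, THEN max_C7_rotate, THEN max_C7_rotate, THEN max_C7_rotate, THEN max_C7_rotate, THEN
        max_C7_rotate]
  note far = max_C7_no_far_pair[OF _ no_C11]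
  have swap: "\<not> (Q \<and> P)" if "\<not> (P \<and> Q)" for P Q using that by blast
  show ?thesis
    by (rule arc7_pair[OF C7_arc[OF H HV x] C7_arc[OF H HV y]];
      (rule 5[OF E(1) E(2) F(1) xy] 5[OF E(1) E(2) F(1) yx] 5[OF E(2) E(3) F(2) xy] 5[OF E(2) E(3) F(2) yx] 5[OF E(3)
          E(4) F(3) xy] 5[OF E(3) E(4) F(3) yx] 5[OF E(4) E(5) F(4) xy] 5[OF E(4) E(5) F(4) yx] 5[OF E(5) E(6) F(5)
          xy] 5[OF E(5) E(6) F(5) yx] 5[OF E(6) E(7) F(6) xy] 5[OF E(6) E(7) F(6) yx] 5[OF E(7) E(1) F(7) xy] 5[OF
          E(7) E(1) F(7) yx] |
       (rule E[THEN 4, OF xy] E[THEN 4, OF yx], (use x(2) y(2) in simp)+) |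
       (rule R[THEN far, OF x(1) _ y(1) _ xy] R[THEN far, OF y(1) _ x(1) _ yx, THEN swap],
         (use x(2) y(2) in simp)+)))
qed

text \<open>Deleting \<open>T\<close> costs \<open>k\<close> colours and lowers the clique bound by
  \<open>m\<close>. Both pairs that occur, 3 with 2 and 4 with 3, satisfy
  \<open>2 * k \<le> 3 * m\<close>, which is what the bound can pay for.\<close>

definition removable :: "'a set \<Rightarrow> nat \<Rightarrow> nat \<Rightarrow> bool" where
  "removable T k m \<longleftrightarrow> T \<subseteq> V \<and> T \<noteq> {} \<and> colourable T k \<and>
     (\<forall>K. K \<subseteq> V - T \<longrightarrow> clq K \<longrightarrow> (\<exists>L\<subseteq>T. card L = m \<and> clq (K \<union> L)))"

lemma C7_reduction:
  assumes "C7 a b c d e f g" "{a, b, c, d, e, f, g} \<subseteq> V"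
  shows "\<exists>T. removable T 3 2 \<or> removable T 4 3"
proof (cases has_C11)
  case True
  then obtain c0 c1 c2 c3 c4 c5 c6 c7 c8 c9 c10 where
    H: "C11 c0 c1 c2 c3 c4 c5 c6 c7 c8 c9 c10" and HV: "{c0, c1, c2, c3, c4, c5, c6, c7, c8, c9, c10} \<subseteq> V" (is
        "?T \<subseteq> _")
    by (cases rule: has_C11.cases)
  have "\<exists>L\<subseteq>?T. card L = 3 \<and> clq (K \<union> L)" if K: "K \<subseteq> V - ?T" "clq K" for K
  proof -
    have k: "k \<in> V" "k \<notin> ?T" if "k \<in> K" for k using K that by auto
    have "\<exists>p\<in>?T. \<exists>q\<in>?T. \<exists>r\<in>?T. p \<sim> q \<and> q \<sim> r \<and> p \<sim> r \<and> (\<forall>k\<in>K. k \<sim> p \<and> k \<sim> q \<and> k \<sim> r)"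
    proof (rule C11_helly[OF H C11_arc[OF H HV k]])
      fix k l assume kl: "k \<in> K" "l \<in> K"
      show "meet11 (k \<sim> c0 \<and> l \<sim> c0) (k \<sim> c1 \<and> l \<sim> c1) (k \<sim> c2 \<and> l \<sim> c2) (k \<sim> c3 \<and> l \<sim> c3) (k \<sim> c4 \<and> l \<sim> c4) (k \<sim> c5 \<and>
          l \<sim> c5) (k \<sim> c6 \<and> l \<sim> c6) (k \<sim> c7 \<and> l \<sim> c7) (k \<sim> c8 \<and> l \<sim> c8) (k \<sim> c9 \<and> l \<sim> c9) (k \<sim> c10 \<and> l \<sim> c10)"
      \<comment> \<open>The lemma on pairs needs an edge between \<open>k\<close> and
        \<open>l\<close>; for \<open>k = l\<close> the arc itself contains a triangle.\<close>
      proof (cases "k = l")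
        case True
        then show ?thesis using arc11_meet11[OF C11_arc[OF H HV k[OF kl(1)]]] by simp
      next
        case False
        then have "k \<sim> l" using K(2) kl by (auto simp: clq_def)
        then show ?thesis by (rule C11_pair[OF H HV k[OF kl(1)] k[OF kl(2)]])
      qed
    qed
    then obtain p q r where pqr: "p \<in> ?T" "q \<in> ?T" "r \<in> ?T" "p \<sim> q" "q \<sim> r" "p \<sim> r" "\<forall>k\<in>K. k \<sim> p \<and> k \<sim> q \<and> k \<sim> r"
      by (elim bexE conjE) (rule that)
    have "p \<noteq> q" "q \<noteq> r" "p \<noteq> r" using pqr(4-6) adj_irrefl by auto
    moreover have "clq (K \<union> {p, q, r})"
      using pqr(4-7) K(2) by (auto simp: clq_insert intro: adj_sym)
    ultimately show ?thesis using pqr(1-3) by (intro exI[of _ "{p, q, r}"] conjI) simp_all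
  qed
  then have "removable ?T 4 3"
    unfolding removable_def using HV C11_colourable[OF H] by (intro conjI allI impI) simp_all
  then show ?thesis by iprover
next
  case no_C11: False
  obtain a b c d e f g where M: "max_C7 a b c d e f g" using obtain_max_C7[OF assms] by blast
  let ?T = "{a, b, c, d, e, f, g}"
  have H: "C7 a b c d e f g" and HV: "?T \<subseteq> V"
    using M by (simp_all add: max_C7_def)
  have "\<exists>L\<subseteq>?T. card L = 2 \<and> clq (K \<union> L)" if K: "K \<subseteq> V - ?T" "clq K" for K
  proof -
    have k: "k \<in> V" "k \<notin> ?T" if "k \<in> K" for k using K that by auto
    have "\<exists>p\<in>?T. \<exists>q\<in>?T. p \<sim> q \<and> (\<forall>k\<in>K. k \<sim> p \<and> k \<sim> q)"
    proof (rule C7_helly[OF H C7_arc[OF H HV k]])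
      fix k l assume kl: "k \<in> K" "l \<in> K"
      show "meet7 (k \<sim> a \<and> l \<sim> a) (k \<sim> b \<and> l \<sim> b) (k \<sim> c \<and> l \<sim> c) (k \<sim> d \<and> l \<sim> d) (k \<sim> e \<and> l \<sim> e) (k \<sim> f \<and> l \<sim> f)
          (k \<sim> g \<and> l \<sim> g)"
      proof (cases "k = l")
        case True
        then show ?thesis using arc7_meet7[OF C7_arc[OF H HV k[OF kl(1)]]] by simp
      next
        case False
        then have "k \<sim> l" using K(2) kl by (auto simp: clq_def)
        then show ?thesis by (rule max_C7_pair[OF M no_C11 k[OF kl(1)] k[OF kl(2)]])
      qed
    qed
    then obtain p q where pq: "p \<in> ?T" "q \<in> ?T" "p \<sim> q" "\<forall>k\<in>K. k \<sim> p \<and> k \<sim> q"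
      by (elim bexE conjE) (rule that)
    have "p \<noteq> q" using pq(3) adj_irrefl by auto
    moreover have "clq (K \<union> {p, q})"
      using pq(3,4) K(2) by (auto simp: clq_insert intro: adj_sym)
    ultimately show ?thesis using pq(1-2) by (intro exI[of _ "{p, q}"] conjI) simp_all
  qed
  then have "removable ?T 3 2"
    unfolding removable_def using HV C7_colourable[OF H] by (intro conjI allI impI) simp_all
  then show ?thesis by iprover
qed

end

context p7_c4_c5_free
begin

subsection \<open>Separations in graphs without 7-cycles\<close>

definition conn :: "'a set \<Rightarrow> bool" where
  "conn R \<longleftrightarrow> (\<forall>x\<in>R. \<forall>y\<in>R. (x, y) \<in> (edges_in R)\<^sup>*)"

lemma edges_in_rtrancl_mono: "(x, y) \<in> (edges_in R)\<^sup>* \<Longrightarrow> R \<subseteq> W \<Longrightarrow> (x, y) \<in> (edges_in W)\<^sup>*"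
  by (erule rtrancl_mono[THEN subsetD, rotated]) (auto simp: edges_in_def)

lemma conn_insert:
  assumes "conn R" "r \<in> R" "r \<sim> s"
  shows "conn (insert s R)"
proof -
  have rs: "(r, s) \<in> edges_in (insert s R)" "(s, r) \<in> edges_in (insert s R)"
    using assms adj_sym by (auto simp: edges_in_def)
  have R: "(x, y) \<in> (edges_in (insert s R))\<^sup>*" if "x \<in> R" "y \<in> R" for x y
    using assms(1) that edges_in_rtrancl_mono[of x y R "insert s R"] by (auto simp: conn_def)
  have "(x, s) \<in> (edges_in (insert s R))\<^sup>*" "(s, x) \<in> (edges_in (insert s R))\<^sup>*" if "x \<in> R" for x
    using R[OF that assms(2)] R[OF assms(2) that] rs by (auto intro: rtrancl_into_rtrancl
        converse_rtrancl_into_rtrancl)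
  then show ?thesis using R by (auto simp: conn_def)
qed

lemma ind_path_3: "ind_path [a, b, c] \<Longrightarrow> a \<sim> b \<and> b \<sim> c \<and> \<not> a \<sim> c"
  by (simp add: ind_path_def All_less_Suc)

lemma ind_path_4: "ind_path [a, b, c, d] \<Longrightarrow> a \<sim> b \<and> b \<sim> c \<and> c \<sim> d \<and> \<not> a \<sim> c \<and> \<not> a \<sim> d \<and> \<not> b \<sim> d"
  by (simp add: ind_path_def All_less_Suc)

lemma ind_path_5: "ind_path [a, b, c, d, e] \<Longrightarrow> a \<sim> b \<and> b \<sim> c \<and> c \<sim> d \<and> d \<sim> e \<and>
    \<not> a \<sim> c \<and> \<not> a \<sim> d \<and> \<not> a \<sim> e \<and> \<not> b \<sim> d \<and> \<not> b \<sim> e \<and> \<not> c \<sim> e"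
  by (simp add: ind_path_def All_less_Suc)

lemma ind_path_6: "ind_path [a, b, c, d, e, f] \<Longrightarrow> a \<sim> b \<and> b \<sim> c \<and> c \<sim> d \<and> d \<sim> e \<and> e \<sim> f \<and>
    \<not> a \<sim> c \<and> \<not> a \<sim> d \<and> \<not> a \<sim> e \<and> \<not> a \<sim> f \<and> \<not> b \<sim> d \<and> \<not> b \<sim> e \<and> \<not> b \<sim> f \<and> \<not> c \<sim> e \<and> \<not> c \<sim> f \<and> \<not> d \<sim> f"
  by (simp add: ind_path_def All_less_Suc)

text \<open>The inequalities cannot be dropped: in a closed walk of length 4 opposite vertices may
  coincide without creating a chord. In \<open>C5E\<close> the missing chords already keep the
  vertices apart.\<close>

lemma C4E: "\<lbrakk>a \<sim> b; b \<sim> c; c \<sim> d; d \<sim> a; a \<noteq> c; b \<noteq> d; \<not> a \<sim> c; \<not> b \<sim> d\<rbrakk> \<Longrightarrow> False"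
  using no_C4[of a b c d] by blast

lemma C5E: "\<lbrakk>a \<sim> b; b \<sim> c; c \<sim> d; d \<sim> e; e \<sim> a; \<not> a \<sim> c; \<not> b \<sim> d; \<not> c \<sim> e; \<not> d \<sim> a; \<not> e \<sim> b\<rbrakk> \<Longrightarrow> False"
  using no_C5[of a b c d e] by blast

end

text \<open>The vertex \<open>v\<close> is complete to \<open>S\<close> and has no neighbour in
  \<open>R\<close>, so it closes up paths with ends in \<open>S\<close> and interior in
  \<open>R\<close>.\<close>

locale C7_free_separation = p7_c4_c5_free adj for adj :: "'a \<Rightarrow> 'a \<Rightarrow> bool" (infix "\<sim>" 50) +
  fixes R S C :: "'a set" and v :: 'a
  assumes disj: "R \<inter> S = {}" "R \<inter> C = {}" "S \<inter> C = {}"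
    and finite: "finite R" "finite S" "finite C"
    and conn_R: "conn R"
    and R_nbr: "s \<in> S \<Longrightarrow> \<exists>r\<in>R. r \<sim> s"
    and SC: "\<lbrakk>s \<in> S; x \<in> C\<rbrakk> \<Longrightarrow> x \<sim> s"
    and RC: "\<lbrakk>r \<in> R; x \<in> C\<rbrakk> \<Longrightarrow> \<not> x \<sim> r"
    and v: "v \<in> C"
    and no_C7: "\<lbrakk>{a, b, c, d, e, f, g} \<subseteq> R \<union> S \<union> C; a \<sim> b; b \<sim> c; c \<sim> d; d \<sim> e; e \<sim> f; f \<sim> g; g \<sim> a;
      \<not> a \<sim> c; \<not> b \<sim> d; \<not> c \<sim> e; \<not> d \<sim> f; \<not> e \<sim> g; \<not> f \<sim> a; \<not> g \<sim> b;
      \<not> a \<sim> d; \<not> b \<sim> e; \<not> c \<sim> f; \<not> d \<sim> g; \<not> e \<sim> a; \<not> f \<sim> b; \<not> g \<sim> c\<rbrakk> \<Longrightarrow> False"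
begin

lemma vS: "s \<in> S \<Longrightarrow> v \<sim> s" "s \<in> S \<Longrightarrow> s \<sim> v"
  using SC v adj_sym by blast+

lemma vR: "r \<in> R \<Longrightarrow> \<not> v \<sim> r" "r \<in> R \<Longrightarrow> \<not> r \<sim> v" "r \<in> R \<Longrightarrow> v \<noteq> r" "r \<in> R \<Longrightarrow> r \<noteq> v"
  using RC v adj_sym disj by blast+

lemma RS_neq: "r \<in> R \<Longrightarrow> s \<in> S \<Longrightarrow> r \<noteq> s" "r \<in> R \<Longrightarrow> s \<in> S \<Longrightarrow> s \<noteq> r"
  using disj by blast+

text \<open>An induced path from \<open>s\<close> to \<open>t\<close> with interior in
  \<open>R\<close> has at most six vertices. Together with \<open>v\<close> it forms an induced
  cycle, so three, four or six vertices would give a cycle of length 4, 5 or 7. Five remain.\<close>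

lemma path_through_R:
  assumes st: "s \<in> S" "t \<in> S" "s \<noteq> t" "\<not> s \<sim> t"
  obtains a b c where "a \<in> R" "b \<in> R" "c \<in> R" "s \<sim> a" "a \<sim> b" "b \<sim> c" "c \<sim> t"
    "\<not> s \<sim> b" "\<not> s \<sim> c" "\<not> a \<sim> c" "\<not> a \<sim> t" "\<not> b \<sim> t"
proof -
  let ?W = "insert s (insert t R)"
  obtain r r' where r: "r \<in> R" "r \<sim> s" "r' \<in> R" "r' \<sim> t" using R_nbr st by blast
  have "(s, r) \<in> edges_in ?W" "(r', t) \<in> edges_in ?W"
    using r adj_sym by (auto simp: edges_in_def)
  moreover have "(r, r') \<in> (edges_in ?W)\<^sup>*"
    using conn_R r edges_in_rtrancl_mono[of r r' R ?W] by (auto simp: conn_def)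
  ultimately have "(s, t) \<in> (edges_in ?W)\<^sup>*" by (meson converse_rtrancl_into_rtrancl rtrancl_into_rtrancl)
  then obtain p where p: "p \<noteq> []" "hd p = s" "last p = t" "set p \<subseteq> ?W" "ind_path p"
    using obtain_ind_path[of s t ?W] by blast
  have d: "distinct p" using p(5) by (simp add: ind_path_def)
  have len: "length p \<le> 6" by (rule ind_path_length[OF p(5)])
  show thesis
  proof (rule length_le_6_cases[OF len p(1)])
    fix a assume "p = [a]" then show thesis using p st by simp
  next
    fix a b assume "p = [a, b]"
    then show thesis using p st by (auto simp: ind_path_def All_less_Suc)
  next
    fix a b c assume P: "p = [a, b, c]"
    then have *: "a = s" "c = t" "b \<in> R" using p d by auto
    have "s \<sim> b \<and> b \<sim> t" using ind_path_3[OF p(5)[unfolded P]] * by simp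
    then have False using C4E[of v s b t] st vS[OF st(1)] vS[OF st(2)] vR[OF *(3)] by blast
    then show thesis ..
  next
    fix a b c e assume P: "p = [a, b, c, e]"
    then have *: "a = s" "e = t" "b \<in> R" "c \<in> R" using p d by auto
    have "s \<sim> b \<and> b \<sim> c \<and> c \<sim> t \<and> \<not> s \<sim> c \<and> \<not> b \<sim> t"
      using ind_path_4[OF p(5)[unfolded P]] * by simp
    then have False
      using C5E[of v s b c t] st vS[OF st(1)] vS[OF st(2)] vR[OF *(3)] vR[OF *(4)] adj_commute[of s t] by blast
    then show thesis ..
  next
    fix a b c e f assume P: "p = [a, b, c, e, f]"
    then have *: "a = s" "f = t" "b \<in> R" "c \<in> R" "e \<in> R" using p d by auto
    show thesis using that[of b c e] ind_path_5[OF p(5)[unfolded P]] * by simp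
  next
    fix a b c e f g assume P: "p = [a, b, c, e, f, g]"
    then have *: "a = s" "g = t" "b \<in> R" "c \<in> R" "e \<in> R" "f \<in> R" using p d by auto
    have i: "s \<sim> b" "b \<sim> c" "c \<sim> e" "e \<sim> f" "f \<sim> t"
      "\<not> s \<sim> c" "\<not> s \<sim> e" "\<not> s \<sim> f" "\<not> s \<sim> t" "\<not> b \<sim> e" "\<not> b \<sim> f" "\<not> b \<sim> t" "\<not> c \<sim> f" "\<not> c \<sim> t" "\<not> e \<sim> t"
      using ind_path_6[OF p(5)[unfolded P]] * by simp_all
    have False
      by (rule no_C7[of v s b c e f t]) (use * i st v vS[OF st(1)] vS[OF st(2)] vR[OF *(3)] vR[OF *(4)] vR[OF *(5)]
          vR[OF *(6)]
          in \<open>auto simp: adj_commute\<close>)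
    then show thesis ..
  qed
qed

text \<open>The asymmetric case of \<open>no_P4\<close>. A neighbour \<open>r\<close> of
  \<open>s3\<close> in \<open>R\<close> is forced to see \<open>b\<close>, \<open>c\<close> and
  \<open>s4\<close> but not \<open>a\<close>, \<open>s1\<close> or \<open>s2\<close>, and then
  \<open>s2, a, b, r, s3\<close> is an induced 5-cycle.\<close>

lemma no_P4_aux:
  assumes S: "s1 \<in> S" "s2 \<in> S" "s3 \<in> S" "s4 \<in> S"
    and e: "s1 \<sim> s2" "s2 \<sim> s3" "s3 \<sim> s4" and n: "\<not> s1 \<sim> s3" "\<not> s1 \<sim> s4" "\<not> s2 \<sim> s4"
    and R: "a \<in> R" "b \<in> R" "c \<in> R"
    and p: "s1 \<sim> a" "a \<sim> b" "b \<sim> c" "c \<sim> s4"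
      "\<not> s1 \<sim> b" "\<not> s1 \<sim> c" "\<not> a \<sim> c" "\<not> a \<sim> s4" "\<not> b \<sim> s4"
    and s2: "s2 \<sim> a" "\<not> s2 \<sim> b" "\<not> s2 \<sim> c" and s3: "\<not> s3 \<sim> a" "\<not> s3 \<sim> b" "\<not> s3 \<sim> c"
  shows False
proof -
  obtain r where r: "r \<in> R" "r \<sim> s3" using R_nbr S(3) by blast
  note vv = vS[OF S(1)] vS[OF S(2)] vS[OF S(3)] vS[OF S(4)] vR[OF R(1)] vR[OF R(2)] vR[OF R(3)] vR[OF r(1)]
  have ne: "s1 \<noteq> s3" "s1 \<noteq> s4" "s2 \<noteq> s4" "r \<noteq> s1" "r \<noteq> s4" "r \<noteq> s2" "s3 \<noteq> c" "s4 \<noteq> b"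
    using e n adj_irrefl RS_neq r R S adj_commute by blast+
  have 1: "\<not> r \<sim> s1" using C4E[of r s1 v s3] vv ne r n e by (auto simp: adj_commute)
  have 2: "r \<sim> a \<or> r \<sim> b \<or> r \<sim> c"
    using no_P7[of r s3 v s1 a b c] r vv p s3 n 1 by (auto simp: adj_commute)
  have 3: "\<not> r \<sim> a" using C5E[of r a s1 v s3] vv r p n s3 1 by (auto simp: adj_commute)
  have 4: "r \<sim> s4"
  proof (rule ccontr)
    assume "\<not> r \<sim> s4"
    moreover have "\<not> r \<sim> c" using C4E[of s3 s4 c r] ne e p r s3 \<open>\<not> r \<sim> s4\<close> by (auto simp: adj_commute)
    ultimately show False using 2 3 C5E[of s3 s4 c b r] e p r s3 by (auto simp: adj_commute)
  qed
  have 5: "r \<sim> c" using 2 3 4 C4E[of s4 c b r] p ne r s3 by (auto simp: adj_commute)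
  have 6: "r \<sim> b"
  proof (rule ccontr)
    assume "\<not> r \<sim> b"
    show False
      by (rule no_C7[of s3 r c b a s1 v])
        (use S R r v 1 3 5 \<open>\<not> r \<sim> b\<close> e n p s3 vv in \<open>auto simp: adj_commute\<close>)
  qed
  have 7: "\<not> s2 \<sim> r" using C4E[of v s2 r s4] vv ne n 4 by (auto simp: adj_commute)
  show False using C5E[of s2 a b r s3] s2 s3 p 6 r e 7 3 by (auto simp: adj_commute)
qed

text \<open>Join \<open>s1\<close> to \<open>s4\<close> by \<open>a, b, c\<close> in
  \<open>R\<close>. Going through \<open>v\<close> shows that \<open>s2\<close> sees at most
  \<open>a\<close>, and \<open>s3\<close> at most \<open>c\<close>, on this path. If both do, a
  5-cycle appears; if neither does, a 7-cycle. The mixed cases are mirror images of each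
  other.\<close>

lemma no_P4:
  assumes S: "s1 \<in> S" "s2 \<in> S" "s3 \<in> S" "s4 \<in> S"
    and e: "s1 \<sim> s2" "s2 \<sim> s3" "s3 \<sim> s4" and n: "\<not> s1 \<sim> s3" "\<not> s1 \<sim> s4" "\<not> s2 \<sim> s4"
  shows False
proof -
  have "s1 \<noteq> s4" using e n by (auto simp: adj_commute)
  then obtain a b c where R: "a \<in> R" "b \<in> R" "c \<in> R"
    and p: "s1 \<sim> a" "a \<sim> b" "b \<sim> c" "c \<sim> s4"
      "\<not> s1 \<sim> b" "\<not> s1 \<sim> c" "\<not> a \<sim> c" "\<not> a \<sim> s4" "\<not> b \<sim> s4"
    using path_through_R[OF S(1,4) _ n(2)] by metis
  note vv = vS[OF S(1)] vS[OF S(2)] vS[OF S(3)] vS[OF S(4)] vR[OF R(1)] vR[OF R(2)] vR[OF R(3)]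
  have ne: "s1 \<noteq> s3" "s2 \<noteq> s4" using e n by (auto simp: adj_commute)+
  have s2: "\<not> s2 \<sim> c" "\<not> s2 \<sim> b"
  proof -
    show *: "\<not> s2 \<sim> c" using C4E[of s2 c s4 v] vv ne p n by (auto simp: adj_commute)
    show "\<not> s2 \<sim> b" using C5E[of s2 b c s4 v] vv p n * by (auto simp: adj_commute)
  qed
  have s3: "\<not> s3 \<sim> a" "\<not> s3 \<sim> b"
  proof -
    show *: "\<not> s3 \<sim> a" using C4E[of s3 a s1 v] vv ne p n by (auto simp: adj_commute)
    show "\<not> s3 \<sim> b" using C5E[of s3 b a s1 v] vv p n * by (auto simp: adj_commute)
  qed
  consider "s2 \<sim> a" "s3 \<sim> c" | "\<not> s2 \<sim> a" "\<not> s3 \<sim> c" | "s2 \<sim> a" "\<not> s3 \<sim> c" | "\<not> s2 \<sim> a" "s3 \<sim> c"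
    by blast
  then show False
  proof cases
    case 1
    then show False using C5E[of s2 a b c s3] s2 s3 p e by (auto simp: adj_commute)
  next
    case 2
    show False
      by (rule no_C7[of s1 a b c s4 s3 s2]) (use S R 2 s2 s3 p e n in \<open>auto simp: adj_commute\<close>)
  next
    case 3
    then show False using no_P4_aux[OF S e n R p] s2 s3 by blast
  next
    case 4
    then show False
      using no_P4_aux[of s4 s3 s2 s1 c b a] S e n R p s2 s3 by (auto simp: adj_commute)
  qed
qed

text \<open>Join \<open>s1\<close> to \<open>s4\<close> by \<open>a, b, c\<close> in
  \<open>R\<close>. Then \<open>s2\<close> must see \<open>a\<close>, or
  \<open>s3, s2, s1, a, b, c, s4\<close> is an induced path. A neighbour \<open>r\<close> of
  \<open>s3\<close> in \<open>R\<close> is forced to see \<open>b\<close> but not \<open>a\<close>,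
  and also \<open>s2\<close>, which closes the 4-cycle \<open>s2, a, b, r\<close>.\<close>

lemma no_P3_K1:
  assumes S: "s1 \<in> S" "s2 \<in> S" "s3 \<in> S" "s4 \<in> S"
    and e: "s1 \<sim> s2" "s2 \<sim> s3" and n: "\<not> s1 \<sim> s3" "s1 \<noteq> s3" "\<not> s4 \<sim> s1" "\<not> s4 \<sim> s2" "\<not> s4 \<sim> s3"
    and ne: "s4 \<noteq> s1" "s4 \<noteq> s2" "s4 \<noteq> s3"
  shows False
proof -
  have n': "\<not> s1 \<sim> s4" "\<not> s2 \<sim> s4" "\<not> s3 \<sim> s4" "s1 \<noteq> s4" using n ne by (auto simp: adj_commute)+
  obtain a b c where R: "a \<in> R" "b \<in> R" "c \<in> R"
    and p: "s1 \<sim> a" "a \<sim> b" "b \<sim> c" "c \<sim> s4"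
      "\<not> s1 \<sim> b" "\<not> s1 \<sim> c" "\<not> a \<sim> c" "\<not> a \<sim> s4" "\<not> b \<sim> s4"
    using path_through_R[OF S(1,4) n'(4,1)] by metis
  obtain r where r: "r \<in> R" "r \<sim> s3" using R_nbr S(3) by blast
  note vv = vS[OF S(1)] vS[OF S(2)] vS[OF S(3)] vS[OF S(4)] vR[OF R(1)] vR[OF R(2)] vR[OF R(3)] vR[OF r(1)]
  have ner: "r \<noteq> s1" "r \<noteq> s4" "r \<noteq> s2" "s2 \<noteq> b" using RS_neq r R S by blast+
  have s2c: "\<not> s2 \<sim> c" using C4E[of s2 c s4 v] vv ne p n' by (auto simp: adj_commute)
  have s2b: "\<not> s2 \<sim> b" using C5E[of s2 b c s4 v] vv p n' s2c by (auto simp: adj_commute)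
  have s3a: "\<not> s3 \<sim> a" using C4E[of s3 a s1 v] vv n p by (auto simp: adj_commute)
  have s3c: "\<not> s3 \<sim> c" using C4E[of s3 c s4 v] vv ne n' p by (auto simp: adj_commute)
  have s3b: "\<not> s3 \<sim> b" using C5E[of s3 b a s1 v] vv n p s3a by (auto simp: adj_commute)
  have s2a: "s2 \<sim> a"
    using no_P7[of s3 s2 s1 a b c s4] e p n n' s2b s2c s3a s3b s3c by (auto simp: adj_commute)
  have r1: "\<not> r \<sim> s1" using C4E[of r s1 v s3] vv ner r n by (auto simp: adj_commute)
  have r4: "\<not> r \<sim> s4" using C4E[of r s4 v s3] vv ner ne r n' by (auto simp: adj_commute)
  have "r \<sim> a \<or> r \<sim> b \<or> r \<sim> c"
    using no_P7[of r s3 v s1 a b c] r vv p s3a s3b s3c n r1 by (auto simp: adj_commute)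
  moreover have ra: "\<not> r \<sim> a" using C5E[of r a s1 v s3] vv r p n s3a r1 by (auto simp: adj_commute)
  moreover have "\<not> r \<sim> c" using C5E[of r c s4 v s3] vv r p n' s3c r4 by (auto simp: adj_commute)
  ultimately have rb: "r \<sim> b" by blast
  have "s2 \<sim> r" using C5E[of s2 a b r s3] s2a s2b s3a s3b p rb r e ra by (auto simp: adj_commute)
  moreover have "a \<noteq> r" using r s3a by (auto simp: adj_commute)
  ultimately show False using C4E[of s2 a b r] s2a p rb s2b ra ner by (auto simp: adj_commute)
qed

text \<open>Hence \<open>S\<close> is the join of a clique and a disjoint union of cliques.\<close>

lemma P3_centre_universal:
  assumes S: "x \<in> S" "y \<in> S" "z \<in> S" "w \<in> S" and e: "x \<sim> y" "y \<sim> z" and n: "\<not> x \<sim> z" "x \<noteq> z"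
  shows "w = y \<or> w \<sim> y"
proof (rule ccontr)
  assume *: "\<not> ?thesis"
  then have ne: "w \<noteq> y" "w \<noteq> x" "w \<noteq> z" using e by (auto simp: adj_commute)+
  consider "w \<sim> x" "w \<sim> z" | "w \<sim> x" "\<not> w \<sim> z" | "\<not> w \<sim> x" "w \<sim> z" | "\<not> w \<sim> x" "\<not> w \<sim> z" by blast
  then show False
  proof cases
    case 1 then show False using C4E[of w x y z] * e n ne by (auto simp: adj_commute)
  next
    case 2 then show False using no_P4[of w x y z] S * e n by blast
  next
    case 3 then show False using no_P4[of x y z w] S * e n by (auto simp: adj_commute)
  next
    case 4 then show False using no_P3_K1[of x y z w] S * e n ne by blast
  qed
qed

lemma v_nbr: "w \<in> R \<union> S \<Longrightarrow> v \<sim> w \<longleftrightarrow> w \<in> S"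
  using vS vR by blast

subsection \<open>Kempe changes\<close>

text \<open>The vertices \<open>x\<close> and \<open>y\<close> lie in one Kempe component but have different colours, so they are joined by an
  induced path of odd length, at most 5. Closing it up through \<open>v\<close> leaves only the pattern where the
  vertex before \<open>x\<close> belongs to \<open>S\<close>.\<close>

lemma Kempe_path:
  assumes c: "proper (R \<union> S) k c" and y: "y \<in> S" and x: "x \<in> S" "c x \<noteq> c y" "\<not> y \<sim> x"
    and W: "W = {w \<in> R \<union> S. c w = c x \<or> c w = c y}"
    and path: "(y, x) \<in> (edges_in W)\<^sup>*"
    and y_nbr: "\<And>s. s \<in> S \<Longrightarrow> y \<sim> s \<Longrightarrow> c s \<noteq> c x"
  shows "\<exists>s\<in>S. s \<sim> x \<and> c s = c y \<and> s \<noteq> y"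
proof -
  have yW: "y \<in> W" using y W by auto
  obtain p where p: "p \<noteq> []" "hd p = y" "last p = x" "set p \<subseteq> W" "ind_path p"
    using obtain_ind_path[OF path yW] by blast
  have alt: "(c a = c y \<longleftrightarrow> c b = c x) \<and> (c a = c x \<longleftrightarrow> c b = c y)" if "a \<sim> b" "a \<in> W" "b \<in> W" for a b
  proof -
    have "a \<in> R \<union> S" "b \<in> R \<union> S" using that W by auto
    then have "c a \<noteq> c b" using c that(1) unfolding proper_def by blast
    then show ?thesis using that(2,3) W x(2) by auto
  qed
  have v_nbrW: "v \<sim> w \<longleftrightarrow> w \<in> S" if "w \<in> W" for w using that v_nbr W by auto
  have vW: "v \<noteq> w" if "w \<in> W" for w using that W v disj by auto
  have mem: "w \<in> R \<union> S \<union> C" if "w \<in> W" for w using that W by auto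
  have len: "length p \<le> 6" by (rule ind_path_length[OF p(5)])
  have d: "distinct p" using p(5) by (simp add: ind_path_def)
  show ?thesis
  proof (rule length_le_6_cases[OF len p(1)])
    fix a assume "p = [a]" then show ?thesis using p x by auto
  next
    fix a b assume "p = [a, b]"
    then show ?thesis using p x(3) by (auto simp: ind_path_def All_less_Suc)
  next
    fix a b e assume P: "p = [a, b, e]"
    then have *: "a = y" "e = x" "b \<in> W" "x \<in> W" using p by auto
    have "y \<sim> b \<and> b \<sim> x" using ind_path_3[OF p(5)[unfolded P]] * by simp
    then show ?thesis using alt[of y b] alt[of b x] yW * x(2) by blast
  next
    fix a b e f assume P: "p = [a, b, e, f]"
    then have *: "a = y" "f = x" "b \<in> W" "e \<in> W" "x \<in> W" and ne: "b \<noteq> x" "y \<noteq> e" using p d by auto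
    have i: "y \<sim> b" "b \<sim> e" "e \<sim> x" "\<not> y \<sim> e" "\<not> b \<sim> x" using ind_path_4[OF p(5)[unfolded P]] * by simp_all
    have "c b = c x" using alt[OF i(1) yW *(3)] by simp
    then have "b \<notin> S" using y_nbr i(1) by blast
    then have vb: "\<not> v \<sim> b" using v_nbrW * by simp
    have False
    proof (cases "e \<in> S")
      case True
      then show False
        using C4E[of v y b e] i vb v_nbrW[OF *(4)] v_nbrW[OF yW] y ne vW[OF *(3)] by (auto simp: adj_commute)
    next
      case False
      then show False
        using C5E[of v y b e x] i vb v_nbrW[OF *(4)] v_nbrW[OF yW] v_nbrW[OF *(5)] y x by (auto simp: adj_commute)
    qed
    then show ?thesis ..
  next
    fix a b e f g assume P: "p = [a, b, e, f, g]"
    then have *: "a = y" "g = x" "b \<in> W" "e \<in> W" "f \<in> W" "x \<in> W" using p by auto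
    have "y \<sim> b \<and> b \<sim> e \<and> e \<sim> f \<and> f \<sim> x" using ind_path_5[OF p(5)[unfolded P]] * by simp
    then show ?thesis using alt[of y b] alt[of b e] alt[of e f] alt[of f x] yW * x(2) by blast
  next
    fix a b e f g h assume P: "p = [a, b, e, f, g, h]"
    then have *: "a = y" "h = x" "b \<in> W" "e \<in> W" "f \<in> W" "g \<in> W" "x \<in> W"
      and ne: "y \<noteq> e" "y \<noteq> g" using p d by auto
    have i: "y \<sim> b" "b \<sim> e" "e \<sim> f" "f \<sim> g" "g \<sim> x"
      "\<not> y \<sim> e" "\<not> y \<sim> f" "\<not> y \<sim> g" "\<not> y \<sim> x" "\<not> b \<sim> f" "\<not> b \<sim> g" "\<not> b \<sim> x" "\<not> e \<sim> g" "\<not> e \<sim> x" "\<not> f \<sim> x"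
      using ind_path_6[OF p(5)[unfolded P]] * by simp_all
    have cb: "c b = c x" using alt[OF i(1) yW *(3)] by blast
    have ce: "c e = c y" using alt[OF i(2) *(3,4)] cb by blast
    have cf: "c f = c x" using alt[OF i(3) *(4,5)] ce by blast
    have cg: "c g = c y" using alt[OF i(4) *(5,6)] cf by blast
    \<comment> \<open>The colour of \<open>b\<close> keeps it out of \<open>S\<close>. From there
      on, excluding cycles of length 4, 5 and 7 decides in turn whether \<open>v\<close> sees
      \<open>e\<close>, \<open>f\<close> and \<open>g\<close>.\<close>
    have "b \<notin> S" using y_nbr i(1) cb by blast
    then have vb: "\<not> v \<sim> b" using v_nbrW * by simp
    have ve: "\<not> v \<sim> e"
      using C4E[of v y b e] i vb v_nbrW[OF yW] y ne vW[OF *(3)] by (auto simp: adj_commute)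
    have vf: "\<not> v \<sim> f"
      using C5E[of v y b e f] i vb ve v_nbrW[OF yW] y by (auto simp: adj_commute)
    have "v \<sim> g"
    proof (rule ccontr)
      assume vg: "\<not> v \<sim> g"
      show False
        by (rule no_C7[of v y b e f g x])
          (use mem[OF *(3)] mem[OF *(4)] mem[OF *(5)] mem[OF *(6)] v y x(1) i vb ve vf vg vS[OF y] vS[OF x(1)]
            in \<open>simp_all add: adj_commute\<close>)
    qed
    then have "g \<in> S" using v_nbrW[OF *(6)] by simp
    then show ?thesis using i(5) cg ne(2) by blast
  qed
qed

definition multiplicity_in :: "('a \<Rightarrow> nat) \<Rightarrow> nat \<Rightarrow> nat" where
  "multiplicity_in c i = card {s \<in> S. c s = i}"

definition concentration :: "nat \<Rightarrow> ('a \<Rightarrow> nat) \<Rightarrow> nat" where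
  "concentration k c = (\<Sum>i<k. (multiplicity_in c i)\<^sup>2)"

text \<open>Here \<open>p\<close> and \<open>q\<close> count the vertices of colours
  \<open>i\<close> and \<open>j\<close> that are swapped, \<open>m\<close> and \<open>n\<close>
  those that stay. The sum of the squares grows by \<open>2 * (q - p) * (m - n)\<close>, and the
  last assumption makes \<open>m - n\<close> at least \<open>q - p\<close>.\<close>

lemma concentration_less:
  assumes "i < k" "j < k" "i \<noteq> j" and other: "\<And>l. l \<noteq> i \<Longrightarrow> l \<noteq> j \<Longrightarrow> multiplicity_in d l = multiplicity_in c l"
    and "multiplicity_in c i = p + m" "multiplicity_in c j = q + n"
      "multiplicity_in d i = q + m" "multiplicity_in d j = p + n"
    and "p < q" "multiplicity_in c j \<le> multiplicity_in c i"
  shows "concentration k c < concentration k d"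
proof -
  have split: "concentration k e = (multiplicity_in e i)\<^sup>2 + (multiplicity_in e j)\<^sup>2 +
      (\<Sum>l\<in>{..<k} - {i, j}. (multiplicity_in e l)\<^sup>2)" for e
  proof -
    have "{..<k} = insert i (insert j ({..<k} - {i, j}))" using assms(1,2) by auto
    then show ?thesis unfolding concentration_def using assms(3)
      by (metis (no_types, lifting) Diff_iff add.assoc finite_Diff finite_insert finite_lessThan insertCI insertE
          sum.insert)
  qed
  have rest: "(\<Sum>l\<in>{..<k} - {i, j}. (multiplicity_in d l)\<^sup>2) = (\<Sum>l\<in>{..<k} - {i, j}. (multiplicity_in c l)\<^sup>2)"
    by (intro sum.cong refl) (use other in auto)
  \<comment> \<open>The differences \<open>q - p = Suc t\<close> and
    \<open>m - n = Suc t + r\<close> are named, so that the inequality becomes a polynomial one over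
    the naturals.\<close>
  obtain t where t: "q = p + Suc t" using \<open>p < q\<close> less_iff_Suc_add by auto
  obtain r where r: "m = n + Suc t + r"
    using assms(5,6,10) t le_Suc_ex[of "n + Suc t" m] by auto
  have "(p + m)\<^sup>2 + (q + n)\<^sup>2 < (q + m)\<^sup>2 + (p + n)\<^sup>2"
    unfolding r t by (simp add: power2_eq_square algebra_simps)
  then show ?thesis unfolding split[of c] split[of d] rest assms(5-8) by simp
qed

lemma concentration_bound: "concentration k c \<le> k * (card S)\<^sup>2"
proof -
  have "multiplicity_in c i \<le> card S" for i
    unfolding multiplicity_in_def using finite(2) by (intro card_mono) auto
  then have "concentration k c \<le> (\<Sum>i<k. (card S)\<^sup>2)"
    unfolding concentration_def by (intro sum_mono power_mono) auto
  then show ?thesis by simp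
qed

text \<open>Otherwise swap the colours in the Kempe component of \<open>y\<close>. Each vertex of \<open>S\<close> in it with colour \<open>i\<close>
  has a neighbour in \<open>S\<close> with the colour of \<open>y\<close>; these neighbours are distinct, since a common one would be the centre
  of an induced path and hence adjacent to \<open>y\<close>. So the swap would increase the concentration.\<close>

lemma Kempe_swap:
  assumes c: "proper (R \<union> S) k c"
    and max: "\<And>d. proper (R \<union> S) k d \<Longrightarrow> concentration k d \<le> concentration k c"
    and i: "i < k" and y: "y \<in> S" "c y \<noteq> i" and le: "multiplicity_in c (c y) \<le> multiplicity_in c i"
  shows "\<exists>s\<in>S. y \<sim> s \<and> c s = i"
proof (rule ccontr)
  assume no: "\<not> ?thesis"
  define j where "j = c y"
  define W where "W = {w \<in> R \<union> S. c w = i \<or> c w = j}"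
  define T where "T = {x. (y, x) \<in> (edges_in W)\<^sup>*}"
  have yW: "y \<in> W" using y by (simp add: W_def j_def)
  have TW: "T \<subseteq> W" using edges_in_rtrancl_mem[of y _ W] yW by (auto simp: T_def)
  have yT: "y \<in> T" by (simp add: T_def)
  have Tstep: "b \<in> T" if "a \<in> T" "a \<sim> b" "b \<in> W" for a b
  proof -
    have "(a, b) \<in> edges_in W" using that TW by (auto simp: edges_in_def)
    then show ?thesis using that(1) unfolding T_def by (auto intro: rtrancl_into_rtrancl)
  qed
  have ij: "i \<noteq> j" using y(2) by (simp add: j_def)
  have jk: "j < k" using c y(1) by (auto simp: proper_def j_def)
  define d where "d = (\<lambda>x. if x \<in> T then (if c x = i then j else i) else c x)"
  have cT: "c x = i \<or> c x = j" if "x \<in> T" for x using that TW by (auto simp: W_def)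
  have cne: "c a \<noteq> c b" if "a \<in> R \<union> S" "b \<in> R \<union> S" "a \<sim> b" for a b
    using c that by (auto simp: proper_def)
  have d: "proper (R \<union> S) k d"
    unfolding proper_def
  proof (intro conjI ballI impI)
    fix a assume "a \<in> R \<union> S"
    then show "d a < k" using c i jk by (auto simp: d_def proper_def)
  next
    fix a b assume ab: "a \<in> R \<union> S" "b \<in> R \<union> S" "a \<sim> b"
    have out: "c b' \<noteq> i \<and> c b' \<noteq> j" if "a' \<in> T" "b' \<notin> T" "a' \<sim> b'" "b' \<in> R \<union> S" for a' b'
      using Tstep[of a' b'] that by (auto simp: W_def)
    show "d a \<noteq> d b"
    proof (cases "a \<in> T"; cases "b \<in> T")
      assume "a \<in> T" "b \<in> T"
      then show ?thesis using cne[OF ab] cT[of a] cT[of b] ij by (auto simp: d_def)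
    next
      assume "a \<in> T" "b \<notin> T"
      then show ?thesis using out[of a b] ab by (auto simp: d_def)
    next
      assume "a \<notin> T" "b \<in> T"
      then show ?thesis using out[of b a] ab adj_sym[OF ab(3)] by (auto simp: d_def)
    next
      assume "a \<notin> T" "b \<notin> T"
      then show ?thesis using cne[OF ab] by (auto simp: d_def)
    qed
  qed
  define Ai Aj Bi Bj where "Ai = {s \<in> S. s \<in> T \<and> c s = i}" and "Aj = {s \<in> S. s \<in> T \<and> c s = j}"
    and "Bi = {s \<in> S. s \<notin> T \<and> c s = i}" and "Bj = {s \<in> S. s \<notin> T \<and> c s = j}"
  note defs = Ai_def Aj_def Bi_def Bj_def
  have fin: "finite Ai" "finite Aj" "finite Bi" "finite Bj" using finite(2) by (auto simp: defs)
  have "{s \<in> S. c s = i} = Ai \<union> Bi" "{s \<in> S. c s = j} = Aj \<union> Bj"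
    "{s \<in> S. d s = i} = Aj \<union> Bi" "{s \<in> S. d s = j} = Ai \<union> Bj"
    using ij cT by (auto simp: defs d_def)
  moreover have "Ai \<inter> Bi = {}" "Aj \<inter> Bj = {}" "Aj \<inter> Bi = {}" "Ai \<inter> Bj = {}" by (auto simp: defs)
  ultimately have mult: "multiplicity_in c i = card Ai + card Bi" "multiplicity_in c j = card Aj + card Bj"
    "multiplicity_in d i = card Aj + card Bi" "multiplicity_in d j = card Ai + card Bj"
    using fin by (simp_all add: multiplicity_in_def card_Un_disjoint)
  have other: "multiplicity_in d l = multiplicity_in c l" if "l \<noteq> i" "l \<noteq> j" for l
  proof -
    have "{s \<in> S. d s = l} = {s \<in> S. c s = l}" using that cT by (auto simp: d_def)
    then show ?thesis by (simp add: multiplicity_in_def)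
  qed
  \<comment> \<open>Leaving \<open>y\<close> out of the targets is what later makes
    \<open>card Ai < card Aj\<close> strict.\<close>
  have "\<forall>x\<in>Ai. \<exists>s. s \<in> Aj - {y} \<and> s \<sim> x"
  proof
    fix x assume "x \<in> Ai"
    then have x: "x \<in> S" "x \<in> T" "c x = i" by (auto simp: Ai_def)
    have "\<exists>s\<in>S. s \<sim> x \<and> c s = c y \<and> s \<noteq> y"
    proof (rule Kempe_path[OF c y(1) x(1) _ _ refl])
      show "c x \<noteq> c y" using x y by simp
      show "\<not> y \<sim> x" using no x by blast
      show "(y, x) \<in> (edges_in {w \<in> R \<union> S. c w = c x \<or> c w = c y})\<^sup>*"
        using x(2) by (simp add: T_def W_def x(3) j_def)
      show "c s \<noteq> c x" if "s \<in> S" "y \<sim> s" for s using no that x(3) by blast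
    qed
    then obtain s where s: "s \<in> S" "s \<sim> x" "c s = j" "s \<noteq> y" by (auto simp: j_def)
    have "s \<in> T" using Tstep[OF x(2) adj_sym[OF s(2)]] s by (auto simp: W_def)
    then show "\<exists>s. s \<in> Aj - {y} \<and> s \<sim> x" using s by (auto simp: Aj_def)
  qed
  then obtain h where h: "\<forall>x\<in>Ai. h x \<in> Aj - {y} \<and> h x \<sim> x" by (elim bchoice[THEN exE])
  have "inj_on h Ai"
  proof (rule inj_onI, rule ccontr)
    fix x x' assume xx: "x \<in> Ai" "x' \<in> Ai" "h x = h x'" "x \<noteq> x'"
    have "h x \<in> Aj - {y}" "h x \<sim> x" "h x \<sim> x'" using h xx by auto
    moreover have "\<not> x \<sim> x'" using cne[of x x'] xx by (auto simp: Ai_def)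
    ultimately have "y \<sim> h x"
      using P3_centre_universal[of x "h x" x' y] xx y(1) adj_sym[of "h x" x] by (auto simp: Ai_def Aj_def)
    then show False using cne[of y "h x"] \<open>h x \<in> Aj - {y}\<close> y(1) by (auto simp: Aj_def j_def)
  qed
  then have "card Ai \<le> card (Aj - {y})"
    using h fin by (intro card_inj_on_le) auto
  moreover have "y \<in> Aj" using y(1) yT by (simp add: Aj_def j_def)
  ultimately have "card Ai < card Aj" using fin by (metis card_Diff1_less order_le_less_trans)
  then have "concentration k c < concentration k d"
    using concentration_less[OF i jk ij other mult] le by (simp add: j_def)
  then show False using max[OF d] by simp
qed

text \<open>Let \<open>N\<close> be the closed neighbourhood in \<open>S\<close> of a suitable
  vertex \<open>y\<close>. It is a clique containing every colour used on \<open>S\<close>, so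
  \<open>N \<union> C\<close> is a clique and at least \<open>card C\<close> of the \<open>k\<close>
  colours are absent from \<open>S\<close>. Vertices of \<open>C\<close> have no neighbours in
  \<open>R\<close>, so these colours suffice for them.\<close>

lemma colourable_extend:
  assumes c: "colourable (R \<union> S) k" and S: "\<not> clq S" and C: "clq C"
    and w: "clqs_le (R \<union> S \<union> C) w" "w \<le> k"
  shows "colourable (R \<union> S \<union> C) k"
proof -
  let ?P = "proper (R \<union> S) k"
  obtain c0 where "?P c0" using c by (auto simp: colourable_def)
  moreover have "\<forall>d. ?P d \<longrightarrow> concentration k d < Suc (k * (card S)\<^sup>2)"
    using concentration_bound by (simp add: less_Suc_eq_le)
  ultimately have "\<exists>c. ?P c \<and> (\<forall>d. ?P d \<longrightarrow> concentration k d \<le> concentration k c)"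
    using ex_has_greatest_nat[of ?P c0 "concentration k"] by blast
  then obtain c where c: "?P c" and max: "\<And>d. ?P d \<Longrightarrow> concentration k d \<le> concentration k c" by blast
  have cne: "c a \<noteq> c b" if "a \<in> R \<union> S" "b \<in> R \<union> S" "a \<sim> b" for a b
    using c that by (auto simp: proper_def)
  have ck: "c s < k" if "s \<in> S" for s using c that by (auto simp: proper_def)
  define U where "U = {s \<in> S. \<forall>t\<in>S. t \<noteq> s \<longrightarrow> s \<sim> t}"
  have "S - U \<noteq> {}" using S by (auto simp: U_def clq_def)
  \<comment> \<open>Two conditions meet in \<open>y\<close>: having a nonneighbour in
    \<open>S\<close> stops it from being the centre of an induced path, so \<open>N\<close> is a
    clique, and having a rarest colour among such vertices is the inequality that
    \<open>Kempe_swap\<close> requires. Vertices of \<open>U\<close> are adjacent to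
    \<open>y\<close> in any case.\<close>
  then obtain y where y: "y \<in> S - U" and min: "\<And>s. s \<in> S - U \<Longrightarrow> multiplicity_in c (c y) \<le> multiplicity_in c (c s)"
    using finite(2) arg_min_if_finite[of "S - U" "\<lambda>s. multiplicity_in c (c s)"]
    by (metis finite_Diff not_le_imp_less)
  define N where "N = insert y {s \<in> S. y \<sim> s}"
  have NS: "N \<subseteq> S" using y by (auto simp: N_def)
  have "clq N"
  proof -
    have "s \<sim> t" if "s \<in> S" "t \<in> S" "y \<sim> s" "y \<sim> t" "s \<noteq> t" for s t
    proof (rule ccontr)
      assume "\<not> s \<sim> t"
      then have "w = y \<or> w \<sim> y" if "w \<in> S" for w
        using P3_centre_universal[of s y t w] that \<open>s \<in> S\<close> \<open>t \<in> S\<close> \<open>y \<sim> s\<close> \<open>y \<sim> t\<close> \<open>s \<noteq> t\<close> y adj_sym[of y s] by blast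
      then have "y \<in> U" using y adj_sym by (auto simp: U_def)
      then show False using y by blast
    qed
    then show ?thesis by (auto simp: N_def clq_def adj_sym)
  qed
  have cS: "c ` S \<subseteq> c ` N"
  proof
    fix i assume "i \<in> c ` S"
    then obtain s where s: "s \<in> S" "i = c s" by blast
    show "i \<in> c ` N"
    proof (cases "s \<in> U")
      case True
      then have "y \<noteq> s" using y by blast
      then have "s \<sim> y" using True y by (simp add: U_def)
      then have "y \<sim> s" by (rule adj_sym)
      then show ?thesis using s by (simp add: N_def)
    next
      case False
      show ?thesis
      proof (cases "c s = c y")
        case True then show ?thesis using s by (auto simp: N_def)
      next
        case ne: False
        then obtain t where "t \<in> S" "y \<sim> t" "c t = c s"
          using Kempe_swap[OF c max ck[OF s(1)], of y] min[of s] False s y by auto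
        then show ?thesis using s by (auto simp: N_def intro!: image_eqI[of _ _ t])
      qed
    qed
  qed
  have finN: "finite N" using NS finite(2) finite_subset by blast
  have "clq (N \<union> C)"
    unfolding clq_def
  proof (intro ballI impI)
    fix a b assume ab: "a \<in> N \<union> C" "b \<in> N \<union> C" "a \<noteq> b"
    consider "a \<in> N" "b \<in> N" | "a \<in> C" "b \<in> C" | "a \<in> C" "b \<in> S" | "a \<in> S" "b \<in> C"
      using ab NS by auto
    then show "a \<sim> b"
      using \<open>clq N\<close> C SC[of b a] SC[of a b] adj_sym[of b a] ab(3) by cases (auto simp: clq_def)
  qed
  moreover have "N \<union> C \<subseteq> R \<union> S \<union> C" using NS by auto
  ultimately have "card (N \<union> C) \<le> w" using w(1) unfolding clqs_le_def by simp
  moreover have "card (N \<union> C) = card N + card C"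
    using finN finite(3) NS disj(3) by (intro card_Un_disjoint) auto
  moreover have "card (c ` S) \<le> card N"
    using cS finN by (meson card_image_le card_mono finite_imageI le_trans)
  moreover have "card ({..<k} - c ` S) = k - card (c ` S)"
    using ck finite(2) by (subst card_Diff_subset) auto
  ultimately have "card C \<le> card ({..<k} - c ` S)" using w(2) by linarith
  then obtain g where g: "inj_on g C" "g ` C \<subseteq> {..<k} - c ` S"
    using card_le_inj[of C "{..<k} - c ` S"] finite(3) by auto
  have "proper (R \<union> S \<union> C) k (\<lambda>x. if x \<in> C then g x else c x)"
    unfolding proper_def
  proof (intro conjI ballI impI)
    fix a assume "a \<in> R \<union> S \<union> C"
    then show "(if a \<in> C then g a else c a) < k" using g(2) c by (auto simp: proper_def)
  next
    fix a b assume ab: "a \<in> R \<union> S \<union> C" "b \<in> R \<union> S \<union> C" "a \<sim> b"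
    have gc: "g x \<noteq> c z" if "x \<in> C" "z \<in> R \<union> S" "x \<sim> z" for x z
    proof -
      have "z \<in> S" using that RC by blast
      then show ?thesis using g(2) that(1) by auto
    qed
    show "(if a \<in> C then g a else c a) \<noteq> (if b \<in> C then g b else c b)"
    proof (cases "a \<in> C"; cases "b \<in> C")
      assume "a \<in> C" "b \<in> C"
      then show ?thesis using g(1) ab(3) adj_irrefl by (auto dest: inj_onD)
    next
      assume "a \<in> C" "b \<notin> C"
      then show ?thesis using gc[of a b] ab by auto
    next
      assume "a \<notin> C" "b \<in> C"
      then show ?thesis using gc[of b a] ab adj_sym[OF ab(3)] by auto
    next
      assume "a \<notin> C" "b \<notin> C"
      then show ?thesis using cne[of a b] ab by auto
    qed
  qed
  then show ?thesis by (auto simp: colourable_def)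
qed

end

context reduced_graph
begin

subsection \<open>The bound\<close>

definition separating :: "'a set \<Rightarrow> bool" where
  "separating R \<longleftrightarrow> R \<subseteq> V \<and> R \<noteq> {} \<and> conn R \<and> (\<exists>x\<in>V - R. \<forall>r\<in>R. \<not> x \<sim> r)"

text \<open>If \<open>x\<close> in \<open>C\<close> missed some \<open>s\<close> in
  \<open>S\<close>, then \<open>insert s R\<close> would be a larger set of the same kind, still not
  dominating \<open>x\<close>. As \<open>S\<close> is no clique cutset, it contains two nonadjacent
  vertices, and being common neighbours of all of \<open>C\<close> they make \<open>C\<close> a
  clique.\<close>

lemma obtain_separation:
  assumes "V \<noteq> {}" and no_C7: "\<And>a b c d e f g. C7 a b c d e f g \<Longrightarrow> \<not> {a, b, c, d, e, f, g} \<subseteq> V"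
  shows "\<exists>R S C v. R \<union> S \<union> C = V \<and> \<not> clq S \<and> clq C \<and> C7_free_separation adj R S C v"
proof -
  obtain u where u: "u \<in> V" using assms(1) by blast
  then obtain x where "x \<in> V" "x \<noteq> u" "\<not> u \<sim> x" using no_universal by blast
  \<comment> \<open>Such sets exist: a single vertex that is not universal is one.\<close>
  then have "separating {u}" using u adj_commute[of u x] by (auto simp: separating_def conn_def)
  moreover have "\<forall>R. separating R \<longrightarrow> card R < Suc (card V)"
    using finite_V by (auto simp: separating_def less_Suc_eq_le intro: card_mono)
  ultimately obtain R where R: "separating R" and max: "\<And>R'. separating R' \<Longrightarrow> card R' \<le> card R"
    using ex_has_greatest_nat[of separating "{u}" card] by blast
  have RV: "R \<subseteq> V" "R \<noteq> {}" "conn R" using R by (auto simp: separating_def)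
  have finR: "finite R" using RV(1) finite_V finite_subset by blast
  define S where "S = {s \<in> V - R. \<exists>r\<in>R. r \<sim> s}"
  define C where "C = V - R - S"
  have CR: "\<not> x \<sim> r" if "x \<in> C" "r \<in> R" for x r
    using that adj_sym by (auto simp: C_def S_def)
  obtain v where "v \<in> V - R" and "\<And>r. r \<in> R \<Longrightarrow> \<not> v \<sim> r" using R by (auto simp: separating_def)
  moreover from this have "\<not> r \<sim> v" if "r \<in> R" for r using that adj_sym by blast
  ultimately have v: "v \<in> C" by (auto simp: C_def S_def)
  have SC: "x \<sim> s" if s: "s \<in> S" and x: "x \<in> C" for s x
  proof (rule ccontr)
    assume "\<not> x \<sim> s"
    obtain r where "r \<in> R" "r \<sim> s" using s by (auto simp: S_def)
    then have "conn (insert s R)" using conn_insert RV(3) by blast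
    moreover have "x \<in> V - insert s R" "insert s R \<subseteq> V" using s x RV(1) by (auto simp: C_def S_def)
    ultimately have "separating (insert s R)"
      using CR[OF x] \<open>\<not> x \<sim> s\<close> unfolding separating_def by blast
    then have "card (insert s R) \<le> card R" by (rule max)
    moreover have "s \<notin> R" using s by (auto simp: S_def)
    ultimately show False using finR by simp
  qed
  have part: "(R \<union> S) \<union> (S \<union> C) = V" "R \<union> S \<union> C = V" using RV(1) by (auto simp: S_def C_def)
  have disj: "R \<inter> S = {}" "R \<inter> C = {}" "S \<inter> C = {}" by (auto simp: S_def C_def)
  have nS: "\<not> clq S"
  proof
    assume S: "clq S"
    have "(R \<union> S) \<inter> (S \<union> C) = S" "R \<union> S - (S \<union> C) = R" "S \<union> C - (R \<union> S) = C" using disj by auto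
    moreover have "R \<union> S \<noteq> V" "S \<union> C \<noteq> V" using part disj v RV(2) by blast+
    ultimately have "\<exists>a\<in>R. \<exists>b\<in>C. a \<sim> b" using no_clique_cutset[OF part(1)] S by simp
    then show False using CR adj_sym by blast
  qed
  then obtain s t where st: "s \<in> S" "t \<in> S" "s \<noteq> t" "\<not> s \<sim> t" by (auto simp: clq_def)
  have "clq C" unfolding clq_def
  proof (intro ballI impI)
    fix x y assume xy: "x \<in> C" "y \<in> C" "x \<noteq> y"
    show "x \<sim> y"
      by (rule common_nbrs_adj[of x s t y]) (use SC st xy in auto)
  qed
  moreover have "C7_free_separation adj R S C v"
  proof
    show "finite R" "finite S" "finite C" using finR finite_V by (auto simp: S_def C_def)
    show "\<And>s. s \<in> S \<Longrightarrow> \<exists>r\<in>R. r \<sim> s" by (auto simp: S_def)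
  next
    fix a b c d e f g
    assume "{a, b, c, d, e, f, g} \<subseteq> R \<union> S \<union> C" "a \<sim> b" "b \<sim> c" "c \<sim> d" "d \<sim> e" "e \<sim> f" "f \<sim> g" "g \<sim> a"
      "\<not> a \<sim> c" "\<not> b \<sim> d" "\<not> c \<sim> e" "\<not> d \<sim> f" "\<not> e \<sim> g" "\<not> f \<sim> a" "\<not> g \<sim> b"
      "\<not> a \<sim> d" "\<not> b \<sim> e" "\<not> c \<sim> f" "\<not> d \<sim> g" "\<not> e \<sim> a" "\<not> f \<sim> b" "\<not> g \<sim> c"
    moreover from this have "C7 a b c d e f g" unfolding C7_def by simp
    ultimately show False using no_C7[of a b c d e f g] part(2) by simp
  qed (use disj RV(3) SC CR v in auto)
  ultimately show ?thesis using part(2) nS by blast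
qed

end

section \<open>The induction on the vertex set\<close>

context p7_c4_c5_free
begin

theorem colourable_three_halves:
  assumes "finite V" "clqs_le V w"
  shows "colourable V (3 * w div 2)"
  using assms
proof (induction V arbitrary: w rule: finite_psubset_induct)
  case (psubset V)
  show ?case
  proof (cases "V = {}")
    case True
    then show ?thesis by (auto simp: colourable_def proper_def)
  next
    case ne: False
    show ?thesis
    proof (cases "\<exists>A B. A \<union> B = V \<and> A \<noteq> V \<and> B \<noteq> V \<and> clq (A \<inter> B) \<and> (\<forall>a\<in>A - B. \<forall>b\<in>B - A. \<not> a \<sim> b)")
      case True
      then obtain A B where AB: "A \<union> B = V" "A \<noteq> V" "B \<noteq> V" "clq (A \<inter> B)"
        "\<forall>a\<in>A - B. \<forall>b\<in>B - A. \<not> a \<sim> b" by blast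
      have sub: "A \<subset> V" "B \<subset> V" using AB by auto
      have "colourable A (3 * w div 2)" "colourable B (3 * w div 2)"
        by (rule psubset.IH[OF sub(1) clqs_le_mono[OF psubset.prems psubset_imp_subset[OF sub(1)]]],
            rule psubset.IH[OF sub(2) clqs_le_mono[OF psubset.prems psubset_imp_subset[OF sub(2)]]])
      then have "colourable (A \<union> B) (3 * w div 2)"
        by (rule colourable_clique_cutset) (use AB(4,5) in blast)+
      then show ?thesis using AB(1) by simp
    next
      case no_cutset: False
      show ?thesis
      proof (cases "\<exists>u\<in>V. \<forall>x\<in>V. x \<noteq> u \<longrightarrow> u \<sim> x")
        case True
        then obtain u where u: "u \<in> V" "\<And>x. x \<in> V \<Longrightarrow> x \<noteq> u \<Longrightarrow> u \<sim> x" by blast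
        note w = colourable_universal[OF psubset.hyps u psubset.prems]
        have "colourable (V - {u}) (3 * (w - 1) div 2)"
          by (rule psubset.IH[OF _ w(1)]) (use u(1) in blast)
        moreover have "colourable {u} 1" using colourable_card[of "{u}"] by simp
        ultimately have "colourable (V - {u} \<union> {u}) (3 * (w - 1) div 2 + 1)" by (rule colourable_Un)
        then show ?thesis by (rule colourable_mono) (use w(2) in auto)
      next
        case no_univ: False
        interpret reduced_graph adj V
        proof
          show "finite V" by (fact psubset.hyps)
          show "\<exists>a\<in>A - B. \<exists>b\<in>B - A. a \<sim> b" if "A \<union> B = V" "A \<noteq> V" "B \<noteq> V" "clq (A \<inter> B)" for A B
            using that no_cutset by blast
          show "\<exists>x\<in>V. x \<noteq> u \<and> \<not> u \<sim> x" if "u \<in> V" for u using that no_univ by blast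
        qed
        have removable: "colourable V (3 * w div 2)"
          if T: "removable T k m" and km: "k = 3 \<and> m = 2 \<or> k = 4 \<and> m = 3" for T k m
        proof -
          have TV: "T \<subseteq> V" "T \<noteq> {}" "colourable T k" using T by (auto simp: removable_def)
          have drop: "card K + m \<le> w" if K: "K \<subseteq> V - T" "clq K" for K
          proof -
            have "\<exists>L\<subseteq>T. card L = m \<and> clq (K \<union> L)" using T K by (simp add: removable_def)
            then obtain L where L: "L \<subseteq> T" "card L = m" "clq (K \<union> L)" by blast
            have "K \<union> L \<subseteq> V" using K L TV by auto
            then have "card (K \<union> L) \<le> w" using psubset.prems L(3) by (simp add: clqs_le_def)
            moreover have "finite K" "finite L" "K \<inter> L = {}"
              using K(1) L(1) TV(1) by (auto intro: finite_subset[OF _ finite_V])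
            ultimately show ?thesis using L(2) by (simp add: card_Un_disjoint)
          qed
          \<comment> \<open>The empty clique extends as well, so \<open>w - m\<close> is a genuine
            difference.\<close>
          have "m \<le> w" using drop[of "{}"] by (simp add: clq_def)
          have "clqs_le (V - T) (w - m)" unfolding clqs_le_def using drop by (simp add: le_diff_conv2 \<open>m \<le> w\<close>)
          then have "colourable (V - T) (3 * (w - m) div 2)"
            by (rule psubset.IH[rotated]) (use TV in blast)
          then have "colourable (V - T \<union> T) (3 * (w - m) div 2 + k)" using TV(3) by (rule colourable_Un)
          moreover have "3 * (w - m) div 2 + k \<le> 3 * w div 2" using km \<open>m \<le> w\<close> by presburger
          moreover have "V \<subseteq> V - T \<union> T" by blast
          ultimately show ?thesis using colourable_mono by blast
        qed
        show ?thesis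
        proof (rule ccontr)
          assume not_col: "\<not> ?thesis"
          have "\<not> {a, b, c, d, e, f, g} \<subseteq> V" if "C7 a b c d e f g" for a b c d e f g
            using C7_reduction[OF that] removable not_col by iprover
          from obtain_separation[OF ne this] obtain R S C v where RSC: "R \<union> S \<union> C = V" "\<not> clq S" "clq C"
            and sep: "C7_free_separation adj R S C v"
            by iprover
          interpret sep: C7_free_separation adj R S C v by (fact sep)
          have sub: "R \<union> S \<subset> V" using RSC(1) sep.v sep.disj by blast
          have "colourable (R \<union> S) (3 * w div 2)"
            by (rule psubset.IH[OF sub clqs_le_mono[OF psubset.prems psubset_imp_subset[OF sub]]])
          \<comment> \<open>Without 7-cycles no colour is added: it suffices that the palette has at
            least \<open>w\<close> colours.\<close>
          moreover have "w \<le> 3 * w div 2" by simp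
          ultimately show False
            using sep.colourable_extend[OF _ RSC(2,3)] psubset.prems not_col unfolding RSC(1) by blast
        qed
      qed
    qed
  qed
qed

end

section \<open>Transfer to pair graphs\<close>

lemma family_freeD:
  assumes "pair_graph G" "\<And>F. F \<in> \<H> \<Longrightarrow> pair_graph F" "family_free \<H> G" "F \<in> \<H>"
    and "pverts F = {..<n}" "length xs = n" "distinct xs" "set xs \<subseteq> pverts G"
  shows "\<exists>i<n. \<exists>j<n. (i, j) \<in> parcs F \<longleftrightarrow> (xs ! i, xs ! j) \<notin> parcs G"
proof (rule ccontr)
  assume "\<not> ?thesis"
  \<comment> \<open>The list is read as the map sending \<open>i\<close> to \<open>xs ! i\<close>;
    agreement at all pairs would make it an induced copy of \<open>F\<close>.\<close>
  then have "\<forall>i\<in>pverts F. \<forall>j\<in>pverts F. (i, j) \<in> parcs F \<longleftrightarrow> (xs ! i, xs ! j) \<in> parcs G"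
    using assms(5) by auto
  moreover have "inj_on ((!) xs) (pverts F)"
    using assms(5-7) by (auto simp: inj_on_def nth_eq_iff_index_eq)
  moreover have "(!) xs ` pverts F \<subseteq> pverts G" using assms(5,6,8) by auto
  ultimately show False using assms(3,4) family_free_iff[OF assms(1,2)] by blast
qed

text \<open>A configuration without chords is a list of distinct vertices that agrees with the
  forbidden graph at every pair of positions. \<open>family_freeD\<close> yields a pair where they
  differ, which a check of the finitely many pairs refutes.\<close>

lemma family_free_imp_locale:
  assumes G: "pair_graph G" and free: "family_free {path_graph 7, cycle_graph 4, cycle_graph 5} G"
  shows "p7_c4_c5_free (\<lambda>x y. (x, y) \<in> parcs G)"
proof -
  interpret pair_graph G by fact
  let ?H = "{path_graph 7, cycle_graph 4, cycle_graph 5}"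
  let ?adj = "\<lambda>x y. (x, y) \<in> parcs G"
  have sym: "?adj x y \<Longrightarrow> ?adj y x" for x y
    by (meson graph_symmetric)
  have irr: "\<not> ?adj x x" for x using pair_no_loops[of "(x, x)"] by auto
  have V: "x \<in> pverts G \<and> y \<in> pverts G" if "?adj x y" for x y
    using that in_arcsD1 in_arcsD2 by blast
  have sym_iff: "?adj x y \<longleftrightarrow> ?adj y x" for x y using sym by blast
  have H: "\<And>F. F \<in> ?H \<Longrightarrow> pair_graph F"
    using pair_graph_path_graph pair_graph_cycle_graph by auto
  note freeD = family_freeD[OF G H free]
  show ?thesis
  proof
    fix a b c d
    assume e: "?adj a b" "?adj b c" "?adj c d" "?adj d a" "a \<noteq> c" "b \<noteq> d"
    show "?adj a c \<or> ?adj b d"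
    proof (rule ccontr)
      assume n: "\<not> ?thesis"
      have "distinct [a, b, c, d]" "set [a, b, c, d] \<subseteq> pverts G" using e irr V by auto
      then have "\<exists>i<4. \<exists>j<4.
          (i, j) \<in> parcs (cycle_graph 4) \<longleftrightarrow> ([a, b, c, d] ! i, [a, b, c, d] ! j) \<notin> parcs G"
        by (intro freeD) (simp_all add: cycle_graph_def)
      then obtain i j where "i < 4" "j < 4"
        and ij: "(i, j) \<in> parcs (cycle_graph 4) \<longleftrightarrow> ([a, b, c, d] ! i, [a, b, c, d] ! j) \<notin> parcs G"
        by blast
      then have "i \<in> {0, 1, 2, 3}" "j \<in> {0, 1, 2, 3}" by auto
      then show False using ij e n irr sym_iff by (elim insertE emptyE) (simp_all add: cycle_graph_def)
    qed
  next
    fix a b c d e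
    assume e: "?adj a b" "?adj b c" "?adj c d" "?adj d e" "?adj e a"
    show "?adj a c \<or> ?adj b d \<or> ?adj c e \<or> ?adj d a \<or> ?adj e b"
    proof (rule ccontr)
      assume n: "\<not> ?thesis"
      have "distinct [a, b, c, d, e]" "set [a, b, c, d, e] \<subseteq> pverts G"
        using e n irr sym V by auto
      then have "\<exists>i<5. \<exists>j<5.
          (i, j) \<in> parcs (cycle_graph 5) \<longleftrightarrow> ([a, b, c, d, e] ! i, [a, b, c, d, e] ! j) \<notin> parcs G"
        by (intro freeD) (simp_all add: cycle_graph_def)
      then obtain i j where "i < 5" "j < 5"
        and ij: "(i, j) \<in> parcs (cycle_graph 5) \<longleftrightarrow> ([a, b, c, d, e] ! i, [a, b, c, d, e] ! j) \<notin> parcs G"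
        by blast
      then have "i \<in> {0, 1, 2, 3, 4}" "j \<in> {0, 1, 2, 3, 4}" by auto
      then show False using ij e n irr sym_iff by (elim insertE emptyE) (simp_all add: cycle_graph_def)
    qed
  next
    fix a b c d e f g
    assume e: "?adj a b" "?adj b c" "?adj c d" "?adj d e" "?adj e f" "?adj f g"
    show "?adj a c \<or> ?adj a d \<or> ?adj a e \<or> ?adj a f \<or> ?adj a g \<or> ?adj b d \<or> ?adj b e \<or> ?adj b f \<or> ?adj b g \<or>
      ?adj c e \<or> ?adj c f \<or> ?adj c g \<or> ?adj d f \<or> ?adj d g \<or> ?adj e g"
    proof (rule ccontr)
      assume n: "\<not> ?thesis"
      have "distinct [a, b, c, d, e, f, g]" "set [a, b, c, d, e, f, g] \<subseteq> pverts G"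
        using e n irr sym V by auto
      then have "\<exists>i<7. \<exists>j<7.
          (i, j) \<in> parcs (path_graph 7) \<longleftrightarrow> ([a, b, c, d, e, f, g] ! i, [a, b, c, d, e, f, g] ! j) \<notin> parcs G"
        by (intro freeD) (simp_all add: path_graph_def)
      then obtain i j where "i < 7" "j < 7"
        and ij: "(i, j) \<in> parcs (path_graph 7) \<longleftrightarrow> ([a, b, c, d, e, f, g] ! i, [a, b, c, d, e, f, g] ! j) \<notin> parcs G"
        by blast
      then have "i \<in> {0, 1, 2, 3, 4, 5, 6}" "j \<in> {0, 1, 2, 3, 4, 5, 6}" by auto
      then show False using ij e n irr sym_iff by (elim insertE emptyE) (simp_all add: path_graph_def)
    qed
  qed (use sym irr in auto)
qed

theorem theorem4p14:
  fixes G :: "'a pair_pre_digraph"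
  assumes "pair_graph G"
    and "pverts G \<noteq> {}"
    and "family_free {path_graph 7, cycle_graph 4, cycle_graph 5} G"
  shows "int (chromatic_number G) \<le> \<lfloor>(3 / 2 :: real) * real (clique_number G)\<rfloor>"
proof -
  interpret G: pair_graph G by fact
  interpret p7_c4_c5_free "\<lambda>x y. (x, y) \<in> parcs G"
    by (rule family_free_imp_locale[OF assms(1,3)])
  let ?w = "clique_number G"
  have "clqs_le (pverts G) ?w"
    using clique_number_attained(2)[OF assms(1)] by (auto simp: clqs_le_def clq_def clique_def)
  then have "colourable (pverts G) (3 * ?w div 2)"
    by (intro colourable_three_halves) (rule G.pair_finite_verts)
  then obtain c where "proper (pverts G) (3 * ?w div 2) c" by (auto simp: colourable_def)
  then have "proper_colouring G (3 * ?w div 2) c"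
    using G.in_arcsD1 G.in_arcsD2 unfolding proper_def proper_colouring_def by blast
  then have "chromatic_number G \<le> 3 * ?w div 2"
    unfolding chromatic_number_def by (blast intro: Least_le)
  \<comment> \<open>Clearing the denominator links the integer division with the floor of the real
    number.\<close>
  then have "2 * chromatic_number G \<le> 3 * ?w" by linarith
  then have "2 * real (chromatic_number G) \<le> 3 * real ?w" by linarith
  then show ?thesis by (simp add: le_floor_iff)
qed

end
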